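(* Let $\widehat{\mathcal{A}}_\infty$ and $\widehat{\mathcal{B}}_\infty$ be UHF algebras with canonical masas $\widehat{\mathcal{D}}_\infty$ and $\widehat{\mathcal{E}}_\infty$, respectively. Let $\widehat{\mathcal{S}}_\infty\subseteq\widehat{\mathcal{A}}_\infty$ be a concrete operator $\widehat{\mathcal{D}}_\infty$-system and $\widehat{\mathcal{T}}_\infty\subseteq\widehat{\mathcal{B}}_\infty$ a concrete operator $\widehat{\mathcal{E}}_\infty$-system, with associated inductive systems $(\mathcal{S}_k)_{k\in\mathbb{N}}$ and $(\mathcal{T}_k)_{k\in\mathbb{N}}$. The following are equivalent: (i) there exists a unital complete order isomorphism $\phi:\widehat{\mathcal{S}}_\infty\to\widehat{\mathcal{T}}_\infty$ such that $\phi(\widehat{\mathcal{D}}_\infty)=\widehat{\mathcal{E}}_\infty$; (ii) there exist subsequences $(\mathcal{S}_{m_k})_{k\in\mathbb{N}}$ and $(\mathcal{T}_{n_k})_{k\in\mathbb{N}}$ and unital completely positive maps $\phi_1:\mathcal{S}_1\to\mathcal{T}_{n_1}$, $\phi_{k+1}:\mathcal{S}_{m_k}\to\mathcal{T}_{n_{k+1}}$ and $\psi_k:\mathcal{T}_{n_k}\to\mathcal{S}_{m_k}$ ($k\in\mathbb{N}$) such that (a) the diagram with top row $\mathcal{S}_1\to\mathcal{S}_{m_1}\to\mathcal{S}_{m_2}\to\cdots$ and bottom row $\mathcal{T}_{n_1}\to\mathcal{T}_{n_2}\to\mathcal{T}_{n_3}\to\cdots$ (horizontal arrows being the connecting maps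 of the inductive systems), vertical arrows $\phi_k$ and diagonal arrows $\psi_k$, commutes; that is, $\psi_1\circ\phi_1$ is the connecting map $\mathcal{S}_1\to\mathcal{S}_{m_1}$, $\psi_{k+1}\circ\phi_{k+1}$ is the connecting map $\mathcal{S}_{m_k}\to\mathcal{S}_{m_{k+1}}$, and $\phi_{k+1}\circ\psi_k$ is the connecting map $\mathcal{T}_{n_k}\to\mathcal{T}_{n_{k+1}}$, for all $k\in\mathbb{N}$; and (b) $\phi_{k+1}(\mathcal{D}_{m_k})\subseteq\mathcal{E}_{n_{k+1}}$ and $\psi_k(\mathcal{E}_{n_k})\subseteq\mathcal{D}_{m_k}$ for all $k\in\mathbb{N}$.
   Context: UHF setting: $(p_k)_{k\in\mathbb{N}}$ are positive integers with $p_k\mid p_{k+1}$, $e^k_{i,j}$ are the canonical matrix units of $M_{p_k}(\mathbb{C})$, and $\pi_k:M_{p_k}\to M_{p_{k+1}}$ is the unital $*$-homomorphism with $\pi_k(e^k_{i,j})=\sum_{r=0}^{p_{k+1}/p_k-1}e^{k+1}_{rp_k+i,\,rp_k+j}$. $\widehat{\mathcal{A}}_\infty=\varinjlim_{\mathbf{C}^*}(M_{p_k},\pi_k)$; $\mathcal{A}_k\cong M_{p_k}$ is the image of $M_{p_k}$ in $\widehat{\mathcal{A}}_\infty$, $\mathcal{D}_k\subseteq\mathcal{A}_k$ is the algebra of diagonal matrices, and $\widehat{\mathcal{D}}_\infty=\overline{\bigcup_k\mathcal{D}_k}$ is the canonical masa. The algebra $\widehat{\mathcal{B}}_\infty$,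 with subalgebras $\mathcal{B}_k$, diagonals $\mathcal{E}_k$ and canonical masa $\widehat{\mathcal{E}}_\infty=\overline{\bigcup_k\mathcal{E}_k}$, is defined in the same way from another such sequence of matrix algebras. A concrete operator $\widehat{\mathcal{D}}_\infty$-system is a norm-closed selfadjoint subspace $\widehat{\mathcal{S}}_\infty\subseteq\widehat{\mathcal{A}}_\infty$ with $\widehat{\mathcal{D}}_\infty\subseteq\widehat{\mathcal{S}}_\infty$ and $\widehat{\mathcal{D}}_\infty\widehat{\mathcal{S}}_\infty\widehat{\mathcal{D}}_\infty\subseteq\widehat{\mathcal{S}}_\infty$, with the inherited operator system structure; similarly for $\widehat{\mathcal{E}}_\infty$. The inductive system associated with $\widehat{\mathcal{S}}_\infty$ is given by $\mathcal{S}_k=\widehat{\mathcal{S}}_\infty\cap\mathcal{A}_k$ with connecting maps the inclusions (restrictions of the $\pi_k$); one has $\widehat{\mathcal{S}}_\infty=\overline{\bigcup_k\mathcal{S}_k}$. Likewise $\mathcal{T}_k=\widehat{\mathcal{T}}_\infty\cap\mathcal{B}_k$. A unital complete order isomorphism is a unital linear bijection, completely positive with completely positive inverse. *)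

theory Defs
  imports "HOL-Analysis.Analysis" "Jordan_Normal_Form.Matrix"
begin

section \<open>Unital C*-algebras\<close>

class cstar_algebra = real_normed_algebra_1 + banach +
  fixes scaleC :: "complex \<Rightarrow> 'a \<Rightarrow> 'a"
    and star :: "'a \<Rightarrow> 'a"
  assumes scaleC_add_right: "scaleC c (x + y) = scaleC c x + scaleC c y"
    and scaleC_add_left: "scaleC (c + d) x = scaleC c x + scaleC d x"
    and scaleC_scaleC: "scaleC c (scaleC d x) = scaleC (c * d) x"
    and scaleC_of_real: "scaleC (complex_of_real r) x = scaleR r x"
    and scaleC_mult_left: "scaleC c x * y = scaleC c (x * y)"
    and scaleC_mult_right: "x * scaleC c y = scaleC c (x * y)"
    and norm_scaleC: "norm (scaleC c x) = cmod c * norm x"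
    and star_star: "star (star x) = x"
    and star_add: "star (x + y) = star x + star y"
    and star_scaleC: "star (scaleC c x) = scaleC (cnj c) (star x)"
    and star_mult: "star (x * y) = star y * star x"
    and norm_star_mult: "norm (star x * x) = (norm x)\<^sup>2"

instantiation complex :: cstar_algebra
begin

definition scaleC_complex :: "complex \<Rightarrow> complex \<Rightarrow> complex" where
  "scaleC_complex c x = c * x"

definition star_complex :: "complex \<Rightarrow> complex" where
  "star_complex = cnj"

instance
  by standard
    (auto simp: scaleC_complex_def star_complex_def algebra_simps norm_mult
        scaleR_conv_of_real power2_eq_square)

end

definition complex_subspace :: "'a::cstar_algebra set \<Rightarrow> bool" where
  "complex_subspace S \<longleftrightarrow>
     0 \<in> S \<and> (\<forall>x\<in>S. \<forall>y\<in>S. x + y \<in> S) \<and> (\<forall>c. \<forall>x\<in>S. scaleC c x \<in> S)"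

definition complex_linear_on ::
    "'a::cstar_algebra set \<Rightarrow> ('a \<Rightarrow> 'b::cstar_algebra) \<Rightarrow> bool" where
  "complex_linear_on S f \<longleftrightarrow>
     (\<forall>x\<in>S. \<forall>y\<in>S. f (x + y) = f x + f y) \<and> (\<forall>c. \<forall>x\<in>S. f (scaleC c x) = scaleC c (f x))"


section \<open>Matrices over a C*-algebra and completely positive maps\<close>

text \<open>For complex entries this is the conjugate transpose.\<close>

definition mat_star :: "'a::cstar_algebra mat \<Rightarrow> 'a mat" where
  "mat_star X = map_mat star (transpose_mat X)"

text \<open>The positive elements of the C*-algebra of \<open>n \<times> n\<close> matrices over \<open>'a\<close>.\<close>

definition mat_positive :: "nat \<Rightarrow> 'a::cstar_algebra mat \<Rightarrow> bool" where
  "mat_positive n X \<longleftrightarrow> (\<exists>Y \<in> carrier_mat n n. X = mat_star Y * Y)"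

text \<open>
  Here \<open>S\<close> and \<open>T\<close> are subspaces of unital C*-algebras with the inherited operator system
  structure: the positive cone at matrix level \<open>n\<close> consists of the matrices with entries in the
  subspace that are positive over the ambient algebra.
\<close>

definition completely_positive_map ::
    "'a::cstar_algebra set \<Rightarrow> 'b::cstar_algebra set \<Rightarrow> ('a \<Rightarrow> 'b) \<Rightarrow> bool" where
  "completely_positive_map S T f \<longleftrightarrow>
     f ` S \<subseteq> T \<and> complex_linear_on S f \<and>
     (\<forall>n X. mat_positive n X \<and> elements_mat X \<subseteq> S \<longrightarrow> mat_positive n (map_mat f X))"

definition ucp_map ::
    "'a::cstar_algebra set \<Rightarrow> 'b::cstar_algebra set \<Rightarrow> ('a \<Rightarrow> 'b) \<Rightarrow> bool" where
  "ucp_map S T f \<longleftrightarrow> completely_positive_map S T f \<and> f 1 = 1"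

definition unital_complete_order_iso ::
    "'a::cstar_algebra set \<Rightarrow> 'b::cstar_algebra set \<Rightarrow> ('a \<Rightarrow> 'b) \<Rightarrow> bool" where
  "unital_complete_order_iso S T f \<longleftrightarrow>
     bij_betw f S T \<and> ucp_map S T f \<and> completely_positive_map T S (inv_into S f)"


section \<open>UHF algebras and their canonical masas\<close>

text \<open>
  The connecting map from \<open>p \<times> p\<close> to \<open>q \<times> q\<close> matrices, for \<open>p\<close> dividing \<open>q\<close>: the block diagonal
  matrix with \<open>q div p\<close> copies of \<open>x\<close>. Indices start at 0.
\<close>

definition uhf_connect :: "nat \<Rightarrow> nat \<Rightarrow> complex mat \<Rightarrow> complex mat" where
  "uhf_connect p q x =
     mat q q (\<lambda>(a, b). if a div p = b div p then x $$ (a mod p, b mod p) else 0)"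

definition mat_unit :: "nat \<Rightarrow> nat \<Rightarrow> nat \<Rightarrow> complex mat" where
  "mat_unit n i j = mat n n (\<lambda>(a, b). if a = i \<and> b = j then 1 else 0)"

lemma uhf_connect_mat_unit:
  assumes "p dvd q" "i < p" "j < p" "a < q" "b < q"
  shows "uhf_connect p q (mat_unit p i j) $$ (a, b) =
    (\<Sum>r<q div p. mat_unit q (r * p + i) (r * p + j) $$ (a, b))"
proof -
  have p: "p > 0" using assms by simp
  have ad: "a div p < q div p"
    using assms p by (metis dvd_mult_div_cancel less_mult_imp_div_less mult.commute)
  have *: "(a = r * p + i \<and> b = r * p + j) \<longleftrightarrow>
      r = a div p \<and> a div p = b div p \<and> a mod p = i \<and> b mod p = j" for r
  proof
    assume "a = r * p + i \<and> b = r * p + j"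
    then show "r = a div p \<and> a div p = b div p \<and> a mod p = i \<and> b mod p = j"
      using assms(2,3) p by simp
  next
    assume "r = a div p \<and> a div p = b div p \<and> a mod p = i \<and> b mod p = j"
    then show "a = r * p + i \<and> b = r * p + j"
      by (metis div_mult_mod_eq)
  qed
  have "(\<Sum>r<q div p. mat_unit q (r * p + i) (r * p + j) $$ (a, b)) =
      (\<Sum>r<q div p. if r = a div p then
         (if a div p = b div p \<and> a mod p = i \<and> b mod p = j then 1 else 0) else 0)"
    using assms * by (intro sum.cong) (auto simp: mat_unit_def)
  also have "\<dots> = (if a div p = b div p \<and> a mod p = i \<and> b mod p = j then 1 else 0)"
    using ad by simp
  also have "\<dots> = uhf_connect p q (mat_unit p i j) $$ (a, b)"
    using assms p by (simp add: uhf_connect_def mat_unit_def)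
  finally show ?thesis by simp
qed

definition unital_star_hom :: "nat \<Rightarrow> (complex mat \<Rightarrow> 'a::cstar_algebra) \<Rightarrow> bool" where
  "unital_star_hom n h \<longleftrightarrow>
     (\<forall>x \<in> carrier_mat n n. \<forall>y \<in> carrier_mat n n. h (x + y) = h x + h y \<and> h (x * y) = h x * h y) \<and>
     (\<forall>c. \<forall>x \<in> carrier_mat n n. h (c \<cdot>\<^sub>m x) = scaleC c (h x)) \<and>
     (\<forall>x \<in> carrier_mat n n. h (mat_star x) = star (h x)) \<and>
     h (1\<^sub>m n) = 1"

text \<open>
  The type \<open>'a\<close>, with the canonical maps \<open>h k\<close>, is the C*-algebra inductive limit of the system
  of \<open>p k \<times> p k\<close> matrices with the connecting maps above. As the limit is determined only up to
  isomorphism, it is described as a completion of the algebraic direct limit: the \<open>h k\<close> are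
  injective unital *-homomorphisms (hence isometric), compatible with the connecting maps, and
  the union of their images is dense.
\<close>

definition uhf_limit :: "(nat \<Rightarrow> nat) \<Rightarrow> (nat \<Rightarrow> complex mat \<Rightarrow> 'a::cstar_algebra) \<Rightarrow> bool" where
  "uhf_limit p h \<longleftrightarrow>
     (\<forall>k. p k > 0 \<and> p k dvd p (Suc k)) \<and>
     (\<forall>k. unital_star_hom (p k) (h k) \<and> inj_on (h k) (carrier_mat (p k) (p k))) \<and>
     (\<forall>k. \<forall>x \<in> carrier_mat (p k) (p k). h (Suc k) (uhf_connect (p k) (p (Suc k)) x) = h k x) \<and>
     closure (\<Union>k. h k ` carrier_mat (p k) (p k)) = UNIV"

definition uhf_level ::
    "(nat \<Rightarrow> nat) \<Rightarrow> (nat \<Rightarrow> complex mat \<Rightarrow> 'a::cstar_algebra) \<Rightarrow> nat \<Rightarrow> 'a set" where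
  "uhf_level p h k = h k ` carrier_mat (p k) (p k)"

definition uhf_diag ::
    "(nat \<Rightarrow> nat) \<Rightarrow> (nat \<Rightarrow> complex mat \<Rightarrow> 'a::cstar_algebra) \<Rightarrow> nat \<Rightarrow> 'a set" where
  "uhf_diag p h k = h k ` {x \<in> carrier_mat (p k) (p k). diagonal_mat x}"

definition uhf_masa ::
    "(nat \<Rightarrow> nat) \<Rightarrow> (nat \<Rightarrow> complex mat \<Rightarrow> 'a::cstar_algebra) \<Rightarrow> 'a set" where
  "uhf_masa p h = closure (\<Union>k. uhf_diag p h k)"

definition concrete_operator_system :: "'a::cstar_algebra set \<Rightarrow> 'a set \<Rightarrow> bool" where
  "concrete_operator_system D S \<longleftrightarrow>
     complex_subspace S \<and> closed S \<and> star ` S \<subseteq> S \<and> D \<subseteq> S \<and>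
     (\<forall>d\<in>D. \<forall>s\<in>S. \<forall>d'\<in>D. d * s * d' \<in> S)"

text \<open>
  The \<open>k\<close>-th term of the inductive system associated with \<open>S\<close>. Since all terms are subspaces of
  \<open>'a\<close>, the connecting maps are inclusions.
\<close>

definition uhf_section ::
    "(nat \<Rightarrow> nat) \<Rightarrow> (nat \<Rightarrow> complex mat \<Rightarrow> 'a::cstar_algebra) \<Rightarrow> 'a set \<Rightarrow> nat \<Rightarrow> 'a set" where
  "uhf_section p h S k = S \<inter> uhf_level p h k"

end

theory Submission
  imports Defs
begin

text \<open>
  An element of a UHF algebra is regarded as an infinite matrix; norms and positivity over the
  algebra are then read off finite quadratic forms. For an operator system \<open>S\<close> that is a bimodule
  over the diagonal, a matrix unit lies in \<open>S\<close> as soon as the corresponding corner of some element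
  of \<open>S\<close> is close to a nonzero multiple of it; in particular the union of the sections is dense in
  \<open>S\<close>. Unital completely positive maps are contractive, so an intertwining sequence consists of
  isometries and extends to the closures.

  Conversely, a unital complete order isomorphism \<open>\<phi>\<close> with \<open>\<phi>(D) = E\<close> maps projections of \<open>D\<close> to
  projections of \<open>E\<close> and is a bimodule map. The image \<open>v = \<phi>(e)\<close> of a matrix unit need not lie in
  any finite level, but it normalises \<open>E\<close>, and the partial automorphism of \<open>E\<close> that it implements
  is also implemented by a unique finite-level element \<open>u\<close> with nonnegative entries, a sum of matrix
  units in \<open>T\<close>. The assignment \<open>e \<mapsto> u\<close> depends on the action of \<open>\<phi>\<close> on the diagonal only. It is
  therefore multiplicative and inverted by the assignment obtained from \<open>\<phi>\<inverse>\<close>, and on each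
  connected component of the graph of matrix units in a section of \<open>S\<close> it is the restriction of a
  *-homomorphism, hence completely positive.
\<close>

section \<open>C*-algebra preliminaries\<close>

text \<open>Condition (ii) demands exact commutation. Moving \<phi>(e) into a finite level by a
  small perturbation is therefore useless unless the choice is canonical: choices made at different
  levels must agree, and the choices for the inverse must undo them exactly. What survives exactly
  is the conjugation action on the diagonal. It fixes the moduli of the entries of an implementing
  element and leaves their phases open; nonnegativity of the entries removes this freedom.

  A second obstacle is that S is not an algebra and \<phi> is multiplicative only against the
  diagonal: the product of two matrix units of S may lie outside S. The correspondence is therefore
  a relation \<open>R\<close> between elements of the two ambient algebras, closed under products
  wherever these lie. This is what lets the images of the units in one component factor through a
  common representative.

  Finally, positivity over the ambient algebra means a factorisation \<open>Y\<^sup>* Y\<close>.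
  Quadratic forms are easily shown nonnegative, but returning from a form to a factorisation takes a
  square root of a matrix over the algebra, which is built from a power series.\<close>

lemma star_zero [simp]: "star (0::'a::cstar_algebra) = 0"
  using star_add[of "0::'a" 0] by simp

lemma star_one [simp]: "star (1::'a::cstar_algebra) = 1"
  using star_mult[of "star 1::'a" 1] by (simp add: star_star)

lemma star_minus: "star (- x) = - star (x::'a::cstar_algebra)"
  using star_add[of x "- x"] by (simp add: eq_neg_iff_add_eq_0 add.commute)

lemma star_diff: "star (x - y) = star x - star (y::'a::cstar_algebra)"
  using star_add[of x "- y"] by (simp add: star_minus)

lemma star_sum: "star (\<Sum>i\<in>A. f i) = (\<Sum>i\<in>A. star (f i :: 'a::cstar_algebra))"
  by (induction A rule: infinite_finite_induct) (auto simp: star_add)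

lemma scaleC_zero_right [simp]: "scaleC c (0::'a::cstar_algebra) = 0"
  using scaleC_add_right[of c "0::'a" 0] by simp

lemma scaleC_zero_left [simp]: "scaleC 0 (x::'a::cstar_algebra) = 0"
  using scaleC_add_left[of 0 0 x] by simp

lemma scaleC_one [simp]: "scaleC 1 (x::'a::cstar_algebra) = x"
  using scaleC_of_real[of 1 x] by simp

lemma scaleC_minus_one: "scaleC (-1) (x::'a::cstar_algebra) = - x"
  using scaleC_of_real[of "-1" x] by simp

lemma scaleC_sum_right: "scaleC c (\<Sum>i\<in>A. f i) = (\<Sum>i\<in>A. scaleC c (f i :: 'a::cstar_algebra))"
  by (induction A rule: infinite_finite_induct) (auto simp: scaleC_add_right)

lemma norm_star [simp]: "norm (star x) = norm (x::'a::cstar_algebra)"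
proof -
  have le: "norm y \<le> norm (star y)" for y :: 'a
  proof (cases "norm y = 0")
    case False
    have "norm y * norm y \<le> norm (star y) * norm y"
      using norm_star_mult[of y] norm_mult_ineq[of "star y" y] by (simp add: power2_eq_square)
    then show ?thesis using False by (simp add: mult_le_cancel_right)
  qed auto
  show ?thesis using le[of x] le[of "star x"] by (simp add: star_star)
qed

lemma star_scaleR: "star (scaleR r x) = scaleR r (star (x::'a::cstar_algebra))"
  by (simp flip: scaleC_of_real add: star_scaleC)

lemma bounded_linear_star: "bounded_linear (star :: 'a::cstar_algebra \<Rightarrow> 'a)"
  by (rule bounded_linear_intro[of _ 1]) (auto simp: star_add star_scaleR)

lemma scaleC_scaleR: "scaleC c (scaleR r x) = scaleR r (scaleC c (x::'a::cstar_algebra))"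
  by (simp flip: scaleC_of_real add: scaleC_scaleC mult.commute)

lemma bounded_linear_scaleC: "bounded_linear (scaleC c :: 'a::cstar_algebra \<Rightarrow> 'a)"
  by (rule bounded_linear_intro[of _ "cmod c"])
    (auto simp: scaleC_add_right scaleC_scaleR norm_scaleC mult.commute)

lemma norm_selfadjoint_projection:
  fixes e :: "'a::cstar_algebra"
  assumes "star e = e" "e * e = e" "e \<noteq> 0"
  shows "norm e = 1"
proof -
  have "norm e * norm e = norm e"
    using norm_star_mult[of e] assms(1,2) by (simp add: power2_eq_square)
  then show ?thesis using assms(3) by simp
qed

lemma mult_star_eq_0: "x * star x = 0 \<longleftrightarrow> (x::'a::cstar_algebra) = 0"
  using norm_star_mult[of "star x"] by (auto simp: star_star)

section \<open>Finite quadratic forms\<close>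

definition sq :: "'i set \<Rightarrow> ('i \<Rightarrow> complex) \<Rightarrow> real" where
  "sq F \<xi> = (\<Sum>a\<in>F. (cmod (\<xi> a))\<^sup>2)"

definition app :: "'i set \<Rightarrow> ('i \<Rightarrow> 'i \<Rightarrow> complex) \<Rightarrow> ('i \<Rightarrow> complex) \<Rightarrow> 'i \<Rightarrow> complex" where
  "app F M \<xi> a = (\<Sum>b\<in>F. M a b * \<xi> b)"

definition ip :: "'i set \<Rightarrow> ('i \<Rightarrow> complex) \<Rightarrow> ('i \<Rightarrow> complex) \<Rightarrow> complex" where
  "ip F \<eta> \<xi> = (\<Sum>a\<in>F. cnj (\<eta> a) * \<xi> a)"

definition opb :: "'i set \<Rightarrow> real \<Rightarrow> ('i \<Rightarrow> 'i \<Rightarrow> complex) \<Rightarrow> bool" where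
  "opb F c M \<longleftrightarrow> (\<forall>\<xi>. sq F (app F M \<xi>) \<le> c\<^sup>2 * sq F \<xi>)"

text \<open>Only the real part of the form is tested, which alone would admit a skew part as well;
  hermitian symmetry is therefore a separate clause.\<close>

definition psd :: "'i set \<Rightarrow> ('i \<Rightarrow> 'i \<Rightarrow> complex) \<Rightarrow> bool" where
  "psd F M \<longleftrightarrow> (\<forall>a\<in>F. \<forall>b\<in>F. M b a = cnj (M a b)) \<and> (\<forall>\<xi>. 0 \<le> Re (ip F \<xi> (app F M \<xi>)))"

lemma sq_nonneg [simp]: "0 \<le> sq F \<xi>"
  by (simp add: sq_def sum_nonneg)

lemma ip_self: "ip F \<xi> \<xi> = of_real (sq F \<xi>)"
  unfolding ip_def sq_def of_real_sum complex_norm_square by (simp add: mult.commute)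

lemma Re_ip_self [simp]: "Re (ip F \<xi> \<xi>) = sq F \<xi>"
  by (simp add: ip_self)

lemma cnj_ip: "cnj (ip F \<eta> \<xi>) = ip F \<xi> \<eta>"
  by (simp add: ip_def mult.commute)

lemma ip_add_right: "ip F \<eta> (\<lambda>a. \<xi> a + \<zeta> a) = ip F \<eta> \<xi> + ip F \<eta> \<zeta>"
  by (simp add: ip_def sum.distrib algebra_simps)

lemma ip_diff_right: "ip F \<eta> (\<lambda>a. \<xi> a - \<zeta> a) = ip F \<eta> \<xi> - ip F \<eta> \<zeta>"
  by (simp add: ip_def sum_subtractf algebra_simps)

lemma ip_diff_left: "ip F (\<lambda>a. \<xi> a - \<zeta> a) \<eta> = ip F \<xi> \<eta> - ip F \<zeta> \<eta>"
  by (simp add: ip_def sum_subtractf algebra_simps)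

lemma ip_scale_right: "ip F \<eta> (\<lambda>a. s * \<xi> a) = s * ip F \<eta> \<xi>"
  by (simp add: ip_def sum_distrib_left algebra_simps)

lemma ip_scale_left: "ip F (\<lambda>a. s * \<xi> a) \<eta> = cnj s * ip F \<xi> \<eta>"
  by (simp add: ip_def sum_distrib_left algebra_simps)

lemma app_diff: "app F M (\<lambda>a. \<xi> a - \<zeta> a) = (\<lambda>a. app F M \<xi> a - app F M \<zeta> a)"
  by (simp add: app_def fun_eq_iff sum_subtractf algebra_simps)

lemma app_scale: "app F M (\<lambda>a. s * \<xi> a) = (\<lambda>a. s * app F M \<xi> a)"
  by (simp add: app_def fun_eq_iff sum_distrib_left algebra_simps)

lemma app_comp:
  "app F M (app F N \<xi>) = app F (\<lambda>a b. \<Sum>l\<in>F. M a l * N l b) \<xi>"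
proof
  fix a
  have "app F M (app F N \<xi>) a = (\<Sum>l\<in>F. \<Sum>b\<in>F. M a l * N l b * \<xi> b)"
    by (simp add: app_def sum_distrib_left mult.assoc)
  also have "\<dots> = (\<Sum>b\<in>F. \<Sum>l\<in>F. M a l * N l b * \<xi> b)" by (rule sum.swap)
  finally show "app F M (app F N \<xi>) a = app F (\<lambda>a b. \<Sum>l\<in>F. M a l * N l b) \<xi> a"
    by (simp add: app_def sum_distrib_right)
qed

lemma ip_adj:
  "ip F \<eta> (app F M \<xi>) = ip F (app F (\<lambda>a b. cnj (M b a)) \<eta>) \<xi>"
proof -
  have "ip F \<eta> (app F M \<xi>) = (\<Sum>a\<in>F. \<Sum>b\<in>F. cnj (\<eta> a) * M a b * \<xi> b)"
    by (simp add: ip_def app_def sum_distrib_left mult.assoc)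
  also have "\<dots> = (\<Sum>b\<in>F. \<Sum>a\<in>F. cnj (\<eta> a) * M a b * \<xi> b)" by (rule sum.swap)
  finally show ?thesis
    by (simp add: ip_def app_def sum_distrib_left sum_distrib_right algebra_simps)
qed

lemma app_cong: "(\<And>a b. a \<in> F \<Longrightarrow> b \<in> F \<Longrightarrow> M a b = N a b) \<Longrightarrow> a \<in> F \<Longrightarrow> app F M \<xi> a = app F N \<xi> a"
  by (simp add: app_def)

lemma sq_cong: "(\<And>a. a \<in> F \<Longrightarrow> \<xi> a = \<eta> a) \<Longrightarrow> sq F \<xi> = sq F \<eta>"
  by (simp add: sq_def)

lemma ip_cong: "(\<And>a. a \<in> F \<Longrightarrow> \<xi> a = \<eta> a) \<Longrightarrow> (\<And>a. a \<in> F \<Longrightarrow> \<xi>' a = \<eta>' a) \<Longrightarrow> ip F \<xi> \<xi>' = ip F \<eta> \<eta>'"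
  by (simp add: ip_def)

lemma opb_cong:
  assumes "\<And>a b. a \<in> F \<Longrightarrow> b \<in> F \<Longrightarrow> M a b = N a b"
  shows "opb F c M \<longleftrightarrow> opb F c N"
proof -
  have "sq F (app F M \<xi>) = sq F (app F N \<xi>)" for \<xi>
    by (intro sq_cong app_cong assms)
  then show ?thesis by (simp add: opb_def)
qed

lemma psd_hermitian: "psd F M \<Longrightarrow> a \<in> F \<Longrightarrow> b \<in> F \<Longrightarrow> cnj (M b a) = M a b"
  unfolding psd_def by (metis complex_cnj_cnj)

lemma psd_form: "psd F M \<Longrightarrow> 0 \<le> Re (ip F \<xi> (app F M \<xi>))"
  by (simp add: psd_def)

lemma psd_cong:
  assumes "\<And>a b. a \<in> F \<Longrightarrow> b \<in> F \<Longrightarrow> M a b = N a b"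
  shows "psd F M \<longleftrightarrow> psd F N"
proof -
  have "ip F \<xi> (app F M \<xi>) = ip F \<xi> (app F N \<xi>)" for \<xi>
    by (rule ip_cong) (auto intro: app_cong assms)
  then show ?thesis unfolding psd_def using assms by simp
qed

lemma sq_scale: "sq F (\<lambda>a. s * \<xi> a) = (cmod s)\<^sup>2 * sq F \<xi>"
  by (simp add: sq_def norm_mult power_mult_distrib sum_distrib_left)

lemma sq_diff: "sq F (\<lambda>a. \<xi> a - \<eta> a) = sq F \<xi> - 2 * Re (ip F \<xi> \<eta>) + sq F \<eta>"
proof -
  have 1: "Re (ip F (\<lambda>a. \<xi> a - \<eta> a) (\<lambda>a. \<xi> a - \<eta> a)) =
      Re (ip F \<xi> \<xi>) - Re (ip F \<xi> \<eta>) - Re (ip F \<eta> \<xi>) + Re (ip F \<eta> \<eta>)"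
    by (simp only: ip_diff_left ip_diff_right) simp
  have "Re (ip F \<eta> \<xi>) = Re (ip F \<xi> \<eta>)" by (simp flip: cnj_ip[of F \<xi> \<eta>])
  with 1 show ?thesis by simp
qed

lemma sq_eq_0: "finite F \<Longrightarrow> sq F \<xi> = 0 \<longleftrightarrow> (\<forall>a\<in>F. \<xi> a = 0)"
  by (simp add: sq_def sum_nonneg_eq_0_iff)

lemma opb_mult:
  assumes "opb F c M" "opb F d N"
  shows "opb F (c * d) (\<lambda>a b. \<Sum>l\<in>F. M a l * N l b)"
  unfolding opb_def
proof
  fix \<xi>
  have "sq F (app F M (app F N \<xi>)) \<le> c\<^sup>2 * sq F (app F N \<xi>)" using assms(1) by (simp add: opb_def)
  also have "\<dots> \<le> c\<^sup>2 * (d\<^sup>2 * sq F \<xi>)" using assms(2) by (intro mult_left_mono) (auto simp: opb_def)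
  finally show "sq F (app F (\<lambda>a b. \<Sum>l\<in>F. M a l * N l b) \<xi>) \<le> (c * d)\<^sup>2 * sq F \<xi>"
    by (simp add: app_comp power_mult_distrib mult.assoc)
qed

lemma opb_weaken:
  assumes "opb F c M" "0 \<le> c" "c \<le> d"
  shows "opb F d M"
  unfolding opb_def
proof
  fix \<xi>
  have "sq F (app F M \<xi>) \<le> c\<^sup>2 * sq F \<xi>" using assms by (simp add: opb_def)
  also have "\<dots> \<le> d\<^sup>2 * sq F \<xi>" using assms by (intro mult_right_mono power_mono) auto
  finally show "sq F (app F M \<xi>) \<le> d\<^sup>2 * sq F \<xi>" .
qed

lemma sqrt_sq: "sqrt (sq F \<xi>) = L2_set (\<lambda>a. cmod (\<xi> a)) F"
  by (simp add: sq_def L2_set_def)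

lemma opb_sqrt:
  assumes "0 \<le> c"
  shows "opb F c M \<longleftrightarrow> (\<forall>\<xi>. sqrt (sq F (app F M \<xi>)) \<le> c * sqrt (sq F \<xi>))"
proof -
  have "c * sqrt (sq F \<xi>) = sqrt (c\<^sup>2 * sq F \<xi>)" for \<xi>
    using assms by (simp add: real_sqrt_mult)
  then show ?thesis by (simp add: opb_def)
qed

lemma sqrt_sq_add: "sqrt (sq F (\<lambda>a. \<xi> a + \<eta> a)) \<le> sqrt (sq F \<xi>) + sqrt (sq F \<eta>)"
proof -
  have "L2_set (\<lambda>a. cmod (\<xi> a + \<eta> a)) F \<le> L2_set (\<lambda>a. cmod (\<xi> a) + cmod (\<eta> a)) F"
    by (intro L2_set_mono) (auto intro: norm_triangle_ineq)
  also have "\<dots> \<le> L2_set (\<lambda>a. cmod (\<xi> a)) F + L2_set (\<lambda>a. cmod (\<eta> a)) F"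
    by (rule L2_set_triangle_ineq)
  finally show ?thesis by (simp add: sqrt_sq)
qed

lemma opb_add:
  assumes "opb F c M" "opb F d N" "0 \<le> c" "0 \<le> d"
  shows "opb F (c + d) (\<lambda>a b. M a b + N a b)"
proof -
  have "sqrt (sq F (app F (\<lambda>a b. M a b + N a b) \<xi>)) \<le> (c + d) * sqrt (sq F \<xi>)" for \<xi>
  proof -
    have "app F (\<lambda>a b. M a b + N a b) \<xi> = (\<lambda>a. app F M \<xi> a + app F N \<xi> a)"
      by (simp add: app_def fun_eq_iff sum.distrib algebra_simps)
    then have "sqrt (sq F (app F (\<lambda>a b. M a b + N a b) \<xi>)) \<le> sqrt (sq F (app F M \<xi>)) + sqrt (sq F (app F N \<xi>))"
      using sqrt_sq_add by metis
    also have "\<dots> \<le> c * sqrt (sq F \<xi>) + d * sqrt (sq F \<xi>)"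
      using assms opb_sqrt by (intro add_mono) blast+
    finally show ?thesis by (simp add: algebra_simps)
  qed
  then show ?thesis using assms by (subst opb_sqrt) auto
qed

lemma sq_limit:
  assumes "\<And>a. a \<in> F \<Longrightarrow> ((\<lambda>m. f m a) \<longlongrightarrow> g a) L"
  shows "((\<lambda>m. sq F (f m)) \<longlongrightarrow> sq F g) L"
  unfolding sq_def by (intro tendsto_intros assms)

lemma app_limit:
  assumes "\<And>a b. a \<in> F \<Longrightarrow> b \<in> F \<Longrightarrow> ((\<lambda>m. f m a b) \<longlongrightarrow> g a b) L" "a \<in> F"
  shows "((\<lambda>m. app F (f m) \<xi> a) \<longlongrightarrow> app F g \<xi> a) L"
  unfolding app_def by (intro tendsto_intros assms)

lemma opb_limit:
  assumes "\<And>a b. a \<in> F \<Longrightarrow> b \<in> F \<Longrightarrow> (\<lambda>m. f m a b) \<longlonglongrightarrow> g a b"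
    and "\<And>m. opb F (c m) (f m)" and "c \<longlonglongrightarrow> d"
  shows "opb F d g"
  unfolding opb_def
proof
  fix \<xi>
  show "sq F (app F g \<xi>) \<le> d\<^sup>2 * sq F \<xi>"
  proof (rule LIMSEQ_le)
    show "(\<lambda>m. sq F (app F (f m) \<xi>)) \<longlonglongrightarrow> sq F (app F g \<xi>)"
      by (intro sq_limit app_limit assms)
    show "(\<lambda>m. (c m)\<^sup>2 * sq F \<xi>) \<longlonglongrightarrow> d\<^sup>2 * sq F \<xi>" by (intro tendsto_intros assms)
    show "\<exists>N. \<forall>n\<ge>N. sq F (app F (f n) \<xi>) \<le> (c n)\<^sup>2 * sq F \<xi>" using assms(2) by (auto simp: opb_def)
  qed
qed

lemma psd_limit:
  assumes lim: "\<And>a b. a \<in> F \<Longrightarrow> b \<in> F \<Longrightarrow> (\<lambda>m. f m a b) \<longlonglongrightarrow> g a b"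
    and psd: "\<And>m. psd F (f m)"
  shows "psd F g"
  unfolding psd_def
proof (intro conjI ballI allI)
  fix a b assume ab: "a \<in> F" "b \<in> F"
  have "f m b a = cnj (f m a b)" for m using psd[of m] ab unfolding psd_def by blast
  then have eq: "(\<lambda>m. f m b a) = (\<lambda>m. cnj (f m a b))" by (rule ext)
  have "(\<lambda>m. cnj (f m a b)) \<longlonglongrightarrow> g b a" using lim[OF ab(2,1)] unfolding eq .
  moreover have "(\<lambda>m. cnj (f m a b)) \<longlonglongrightarrow> cnj (g a b)" using lim ab by (intro tendsto_cnj) auto
  ultimately show "g b a = cnj (g a b)" using LIMSEQ_unique by blast
next
  fix \<xi>
  have "(\<lambda>m. Re (ip F \<xi> (app F (f m) \<xi>))) \<longlonglongrightarrow> Re (ip F \<xi> (app F g \<xi>))"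
    unfolding ip_def by (intro tendsto_intros app_limit lim)
  then show "0 \<le> Re (ip F \<xi> (app F g \<xi>))"
    using psd by (intro LIMSEQ_le_const[where X = "\<lambda>m. Re (ip F \<xi> (app F (f m) \<xi>))"]) (auto simp: psd_def)
qed

lemma sq_mono: "finite F \<Longrightarrow> G \<subseteq> F \<Longrightarrow> sq G \<xi> \<le> sq F \<xi>"
  unfolding sq_def by (intro sum_mono2) auto

lemma app_restrict:
  assumes "finite F" "G \<subseteq> F"
  shows "app F M (\<lambda>b. if b \<in> G then \<xi> b else 0) = app G M \<xi>"
proof
  fix a
  have "(\<Sum>b\<in>F. M a b * (if b \<in> G then \<xi> b else 0)) = (\<Sum>b\<in>G. M a b * (if b \<in> G then \<xi> b else 0))"
    using assms by (intro sum.mono_neutral_right) auto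
  then show "app F M (\<lambda>b. if b \<in> G then \<xi> b else 0) a = app G M \<xi> a"
    by (simp add: app_def)
qed

lemma sq_restrict:
  assumes "finite F" "G \<subseteq> F"
  shows "sq F (\<lambda>b. if b \<in> G then \<xi> b else 0) = sq G \<xi>"
proof -
  have "sq F (\<lambda>b. if b \<in> G then \<xi> b else 0) = (\<Sum>a\<in>G. (cmod (if a \<in> G then \<xi> a else 0))\<^sup>2)"
    unfolding sq_def using assms by (intro sum.mono_neutral_right) auto
  then show ?thesis by (simp add: sq_def)
qed

lemma ip_restrict:
  assumes "finite F" "G \<subseteq> F"
  shows "ip F (\<lambda>b. if b \<in> G then \<xi> b else 0) \<eta> = ip G \<xi> \<eta>"
proof -
  have "ip F (\<lambda>b. if b \<in> G then \<xi> b else 0) \<eta> = (\<Sum>a\<in>G. cnj (if a \<in> G then \<xi> a else 0) * \<eta> a)"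
    unfolding ip_def using assms by (intro sum.mono_neutral_right) auto
  then show ?thesis by (simp add: ip_def)
qed

lemma opb_subset:
  assumes "opb F c M" "finite F" "G \<subseteq> F"
  shows "opb G c M"
  unfolding opb_def
proof
  fix \<xi>
  have "sq G (app G M \<xi>) \<le> sq F (app G M \<xi>)" using assms by (intro sq_mono)
  also have "\<dots> \<le> c\<^sup>2 * sq F (\<lambda>b. if b \<in> G then \<xi> b else 0)"
    using assms(1) app_restrict[OF assms(2,3)] unfolding opb_def by metis
  also have "\<dots> = c\<^sup>2 * sq G \<xi>" using assms by (simp add: sq_restrict)
  finally show "sq G (app G M \<xi>) \<le> c\<^sup>2 * sq G \<xi>" .
qed

lemma psd_subset:
  assumes "psd F M" "finite F" "G \<subseteq> F"
  shows "psd G M"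
  unfolding psd_def
proof (intro conjI ballI allI)
  fix \<xi>
  let ?x = "\<lambda>b. if b \<in> G then \<xi> b else (0::complex)"
  have "ip F ?x (app F M ?x) = ip G \<xi> (app G M \<xi>)"
    using assms by (simp add: ip_restrict app_restrict)
  moreover have "0 \<le> Re (ip F ?x (app F M ?x))" using assms(1) by (rule psd_form)
  ultimately show "0 \<le> Re (ip G \<xi> (app G M \<xi>))" by simp
next
  fix a b assume "a \<in> G" "b \<in> G"
  then show "M b a = cnj (M a b)" using assms(3) by (simp add: psd_hermitian[OF assms(1)] subsetD)
qed

lemma app_single: "finite F \<Longrightarrow> b \<in> F \<Longrightarrow> app F M (\<lambda>x. if x = b then 1 else 0) = (\<lambda>a. M a b)"
  by (simp add: app_def fun_eq_iff if_distrib cong: if_cong)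

lemma opb_entry:
  assumes "opb F c M" "finite F" "a \<in> F" "b \<in> F" "0 \<le> c"
  shows "cmod (M a b) \<le> c"
proof -
  let ?x = "\<lambda>x. if x = b then 1 else (0::complex)"
  have "(cmod (M a b))\<^sup>2 \<le> sq F (\<lambda>a. M a b)"
    unfolding sq_def using assms by (intro member_le_sum) auto
  also have "\<dots> = sq F (app F M ?x)" using assms by (simp add: app_single)
  also have "\<dots> \<le> c\<^sup>2 * sq F ?x" using assms by (simp add: opb_def)
  also have "sq F ?x = (\<Sum>a\<in>F. if a = b then 1 else 0)" unfolding sq_def by (intro sum.cong) auto
  also have "c\<^sup>2 * \<dots> = c\<^sup>2" using assms by simp
  finally show ?thesis using assms(5) by (simp add: abs_le_square_iff[symmetric])
qed

text \<open>Expand |c \<eta> - M \<xi>|^2 \<ge> 0 and divide by \<open>c\<close>. Replacing \<eta>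
  by -\<eta> gives the absolute value.\<close>

lemma opb_form_le:
  assumes "opb F c M" "0 < c"
  shows "2 * \<bar>Re (ip F \<eta> (app F M \<xi>))\<bar> \<le> c * (sq F \<eta> + sq F \<xi>)"
proof -
  have *: "2 * Re (ip F \<eta> (app F M \<xi>)) \<le> c * (sq F \<eta> + sq F \<xi>)" for \<eta>
  proof -
    have "0 \<le> sq F (\<lambda>a. of_real c * \<eta> a - app F M \<xi> a)" by simp
    also have "\<dots> = c\<^sup>2 * sq F \<eta> - 2 * (c * Re (ip F \<eta> (app F M \<xi>))) + sq F (app F M \<xi>)"
      by (simp add: sq_diff sq_scale ip_scale_left)
    also have "\<dots> \<le> c\<^sup>2 * sq F \<eta> - 2 * (c * Re (ip F \<eta> (app F M \<xi>))) + c\<^sup>2 * sq F \<xi>"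
      using assms by (simp add: opb_def)
    finally have "c * (2 * Re (ip F \<eta> (app F M \<xi>))) \<le> c * (c * (sq F \<eta> + sq F \<xi>))"
      by (simp add: algebra_simps power2_eq_square)
    then show ?thesis using assms by simp
  qed
  have "ip F (\<lambda>a. - 1 * \<eta> a) (app F M \<xi>) = - ip F \<eta> (app F M \<xi>)"
    by (subst ip_scale_left) simp
  moreover have "sq F (\<lambda>a. - 1 * \<eta> a) = sq F \<eta>" by (subst sq_scale) simp
  ultimately show ?thesis using *[of \<eta>] *[of "\<lambda>a. - 1 * \<eta> a"] by auto
qed

text \<open>With \<open>z\<close> the adjoint applied to \<xi>, |z|^2 = Re <\<xi>, M z>. Expanding
  |c^2 \<xi> - M z|^2 \<ge> 0 and using the bound for M z gives |z| \<le> c |\<xi>|.\<close>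

lemma opb_adj:
  assumes "opb F c M" "0 < c"
  shows "opb F c (\<lambda>a b. cnj (M b a))"
  unfolding opb_def
proof
  fix \<xi>
  define z where "z = app F (\<lambda>a b. cnj (M b a)) \<xi>"
  have 1: "sq F z = Re (ip F \<xi> (app F M z))"
    by (simp add: ip_adj z_def flip: Re_ip_self)
  define d where "d = c\<^sup>2"
  have d: "0 < d" using assms(2) by (simp add: d_def)
  have "0 \<le> sq F (\<lambda>a. of_real d * \<xi> a - app F M z a)" by simp
  also have "\<dots> = d\<^sup>2 * sq F \<xi> - 2 * (d * sq F z) + sq F (app F M z)"
    by (simp add: sq_diff sq_scale ip_scale_left 1)
  also have "\<dots> \<le> d\<^sup>2 * sq F \<xi> - 2 * (d * sq F z) + d * sq F z"
    using assms(1) unfolding opb_def d_def by (intro add_left_mono) blast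
  finally have "d * sq F z \<le> d * (d * sq F \<xi>)"
    unfolding power2_eq_square by (simp add: mult.assoc)
  then show "sq F z \<le> c\<^sup>2 * sq F \<xi>" using d by (simp add: d_def[symmetric])
qed

text \<open>The point is \<open>M\<^sup>2 \<le> c M\<close>, obtained by testing the form of
  \<open>M\<close> at c \<xi> - M \<xi>. It supplies the contraction whose powers enter the square
  root series.\<close>

lemma psd_opb_one_minus:
  assumes "psd F M" "opb F c M" "0 < c" "finite F"
  shows "opb F 1 (\<lambda>a b. (if a = b then 1 else 0) - M a b / of_real c)"
  unfolding opb_def
proof
  fix \<xi>
  define z where "z = app F M \<xi>"
  define t where "t = Re (ip F \<xi> z)"
  have herm: "ip F \<eta> (app F M \<zeta>) = ip F (app F M \<eta>) \<zeta>" for \<eta> \<zeta>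
    using assms(1) by (subst ip_adj) (intro ip_cong app_cong refl psd_hermitian)
  have re: "Re (ip F z (app F M z)) \<le> c * sq F z"
    using opb_form_le[OF assms(2,3), of z z] by simp
  have "0 \<le> Re (ip F (\<lambda>a. of_real c * \<xi> a - z a) (app F M (\<lambda>a. of_real c * \<xi> a - z a)))"
    using assms(1) by (rule psd_form)
  also have "\<dots> = c\<^sup>2 * t - 2 * c * sq F z + Re (ip F z (app F M z))"
  proof -
    have "ip F \<xi> (app F M z) = ip F z z" by (simp add: herm flip: z_def)
    then show ?thesis
      by (simp add: app_diff app_scale ip_diff_left ip_diff_right ip_scale_left ip_scale_right
          power2_eq_square t_def flip: z_def)
  qed
  also have "\<dots> \<le> c\<^sup>2 * t - c * sq F z" using re by simp
  finally have "c * sq F z \<le> c * (c * t)" by (simp add: power2_eq_square)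
  then have le: "sq F z \<le> c * t" using assms(3) by simp
  have t0: "0 \<le> t" using assms(1) unfolding t_def z_def by (rule psd_form)
  have "sq F (app F (\<lambda>a b. (if a = b then 1 else 0) - M a b / of_real c) \<xi>)
      = sq F (\<lambda>a. \<xi> a - of_real (1/c) * z a)"
    using assms(4) by (intro sq_cong) (simp add: app_def left_diff_distrib sum_subtractf
        z_def if_distrib[of "\<lambda>x. x * _"] sum_divide_distrib cong: if_cong)
  also have "\<dots> = sq F \<xi> - 2 * (t / c) + sq F z / c\<^sup>2"
    unfolding sq_diff ip_scale_right sq_scale using assms(3)
    by (simp add: t_def norm_divide power_divide)
  also have "sq F z / c\<^sup>2 \<le> t / c"
    using le assms(3) by (simp add: field_simps power2_eq_square)
  also have "sq F \<xi> - 2 * (t / c) + t / c \<le> 1\<^sup>2 * sq F \<xi>" using t0 assms(3) by simp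
  finally show "sq F (app F (\<lambda>a b. (if a = b then 1 else 0) - M a b / of_real c) \<xi>) \<le> 1\<^sup>2 * sq F \<xi>"
    by simp
qed

lemma sum_by_class:
  assumes "finite F"
  shows "(\<Sum>c\<in>\<kappa> ` F. \<Sum>a\<in>{a\<in>F. \<kappa> a = c}. f a) = (\<Sum>a\<in>F. f a)"
  using sum.image_gen[OF assms, of f \<kappa>] by simp

text \<open>On each class of \<kappa> the new matrix acts as a diagonal block of \<open>M\<close>,
  and the squared norms over the classes add up.\<close>

lemma opb_pinch:
  assumes "opb F c M" "finite F"
  shows "opb F c (\<lambda>a b. if \<kappa> a = \<kappa> b then M a b else 0)"
  unfolding opb_def
proof
  fix \<xi>
  let ?N = "\<lambda>a b. if \<kappa> a = \<kappa> b then M a b else 0"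
  let ?G = "\<lambda>k. {a\<in>F. \<kappa> a = k}"
  have "sq (?G k) (app F ?N \<xi>) \<le> c\<^sup>2 * sq (?G k) \<xi>" for k
  proof -
    have "app F ?N \<xi> a = app (?G k) M \<xi> a" if "a \<in> ?G k" for a
    proof -
      have "app F ?N \<xi> a = (\<Sum>b\<in>?G k. ?N a b * \<xi> b)"
        unfolding app_def using that assms(2) by (intro sum.mono_neutral_right) auto
      also have "\<dots> = app (?G k) M \<xi> a" using that unfolding app_def by (intro sum.cong) auto
      finally show ?thesis .
    qed
    then have "sq (?G k) (app F ?N \<xi>) = sq (?G k) (app (?G k) M \<xi>)" by (intro sq_cong)
    also have "\<dots> \<le> c\<^sup>2 * sq (?G k) \<xi>"
      using opb_subset[OF assms, of "?G k"] by (simp add: opb_def)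
    finally show ?thesis .
  qed
  then have "(\<Sum>k\<in>\<kappa> ` F. sq (?G k) (app F ?N \<xi>)) \<le> (\<Sum>k\<in>\<kappa> ` F. c\<^sup>2 * sq (?G k) \<xi>)"
    by (intro sum_mono)
  then show "sq F (app F ?N \<xi>) \<le> c\<^sup>2 * sq F \<xi>"
    unfolding sq_def sum_distrib_left[symmetric] sum_by_class[OF assms(2)] .
qed

lemma cmod_sum_sq_le: "(cmod (\<Sum>b\<in>B. z b))\<^sup>2 \<le> card B * (\<Sum>b\<in>B. (cmod (z b))\<^sup>2)"
proof -
  have "(cmod (\<Sum>b\<in>B. z b))\<^sup>2 \<le> (\<Sum>b\<in>B. 1 * cmod (z b))\<^sup>2"
    by (intro power_mono) (auto intro: norm_sum)
  also have "\<dots> \<le> (\<Sum>b\<in>B. 1\<^sup>2) * (\<Sum>b\<in>B. (cmod (z b))\<^sup>2)"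
    by (rule Cauchy_Schwarz_ineq_sum)
  finally show ?thesis by simp
qed

text \<open>Cauchy-Schwarz inside one block. The bound depends on the block size but not on the
  number of blocks, so it remains useful when the size of \<open>F\<close> is out of
  control.\<close>

lemma opb_small_blocks:
  assumes fin: "finite F" and blk: "\<And>a b. a \<in> F \<Longrightarrow> b \<in> F \<Longrightarrow> \<kappa> a \<noteq> \<kappa> b \<Longrightarrow> M a b = 0"
    and small: "\<And>a b. a \<in> F \<Longrightarrow> b \<in> F \<Longrightarrow> cmod (M a b) \<le> d" and "0 \<le> d"
    and card: "\<And>k. card {a\<in>F. \<kappa> a = k} \<le> n"
  shows "opb F (real n * d) M"
  unfolding opb_def
proof
  fix \<xi>
  let ?G = "\<lambda>k. {a\<in>F. \<kappa> a = k}"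
  have "(cmod (app F M \<xi> a))\<^sup>2 \<le> n * d\<^sup>2 * sq (?G (\<kappa> a)) \<xi>" if "a \<in> F" for a
  proof -
    have "app F M \<xi> a = (\<Sum>b\<in>?G (\<kappa> a). M a b * \<xi> b)"
      unfolding app_def using that fin blk by (intro sum.mono_neutral_right) force+
    then have "(cmod (app F M \<xi> a))\<^sup>2 \<le> card (?G (\<kappa> a)) * (\<Sum>b\<in>?G (\<kappa> a). (cmod (M a b * \<xi> b))\<^sup>2)"
      using cmod_sum_sq_le by metis
    also have "\<dots> \<le> n * (\<Sum>b\<in>?G (\<kappa> a). d\<^sup>2 * (cmod (\<xi> b))\<^sup>2)"
      using card that small
      by (intro mult_mono sum_mono) (auto simp: norm_mult power_mult_distrib intro!: mult_right_mono power_mono sum_nonneg)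
    finally show ?thesis by (simp add: sq_def mult.assoc flip: sum_distrib_left)
  qed
  then have "sq F (app F M \<xi>) \<le> (\<Sum>a\<in>F. n * d\<^sup>2 * sq (?G (\<kappa> a)) \<xi>)"
    unfolding sq_def[of F "app F M \<xi>"] by (intro sum_mono)
  also have "\<dots> = (\<Sum>k\<in>\<kappa> ` F. \<Sum>a\<in>?G k. n * d\<^sup>2 * sq (?G k) \<xi>)"
    by (subst sum_by_class[OF fin, where \<kappa> = \<kappa>, symmetric]) (intro sum.cong; auto)
  also have "\<dots> = (\<Sum>k\<in>\<kappa> ` F. card (?G k) * (n * d\<^sup>2 * sq (?G k) \<xi>))" by simp
  also have "\<dots> \<le> (\<Sum>k\<in>\<kappa> ` F. n * (n * d\<^sup>2 * sq (?G k) \<xi>))"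
    using card by (intro sum_mono mult_right_mono) auto
  also have "\<dots> = (real n * d)\<^sup>2 * sq F \<xi>"
    unfolding sq_def sum_by_class[OF fin, where \<kappa> = \<kappa> and f = "\<lambda>a. (cmod (\<xi> a))\<^sup>2", symmetric]
    by (simp add: power_mult_distrib power2_eq_square mult_ac flip: sum_distrib_left)
  finally show "sq F (app F M \<xi>) \<le> (real n * d)\<^sup>2 * sq F \<xi>" .
qed

section \<open>UHF algebras as infinite matrices\<close>

text \<open>Infinitely many copies of one block down the diagonal. A connecting map produces a
  finite corner of this matrix, so compositions of connecting maps reduce to
  \<open>blk_blk\<close>.\<close>

definition blk :: "nat \<Rightarrow> (nat \<Rightarrow> nat \<Rightarrow> complex) \<Rightarrow> nat \<Rightarrow> nat \<Rightarrow> complex" where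
  "blk p c i j = (if i div p = j div p then c (i mod p) (j mod p) else 0)"

lemma blk_blk:
  assumes "p dvd q"
  shows "blk q (blk p c) = blk p c"
proof -
  obtain r where q: "q = p * r" using assms by blast
  have 1: "i div q = i div p div r" for i by (simp add: q div_mult2_eq)
  have 2: "i mod q div p = i div p mod r" for i
    by (cases "p = 0") (simp_all add: q mod_mult2_eq)
  have 3: "i div p = j div p \<longleftrightarrow> i div q = j div q \<and> i mod q div p = j mod q div p" for i j
    unfolding 1 2 by (metis div_mult_mod_eq)
  have 4: "i mod q mod p = i mod p" for i using assms by (rule mod_mod_cancel)
  have "blk q (blk p c) i j = blk p c i j" for i j
    using 3[of i j] by (auto simp: blk_def 4)
  then show ?thesis by blast
qed

lemma blk_less: "i < p \<Longrightarrow> j < p \<Longrightarrow> blk p c i j = c i j"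
  by (simp add: blk_def)

locale uhf =
  fixes p :: "nat \<Rightarrow> nat" and h :: "nat \<Rightarrow> complex mat \<Rightarrow> 'a::cstar_algebra"
  assumes lim: "uhf_limit p h"
begin

lemma p_pos [simp]: "0 < p k" and p_dvd_Suc: "p k dvd p (Suc k)"
  using lim by (auto simp: uhf_limit_def)

lemma p_dvd: "k \<le> K \<Longrightarrow> p k dvd p K"
  by (induction K rule: dec_induct) (auto intro: dvd_trans p_dvd_Suc)

lemma p_mono: "k \<le> K \<Longrightarrow> p k \<le> p K"
  by (rule dvd_imp_le[OF p_dvd p_pos])

abbreviation pset :: "nat \<Rightarrow> nat set" where "pset k \<equiv> {..<p k}"

text \<open>Reading the entries from a function of two indices keeps carrier conditions out of the
  calculations; values at indices from \<open>p k\<close> on are ignored.\<close>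

definition el :: "nat \<Rightarrow> (nat \<Rightarrow> nat \<Rightarrow> complex) \<Rightarrow> 'a" where
  "el k c = h k (mat (p k) (p k) (\<lambda>(i, j). c i j))"

definition dg :: "nat \<Rightarrow> (nat \<Rightarrow> complex) \<Rightarrow> 'a" where
  "dg k d = el k (\<lambda>i j. if i = j then d i else 0)"

definition E :: "nat \<Rightarrow> nat \<Rightarrow> nat \<Rightarrow> 'a" where
  "E k a b = el k (\<lambda>i j. if i = a \<and> j = b then 1 else 0)"

lemma hom: "unital_star_hom (p k) (h k)"
  using lim by (simp add: uhf_limit_def)

lemma el_cong: "(\<And>i j. i < p k \<Longrightarrow> j < p k \<Longrightarrow> c i j = d i j) \<Longrightarrow> el k c = el k d"
  unfolding el_def by (intro arg_cong[where f = "h k"] eq_matI) auto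

lemma el_mat: "a \<in> carrier_mat (p k) (p k) \<Longrightarrow> el k (\<lambda>i j. a $$ (i, j)) = h k a"
  unfolding el_def by (intro arg_cong[where f = "h k"] eq_matI) auto

lemma el_inj: "el k c = el k d \<Longrightarrow> i < p k \<Longrightarrow> j < p k \<Longrightarrow> c i j = d i j"
proof -
  assume *: "el k c = el k d" "i < p k" "j < p k"
  have "inj_on (h k) (carrier_mat (p k) (p k))" using lim by (simp add: uhf_limit_def)
  then have "mat (p k) (p k) (\<lambda>(i, j). c i j) = mat (p k) (p k) (\<lambda>(i, j). d i j)"
    using *(1) unfolding el_def by (auto dest!: inj_onD)
  then have "mat (p k) (p k) (\<lambda>(i, j). c i j) $$ (i, j) = mat (p k) (p k) (\<lambda>(i, j). d i j) $$ (i, j)"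
    by simp
  then show ?thesis using *(2,3) by simp
qed

lemma el_add: "el k c + el k d = el k (\<lambda>i j. c i j + d i j)"
proof -
  let ?m = "\<lambda>c. mat (p k) (p k) (\<lambda>(i, j). c i j)"
  have "h k (?m c + ?m d) = h k (?m c) + h k (?m d)" using hom[of k] by (simp add: unital_star_hom_def)
  moreover have "?m c + ?m d = ?m (\<lambda>i j. c i j + d i j)" by (intro eq_matI) auto
  ultimately show ?thesis by (simp add: el_def)
qed

lemma el_mult: "el k c * el k d = el k (\<lambda>i j. \<Sum>l<p k. c i l * d l j)"
proof -
  let ?m = "\<lambda>c. mat (p k) (p k) (\<lambda>(i, j). c i j)"
  have "h k (?m c * ?m d) = h k (?m c) * h k (?m d)" using hom[of k] by (simp add: unital_star_hom_def)
  moreover have "?m c * ?m d = ?m (\<lambda>i j. \<Sum>l<p k. c i l * d l j)"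
    by (intro eq_matI) (auto simp: scalar_prod_def atLeast0LessThan)
  ultimately show ?thesis by (simp add: el_def)
qed

lemma el_scale: "scaleC z (el k c) = el k (\<lambda>i j. z * c i j)"
proof -
  let ?m = "\<lambda>c. mat (p k) (p k) (\<lambda>(i, j). c i j)"
  have "h k (z \<cdot>\<^sub>m ?m c) = scaleC z (h k (?m c))" using hom[of k] by (simp add: unital_star_hom_def)
  moreover have "z \<cdot>\<^sub>m ?m c = ?m (\<lambda>i j. z * c i j)" by (intro eq_matI) auto
  ultimately show ?thesis by (simp add: el_def)
qed

lemma el_star: "star (el k c) = el k (\<lambda>i j. cnj (c j i))"
proof -
  let ?m = "\<lambda>c. mat (p k) (p k) (\<lambda>(i, j). c i j)"
  have "h k (mat_star (?m c)) = star (h k (?m c))" using hom[of k] by (simp add: unital_star_hom_def)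
  moreover have "mat_star (?m c) = ?m (\<lambda>i j. cnj (c j i))"
    by (intro eq_matI) (auto simp: mat_star_def star_complex_def)
  ultimately show ?thesis by (simp add: el_def)
qed

lemma el_one: "el k (\<lambda>i j. if i = j then 1 else 0) = 1"
proof -
  have "h k (1\<^sub>m (p k)) = 1" using hom[of k] by (simp add: unital_star_hom_def)
  moreover have "mat (p k) (p k) (\<lambda>(i, j). if i = j then 1 else 0) = (1\<^sub>m (p k) :: complex mat)"
    by (intro eq_matI) auto
  ultimately show ?thesis by (simp add: el_def)
qed

lemma el_zero: "el k (\<lambda>i j. 0) = 0"
  using el_scale[of 0 k "\<lambda>i j. 0"] by simp

lemma el_minus: "- el k c = el k (\<lambda>i j. - c i j)"
  using el_scale[of "-1" k c] by (simp add: scaleC_minus_one)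

lemma el_diff: "el k c - el k d = el k (\<lambda>i j. c i j - d i j)"
  using el_add[of k c "\<lambda>i j. - d i j"] by (simp flip: el_minus)

lemma el_sum: "finite A \<Longrightarrow> (\<Sum>a\<in>A. el k (c a)) = el k (\<lambda>i j. \<Sum>a\<in>A. c a i j)"
  by (induction A rule: finite_induct) (auto simp: el_zero el_add)

lemma el_Suc: "el k c = el (Suc k) (blk (p k) c)"
proof -
  let ?m = "mat (p k) (p k) (\<lambda>(i, j). c i j)"
  have "h (Suc k) (uhf_connect (p k) (p (Suc k)) ?m) = h k ?m"
    using lim by (simp add: uhf_limit_def)
  moreover have "uhf_connect (p k) (p (Suc k)) ?m =
      mat (p (Suc k)) (p (Suc k)) (\<lambda>(i, j). blk (p k) c i j)"
    by (intro eq_matI) (auto simp: uhf_connect_def blk_def)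
  ultimately show ?thesis by (simp add: el_def)
qed

lemma el_up: "k \<le> K \<Longrightarrow> el k c = el K (blk (p k) c)"
proof (induction K rule: dec_induct)
  case base
  show ?case by (intro el_cong) (simp add: blk_less)
next
  case (step K)
  then show ?case by (simp add: el_Suc[of K] blk_blk p_dvd)
qed

lemma level_eq: "uhf_level p h k = range (el k)"
proof -
  have "x \<in> range (el k)" if "x \<in> uhf_level p h k" for x
  proof -
    from that obtain a where "x = h k a" "a \<in> carrier_mat (p k) (p k)" by (auto simp: uhf_level_def)
    then have "x = el k (\<lambda>i j. a $$ (i, j))" by (simp add: el_mat)
    then show ?thesis by simp
  qed
  moreover have "el k c \<in> uhf_level p h k" for c
    by (auto simp: uhf_level_def el_def)
  ultimately show ?thesis by auto
qed

lemma diag_eq: "uhf_diag p h k = range (dg k)"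
proof -
  have "x \<in> range (dg k)" if "x \<in> uhf_diag p h k" for x
  proof -
    from that obtain a where a: "x = h k a" "a \<in> carrier_mat (p k) (p k)" "diagonal_mat a"
      by (auto simp: uhf_diag_def)
    then have "x = dg k (\<lambda>i. a $$ (i, i))"
      unfolding dg_def a(1) el_mat[OF a(2), symmetric]
      by (intro el_cong) (auto simp: diagonal_mat_def)
    then show ?thesis by simp
  qed
  moreover have "dg k c \<in> uhf_diag p h k" for c
    by (auto simp: uhf_diag_def dg_def el_def diagonal_mat_def intro!: imageI)
  ultimately show ?thesis by auto
qed

lemma level_mono: "k \<le> K \<Longrightarrow> range (el k) \<subseteq> range (el K)"
  using el_up by (metis image_subsetI rangeI)

lemma dg_up: "k \<le> K \<Longrightarrow> dg k d = dg K (\<lambda>i. d (i mod p k))"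
  unfolding dg_def by (subst el_up, assumption, intro el_cong)
    (auto simp: blk_def, metis div_mult_mod_eq)

lemma diag_mono: "k \<le> K \<Longrightarrow> range (dg k) \<subseteq> range (dg K)"
  using dg_up by (metis image_subsetI rangeI)

lemma dg_mult: "dg k c * dg k d = dg k (\<lambda>i. c i * d i)"
proof -
  have "(if i = l then c i else 0) * (if l = j then d l else 0) =
      (if l = i then (if i = j then c i * d i else 0) else 0)" for i j l
    by simp
  then show ?thesis unfolding dg_def el_mult by (intro el_cong) simp
qed

lemma dg_add: "dg k c + dg k d = dg k (\<lambda>i. c i + d i)"
  unfolding dg_def el_add by (intro el_cong) auto

lemma dg_diff: "dg k c - dg k d = dg k (\<lambda>i. c i - d i)"
  unfolding dg_def el_diff by (intro el_cong) auto

lemma dg_scale: "scaleC z (dg k d) = dg k (\<lambda>i. z * d i)"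
  unfolding dg_def el_scale by (intro el_cong) auto

lemma dg_star: "star (dg k d) = dg k (\<lambda>i. cnj (d i))"
  unfolding dg_def el_star by (intro el_cong) auto

lemma dg_one: "dg k (\<lambda>i. 1) = 1"
  unfolding dg_def by (rule el_one)

lemma dg_zero: "dg k (\<lambda>i. 0) = 0"
  unfolding dg_def using el_zero[of k] by simp

lemma dg_el: "dg k d * el k c = el k (\<lambda>i j. d i * c i j)"
  unfolding dg_def el_mult by (intro el_cong) (auto simp: if_distrib[of "\<lambda>x. x * _"] cong: if_cong)

lemma el_dg: "el k c * dg k d = el k (\<lambda>i j. c i j * d j)"
  unfolding dg_def el_mult by (intro el_cong) (auto simp: if_distrib cong: if_cong)

lemma E_diag: "E k a a = dg k (\<lambda>i. if i = a then 1 else 0)"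
  unfolding E_def dg_def by (intro el_cong) auto

lemma E_mult: "b < p k \<Longrightarrow> b' < p k \<Longrightarrow> E k a b * E k b' d = (if b = b' then E k a d else 0)"
proof -
  assume b: "b < p k" "b' < p k"
  have "(\<Sum>l<p k. (if i = a \<and> l = b then 1 else 0) * (if l = b' \<and> j = d then 1 else 0)) =
      (\<Sum>l<p k. if l = b then (if b = b' \<and> i = a \<and> j = d then 1 else (0::complex)) else 0)" for i j
    by (intro sum.cong) auto
  then have "E k a b * E k b' d = el k (\<lambda>i j. if b = b' \<and> i = a \<and> j = d then 1 else 0)"
    using b by (simp add: E_def el_mult)
  then show ?thesis by (simp add: E_def el_zero)
qed

lemma E_star: "star (E k a b) = E k b a"
  unfolding E_def el_star by (intro el_cong) auto

lemma E_el_E: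
  "a < p k \<Longrightarrow> b < p k \<Longrightarrow> E k a a * el k c * E k b b = scaleC (c a b) (E k a b)"
  unfolding E_diag dg_el el_dg unfolding E_def el_scale by (intro el_cong) auto

lemma el_expand: "el k c = (\<Sum>i<p k. \<Sum>j<p k. scaleC (c i j) (E k i j))"
proof -
  have "(\<Sum>i<p k. \<Sum>j<p k. scaleC (c i j) (E k i j)) =
     el k (\<lambda>a b. \<Sum>i<p k. \<Sum>j<p k. c i j * (if a = i \<and> b = j then 1 else 0))"
    by (simp add: E_def el_scale el_sum)
  also have "\<dots> = el k c"
  proof (intro el_cong)
    fix a b assume ab: "a < p k" "b < p k"
    have "(\<Sum>i<p k. \<Sum>j<p k. c i j * (if a = i \<and> b = j then 1 else 0)) =
        (\<Sum>i<p k. \<Sum>j<p k. if b = j then (if a = i then c i j else 0) else 0)"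
      by (intro sum.cong) auto
    then show "(\<Sum>i<p k. \<Sum>j<p k. c i j * (if a = i \<and> b = j then 1 else 0)) = c a b"
      using ab by simp
  qed
  finally show ?thesis by simp
qed

lemma dg_expand: "dg k d = (\<Sum>i<p k. scaleC (d i) (E k i i))"
proof -
  have "scaleC (if i = j then d i else 0) (E k i j) = (if j = i then scaleC (d i) (E k i i) else 0)" for i j
    by auto
  then show ?thesis unfolding dg_def el_expand by simp
qed

lemma one_expand: "1 = (\<Sum>i<p k. E k i i)"
  using dg_expand[of k "\<lambda>i. 1"] by (simp add: dg_one)

lemma dense: "\<forall>e>0. \<exists>K\<ge>K0. \<exists>c. norm (x - el K c) < e"
proof (intro allI impI)
  fix e :: real assume "0 < e"
  have "x \<in> closure (\<Union>k. h k ` carrier_mat (p k) (p k))" using lim by (simp add: uhf_limit_def)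
  then obtain y where y: "y \<in> (\<Union>k. h k ` carrier_mat (p k) (p k))" "dist y x < e"
    using \<open>0 < e\<close> closure_approachable by blast
  then obtain k a where "a \<in> carrier_mat (p k) (p k)" "y = h k a" by auto
  then have "y = el k (\<lambda>i j. a $$ (i, j))" by (simp add: el_mat)
  then have "y = el (max k K0) (blk (p k) (\<lambda>i j. a $$ (i, j)))" using el_up[of k "max k K0"] by simp
  then show "\<exists>K\<ge>K0. \<exists>c. norm (x - el K c) < e"
    using y(2) by (intro exI[of _ "max k K0"]) (auto simp: dist_norm norm_minus_commute)
qed

lemma approx_seq: "\<exists>K c. (\<forall>m. K0 + m \<le> K m) \<and> (\<lambda>m. el (K m) (c m)) \<longlonglongrightarrow> x"
proof -
  have "\<exists>K c. K0 + m \<le> K \<and> norm (x - el K c) < inverse (real (Suc m))" for m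
    using dense[of "K0 + m" x, rule_format, of "inverse (real (Suc m))"] by auto
  then obtain K c where K: "\<And>m. K0 + m \<le> K m" "\<And>m. norm (x - el (K m) (c m)) < inverse (real (Suc m))"
    by metis
  have "(\<lambda>m. el (K m) (c m) - x) \<longlonglongrightarrow> 0"
    by (rule Lim_null_comparison[OF _ LIMSEQ_inverse_real_of_nat])
      (use K(2) in \<open>auto simp: norm_minus_commute intro!: always_eventually less_imp_le\<close>)
  then show ?thesis using K(1) LIM_zero_iff by blast
qed

text \<open>
  The map \<open>h k\<close> is isometric for the operator norm. For the lower bound, compress to the rank
  one matrix \<open>P = \<xi> \<xi>\<^sup>*\<close>: for \<open>x = el k c\<close> one has \<open>(x P)\<^sup>* (x P) = \<parallel>c \<xi>\<parallel>\<^sup>2 P\<close>.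
\<close>

lemma opb_el: "opb (pset k) (norm (el k c)) c"
  unfolding opb_def
proof
  fix \<xi> :: "nat \<Rightarrow> complex"
  let ?F = "pset k"
  define \<eta> where "\<eta> = app ?F c \<xi>"
  define P where "P = el k (\<lambda>i j. \<xi> i * cnj (\<xi> j))"
  have ipsum: "(\<Sum>l<p k. cnj (\<zeta> l) * \<zeta> l) = of_real (sq ?F \<zeta>)" for \<zeta>
    using ip_self[of ?F \<zeta>] by (simp add: ip_def)
  show "sq ?F (app ?F c \<xi>) \<le> (norm (el k c))\<^sup>2 * sq ?F \<xi>"
  proof (cases "sq ?F \<xi> = 0")
    case True
    then have "\<forall>a\<in>?F. \<xi> a = 0" by (simp add: sq_eq_0)
    then have "sq ?F (app ?F c \<xi>) = 0" by (simp add: sq_eq_0 app_def)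
    then show ?thesis by simp
  next
    case False
    have P0: "P \<noteq> 0"
    proof
      assume "P = 0"
      then have "\<xi> i * cnj (\<xi> i) = 0" if "i < p k" for i
        using el_inj[of k "\<lambda>i j. \<xi> i * cnj (\<xi> j)" "\<lambda>i j. 0" i i] that by (simp add: el_zero P_def)
      then show False using False by (simp add: sq_eq_0)
    qed
    have xP: "el k c * P = el k (\<lambda>i j. \<eta> i * cnj (\<xi> j))"
      unfolding P_def el_mult \<eta>_def app_def
      by (intro el_cong) (simp add: sum_distrib_right mult.assoc)
    have gen: "star (el k (\<lambda>i j. \<zeta> i * cnj (\<xi> j))) * el k (\<lambda>i j. \<zeta> i * cnj (\<xi> j)) =
        scaleC (of_real (sq ?F \<zeta>)) P" for \<zeta>
      unfolding P_def el_mult el_star el_scale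
    proof (intro el_cong)
      fix i j
      have "(\<Sum>l<p k. cnj (\<zeta> l * cnj (\<xi> i)) * (\<zeta> l * cnj (\<xi> j))) =
          (\<Sum>l<p k. cnj (\<zeta> l) * \<zeta> l) * (\<xi> i * cnj (\<xi> j))"
        unfolding sum_distrib_right by (intro sum.cong) (auto simp: algebra_simps)
      then show "(\<Sum>l<p k. cnj (\<zeta> l * cnj (\<xi> i)) * (\<zeta> l * cnj (\<xi> j))) =
          of_real (sq ?F \<zeta>) * (\<xi> i * cnj (\<xi> j))" by (simp only: ipsum)
    qed
    have 1: "(norm P)\<^sup>2 = sq ?F \<xi> * norm P"
      using norm_star_mult[of P] gen[of \<xi>] by (simp add: norm_scaleC flip: P_def)
    have 2: "(norm (el k c * P))\<^sup>2 = sq ?F \<eta> * norm P"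
      unfolding norm_star_mult[symmetric] unfolding xP gen by (simp add: norm_scaleC)
    have "(norm (el k c * P))\<^sup>2 \<le> (norm (el k c) * norm P)\<^sup>2"
      by (intro power_mono norm_mult_ineq) auto
    then have "sq ?F \<eta> * norm P \<le> (norm (el k c))\<^sup>2 * sq ?F \<xi> * norm P"
      unfolding 2 power_mult_distrib 1 by (simp add: mult.assoc)
    then show ?thesis using P0 by (simp add: \<eta>_def)
  qed
qed

lemma el_entry_le: "i < p k \<Longrightarrow> j < p k \<Longrightarrow> cmod (c i j) \<le> norm (el k c)"
  using opb_entry[OF opb_el] by simp

text \<open>
  For the upper bound, all entries of the powers of \<open>x\<^sup>* x\<close> are at most \<open>(c\<^sup>2)\<^sup>m\<close>, so that
  \<open>\<parallel>x\<parallel>\<^sup>2\<^sup>m \<le> B c\<^sup>2\<^sup>m\<close> with \<open>B\<close> depending on \<open>k\<close> only.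
\<close>

lemma norm_el_le:
  assumes "opb (pset k) c M" "0 \<le> c"
  shows "norm (el k M) \<le> c"
proof -
  have main: "norm (el k M) \<le> c" if M: "opb (pset k) c M" and c: "0 < c" for c
  proof (rule ccontr)
    assume less: "\<not> norm (el k M) \<le> c"
    define B where "B = (\<Sum>i<p k. \<Sum>j<p k. norm (E k i j))"
    have bound: "norm (el k L) \<le> d * B" if "opb (pset k) d L" "0 \<le> d" for L d
    proof -
      have "norm (el k L) \<le> (\<Sum>i<p k. \<Sum>j<p k. norm (scaleC (L i j) (E k i j)))"
        unfolding el_expand by (intro sum_norm_le norm_sum)
      also have "\<dots> \<le> (\<Sum>i<p k. \<Sum>j<p k. d * norm (E k i j))"
        using that by (intro sum_mono) (auto simp: norm_scaleC intro!: mult_right_mono opb_entry[of "pset k"])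
      finally show ?thesis by (simp add: B_def sum_distrib_left)
    qed
    define y where "y = star (el k M) * el k M"
    have "\<exists>L. y ^ (2 ^ m) = el k L \<and> opb (pset k) (c ^ (2 ^ Suc m)) L \<and> star (el k L) = el k L \<and>
       norm (el k L) = norm (el k M) ^ (2 ^ Suc m)" for m
    proof (induction m)
      case 0
      have "y = el k (\<lambda>i j. \<Sum>l<p k. cnj (M l i) * M l j)" by (simp add: y_def el_star el_mult)
      moreover have "opb (pset k) (c * c) (\<lambda>i j. \<Sum>l<p k. cnj (M l i) * M l j)"
        by (intro opb_mult opb_adj M c)
      moreover have "star y = y" by (simp add: y_def star_mult star_star)
      moreover have "norm y = norm (el k M) ^ 2" by (simp add: y_def norm_star_mult)
      ultimately show ?case by (auto simp: power2_eq_square)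
    next
      case (Suc m)
      then obtain L where L: "y ^ (2 ^ m) = el k L" "opb (pset k) (c ^ (2 ^ Suc m)) L"
        "star (el k L) = el k L" "norm (el k L) = norm (el k M) ^ (2 ^ Suc m)" by blast
      have e: "y ^ (2 ^ Suc m) = el k L * el k L"
        by (simp add: power_even_eq power2_eq_square flip: L(1))
      have 1: "opb (pset k) (c ^ (2 ^ Suc m) * c ^ (2 ^ Suc m)) (\<lambda>i j. \<Sum>l<p k. L i l * L l j)"
        by (intro opb_mult L)
      have 2: "star (el k L * el k L) = el k L * el k L" by (simp add: star_mult L)
      have 3: "norm (el k L * el k L) = (norm (el k L))\<^sup>2"
        using norm_star_mult[of "el k L"] L(3) by simp
      have 4: "c ^ (2 ^ Suc m) * c ^ (2 ^ Suc m) = c ^ (2 ^ Suc (Suc m))"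
        by (simp flip: power_add)
      have 5: "(norm (el k L))\<^sup>2 = norm (el k M) ^ (2 ^ Suc (Suc m))"
        unfolding L(4) by (simp flip: power_mult)
      show ?case
        by (rule exI[of _ "\<lambda>i j. \<Sum>l<p k. L i l * L l j"], fold el_mult, intro conjI)
          (fact e, fact 1[unfolded 4], fact 2, fact 3[unfolded 5])
    qed
    then have le: "norm (el k M) ^ (2 ^ Suc m) \<le> c ^ (2 ^ Suc m) * B" for m
      using bound c by (metis less_imp_le zero_less_power)
    define r where "r = norm (el k M) / c"
    have r: "1 < r" using less c by (simp add: r_def)
    have rB: "r ^ (2 ^ Suc m) \<le> B" for m
      using le[of m] c by (simp add: r_def power_divide field_simps)
    obtain n where n: "B < r ^ n" using real_arch_pow[OF r] by blast
    have "r ^ n \<le> r ^ (2 ^ Suc n)"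
    proof (rule power_increasing)
      show "n \<le> 2 ^ Suc n" using less_exp[of n] unfolding power_Suc by linarith
    qed (use r in simp)
    then show False using n rB[of n] by simp
  qed
  show ?thesis
  proof (rule field_le_epsilon)
    fix e :: real assume "0 < e"
    then have "opb (pset k) (c + e) M" by (intro opb_weaken[OF assms]) simp
    then show "norm (el k M) \<le> c + e" by (rule main) (use assms(2) \<open>0 < e\<close> in simp)
  qed
qed

definition lvl :: "'a set" where "lvl = (\<Union>k. range (el k))"

definition coef :: "nat \<Rightarrow> nat \<Rightarrow> 'a \<Rightarrow> complex" where
  "coef i j x = (SOME z. \<exists>k c. x = el k c \<and> z = blk (p k) c i j)"

text \<open>Two descriptions of one element agree at a common level by injectivity, and repeating
  the blocks extends the agreement to all indices.\<close>

lemma coef_el: "coef i j (el k c) = blk (p k) c i j"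
proof -
  have *: "blk (p k) c i j = blk (p k') c' i j" if "el k c = el k' c'" for k c k' c'
  proof -
    let ?K = "max k k'"
    have "el ?K (blk (p k) c) = el ?K (blk (p k') c')"
      using that el_up[of k ?K c] el_up[of k' ?K c'] by simp
    then have "blk (p k) c a b = blk (p k') c' a b" if "a < p ?K" "b < p ?K" for a b
      using el_inj that by blast
    then have "blk (p ?K) (blk (p k) c) i j = blk (p ?K) (blk (p k') c') i j"
      by (simp add: blk_def[of "p ?K"])
    then show ?thesis by (simp add: blk_blk p_dvd)
  qed
  have "\<exists>z. \<exists>k' c'. el k c = el k' c' \<and> z = blk (p k') c' i j" by blast
  then have "\<exists>k' c'. el k c = el k' c' \<and> coef i j (el k c) = blk (p k') c' i j"
    unfolding coef_def by (rule someI_ex)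
  then show ?thesis using * by metis
qed

lemma blk_le: "cmod (blk (p k) c i j) \<le> norm (el k c)"
  by (simp add: blk_def el_entry_le)

lemma lvl_common:
  assumes "x \<in> lvl" "y \<in> lvl"
  obtains K c d where "x = el K c" "y = el K d"
proof -
  obtain k c k' d where "x = el k c" "y = el k' d" using assms by (auto simp: lvl_def)
  then have "x = el (max k k') (blk (p k) c)" "y = el (max k k') (blk (p k') d)"
    using el_up[of k "max k k'" c] el_up[of k' "max k k'" d] by auto
  then show ?thesis using that by blast
qed

lemma blk_diff: "blk q c i j - blk q d i j = blk q (\<lambda>i j. c i j - d i j) i j"
  by (simp add: blk_def)

lemma coef_lipschitz: "x \<in> lvl \<Longrightarrow> y \<in> lvl \<Longrightarrow> cmod (coef i j x - coef i j y) \<le> norm (x - y)"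
  by (erule (1) lvl_common) (simp add: coef_el blk_diff el_diff blk_le)

lemma closure_lvl: "closure lvl = UNIV"
proof -
  have "x \<in> closure lvl" for x
    unfolding closure_approachable
    using dense[of 0 x] by (force simp: lvl_def dist_norm norm_minus_commute)
  then show ?thesis by auto
qed

text \<open>
  The matrix entries of an element in the representation of the limit on \<open>\<ell>\<^sup>2(\<nat>)\<close> in which
  \<open>h k x\<close> acts as \<open>x \<oplus> x \<oplus> x \<oplus> \<dots>\<close>, so that no bound on the indices is needed.
\<close>

definition ent :: "'a \<Rightarrow> nat \<Rightarrow> nat \<Rightarrow> complex" where
  "ent x i j = (SOME g. continuous_on UNIV g \<and> (\<forall>x\<in>lvl. g x = coef i j x)) x"

lemma ent_props: "continuous_on UNIV (\<lambda>x. ent x i j)" "x \<in> lvl \<Longrightarrow> ent x i j = coef i j x"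
proof -
  have "uniformly_continuous_on lvl (coef i j)"
    unfolding uniformly_continuous_on_def
    using coef_lipschitz[of _ _ i j] by (auto simp: dist_norm intro: order.strict_trans1)
  then obtain g where "uniformly_continuous_on (closure lvl) g" "\<And>x. x \<in> lvl \<Longrightarrow> coef i j x = g x"
    by (rule uniformly_continuous_on_extension_on_closure) blast
  then have "\<exists>g. continuous_on UNIV g \<and> (\<forall>x\<in>lvl. g x = coef i j x)"
    using uniformly_continuous_imp_continuous[of "closure lvl" g] unfolding closure_lvl
    by (intro exI[of _ g]) simp
  then have *: "continuous_on UNIV (SOME g. continuous_on UNIV g \<and> (\<forall>x\<in>lvl. g x = coef i j x)) \<and>
      (\<forall>x\<in>lvl. (SOME g. continuous_on UNIV g \<and> (\<forall>x\<in>lvl. g x = coef i j x)) x = coef i j x)"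
    by (rule someI_ex)
  have e: "(\<lambda>x. ent x i j) = (SOME g. continuous_on UNIV g \<and> (\<forall>x\<in>lvl. g x = coef i j x))"
    by (simp add: ent_def fun_eq_iff)
  show "continuous_on UNIV (\<lambda>x. ent x i j)" unfolding e using * by blast
  show "x \<in> lvl \<Longrightarrow> ent x i j = coef i j x" using * by (simp add: ent_def)
qed

lemma ent_blk: "ent (el k c) i j = blk (p k) c i j"
  using ent_props(2)[of "el k c" i j] by (auto simp: lvl_def coef_el)

lemma ent_el: "i < p k \<Longrightarrow> j < p k \<Longrightarrow> ent (el k c) i j = c i j"
  by (simp add: ent_blk blk_less)

lemma ent_tendsto: "(f \<longlongrightarrow> x) G \<Longrightarrow> ((\<lambda>m. ent (f m) i j) \<longlongrightarrow> ent x i j) G"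
  by (rule continuous_on_tendsto_compose[OF ent_props(1)]) auto

lemma approx_pair:
  "\<exists>K c d. (\<forall>m. K0 + m \<le> K m) \<and> (\<lambda>m. el (K m) (c m)) \<longlonglongrightarrow> x \<and> (\<lambda>m. el (K m) (d m)) \<longlonglongrightarrow> y"
proof -
  obtain K c where 1: "\<forall>m. K0 + m \<le> K m" "(\<lambda>m. el (K m) (c m)) \<longlonglongrightarrow> x"
    using approx_seq[of K0 x] by blast
  obtain K' d where 2: "\<forall>m. K0 + m \<le> K' m" "(\<lambda>m. el (K' m) (d m)) \<longlonglongrightarrow> y"
    using approx_seq[of K0 y] by blast
  define L where "L m = max (K m) (K' m)" for m
  have a: "(\<lambda>m. el (K m) (c m)) = (\<lambda>m. el (L m) (blk (p (K m)) (c m)))"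
    by (intro ext el_up) (simp add: L_def)
  have b: "(\<lambda>m. el (K' m) (d m)) = (\<lambda>m. el (L m) (blk (p (K' m)) (d m)))"
    by (intro ext el_up) (simp add: L_def)
  have "\<forall>m. K0 + m \<le> L m" using 1(1) by (auto simp: L_def intro: max.coboundedI1)
  then show ?thesis using 1(2)[unfolded a] 2(2)[unfolded b]
    by (intro exI[of _ L] exI[of _ "\<lambda>m. blk (p (K m)) (c m)"] exI[of _ "\<lambda>m. blk (p (K' m)) (d m)"]) simp
qed

lemma ent_add: "ent (x + y) i j = ent x i j + ent y i j"
proof -
  obtain K c d where *: "(\<lambda>m. el (K m) (c m)) \<longlonglongrightarrow> x" "(\<lambda>m. el (K m) (d m)) \<longlonglongrightarrow> y"
    using approx_pair[of 0 x y] by blast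
  have "(\<lambda>m. ent (el (K m) (c m) + el (K m) (d m)) i j) \<longlonglongrightarrow> ent (x + y) i j"
    by (intro ent_tendsto tendsto_add *)
  moreover have "(\<lambda>m. ent (el (K m) (c m) + el (K m) (d m)) i j) =
      (\<lambda>m. ent (el (K m) (c m)) i j + ent (el (K m) (d m)) i j)"
    by (simp add: el_add ent_blk blk_def fun_eq_iff)
  moreover have "(\<lambda>m. ent (el (K m) (c m)) i j + ent (el (K m) (d m)) i j) \<longlonglongrightarrow> ent x i j + ent y i j"
    by (intro tendsto_add ent_tendsto *)
  ultimately show ?thesis by (simp add: LIMSEQ_unique)
qed

lemma ent_scale: "ent (scaleC z x) i j = z * ent x i j"
proof -
  obtain K c where *: "(\<lambda>m. el (K m) (c m)) \<longlonglongrightarrow> x"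
    using approx_seq[of 0 x] by blast
  have "(\<lambda>m. ent (scaleC z (el (K m) (c m))) i j) \<longlonglongrightarrow> ent (scaleC z x) i j"
    by (intro ent_tendsto bounded_linear.tendsto[OF bounded_linear_scaleC] *)
  moreover have "(\<lambda>m. ent (scaleC z (el (K m) (c m))) i j) = (\<lambda>m. z * ent (el (K m) (c m)) i j)"
    by (simp add: el_scale ent_blk blk_def fun_eq_iff)
  moreover have "(\<lambda>m. z * ent (el (K m) (c m)) i j) \<longlonglongrightarrow> z * ent x i j"
    by (intro tendsto_mult tendsto_const ent_tendsto *)
  ultimately show ?thesis using LIMSEQ_unique by metis
qed

lemma ent_star: "ent (star x) i j = cnj (ent x j i)"
proof -
  obtain K c where *: "(\<lambda>m. el (K m) (c m)) \<longlonglongrightarrow> x"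
    using approx_seq[of 0 x] by blast
  have "(\<lambda>m. ent (star (el (K m) (c m))) i j) \<longlonglongrightarrow> ent (star x) i j"
    by (intro ent_tendsto bounded_linear.tendsto[OF bounded_linear_star] *)
  moreover have "(\<lambda>m. ent (star (el (K m) (c m))) i j) = (\<lambda>m. cnj (ent (el (K m) (c m)) j i))"
    by (simp add: el_star ent_blk blk_def fun_eq_iff)
  moreover have "(\<lambda>m. cnj (ent (el (K m) (c m)) j i)) \<longlonglongrightarrow> cnj (ent x j i)"
    by (intro tendsto_cnj ent_tendsto *)
  ultimately show ?thesis using LIMSEQ_unique by metis
qed

lemma ent_minus: "ent (- x) i j = - ent x i j"
  using ent_scale[of "-1" x] by (simp add: scaleC_minus_one)

lemma ent_diff: "ent (x - y) i j = ent x i j - ent y i j"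
  using ent_add[of x "- y"] by (simp add: ent_minus)

lemma ent_scaleR: "ent (scaleR r x) i j = of_real r * ent x i j"
  by (simp flip: scaleC_of_real add: ent_scale)

lemma ent_zero [simp]: "ent 0 i j = 0"
  using ent_diff[of 0 0] by simp

lemma ent_one: "ent 1 i j = (if i = j then 1 else 0)"
  unfolding el_one[of 0, symmetric] ent_blk blk_def by (simp, metis div_mult_mod_eq)

lemma ent_sum: "ent (\<Sum>a\<in>A. f a) i j = (\<Sum>a\<in>A. ent (f a) i j)"
  by (induction A rule: infinite_finite_induct) (auto simp: ent_add)

lemma ent_dg: "ent (dg k d) i j = (if i = j then d (i mod p k) else 0)"
  unfolding dg_def ent_blk blk_def by (simp, metis div_mult_mod_eq)

lemma ent_mult_level:
  assumes "x \<in> range (el K)" "y \<in> range (el K)" "i < p K" "j < p K"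
  shows "ent (x * y) i j = (\<Sum>l<p K. ent x i l * ent y l j)"
  using assms by (auto simp: el_mult ent_el)

lemma el_ent: "x \<in> range (el K) \<Longrightarrow> x = el K (ent x)"
  by (auto simp: ent_el intro!: el_cong)

lemma opb_ent: "opb (pset K) (norm x) (ent x)"
proof -
  obtain L c where *: "\<forall>m. K + m \<le> L m" "(\<lambda>m. el (L m) (c m)) \<longlonglongrightarrow> x"
    using approx_seq[of K x] by blast
  show ?thesis
  proof (rule opb_limit)
    show "(\<lambda>m. norm (el (L m) (c m))) \<longlonglongrightarrow> norm x" by (intro tendsto_norm *)
    show "(\<lambda>m. ent (el (L m) (c m)) a b) \<longlonglongrightarrow> ent x a b" for a b by (intro ent_tendsto *)
    fix m
    have le: "p K \<le> p (L m)" using *(1) by (intro p_mono) (meson add_leE)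
    have "opb (pset (L m)) (norm (el (L m) (c m))) (ent (el (L m) (c m)))"
      using opb_el[of "L m" "c m"] by (subst opb_cong[where N = "c m"]) (auto simp: ent_el)
    then show "opb (pset K) (norm (el (L m) (c m))) (ent (el (L m) (c m)))"
      using le by (elim opb_subset) auto
  qed
qed

lemma ent_le: "i < p K \<Longrightarrow> j < p K \<Longrightarrow> cmod (ent x i j) \<le> norm x"
  using opb_entry[OF opb_ent] by simp

text \<open>Compare \<open>x\<close> with a nearby level element \<open>el K d\<close>: the norm of
  the latter is read off the single corner \<open>K\<close> by \<open>norm_el_le\<close>, and that
  corner differs from the corner of \<open>x\<close> by at most the distance.\<close>

lemma norm_le_opb:
  assumes "\<And>K. opb (pset K) c (ent x)" "0 \<le> c"
  shows "norm x \<le> c"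
proof (rule field_le_epsilon)
  fix e :: real assume "0 < e"
  then obtain K d where K: "norm (x - el K d) < e / 2" using dense[of 0 x, rule_format, of "e / 2"] by auto
  have "opb (pset K) (c + norm (el K d - x)) (\<lambda>a b. ent x a b + ent (el K d - x) a b)"
    by (intro opb_add assms opb_ent) auto
  then have "opb (pset K) (c + norm (el K d - x)) d"
    by (subst (asm) opb_cong[where N = d]) (auto simp: ent_el simp flip: ent_add)
  then have "norm (el K d) \<le> c + norm (el K d - x)"
    using assms by (intro norm_el_le) auto
  moreover have "norm x \<le> norm (el K d) + norm (x - el K d)"
    using norm_triangle_ineq[of "el K d" "x - el K d"] by simp
  ultimately show "norm x \<le> c + e" using K by (simp add: norm_minus_commute)
qed

text \<open>Faithfulness of the representation: the corners of \<open>x - y\<close> have bound 0,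
  hence so has its norm.\<close>

lemma ent_eqI:
  assumes "\<And>k i j. i < p k \<Longrightarrow> j < p k \<Longrightarrow> ent x i j = ent y i j"
  shows "x = y"
proof -
  have "opb (pset K) 0 (ent (x - y))" for K
    using assms by (subst opb_cong[where N = "\<lambda>a b. 0"]) (auto simp: ent_diff opb_def app_def sq_def)
  then have "norm (x - y) \<le> 0" by (rule norm_le_opb) simp
  then show ?thesis by simp
qed

end

section \<open>Positivity of matrices over a UHF algebra\<close>

text \<open>The vector with -r B at \<open>a\<close> and 1 at \<open>b\<close> yields a quadratic
  polynomial in the real parameter r. If A > 0, take r = 1 / A; if A = 0, a large r forces B =
  0.\<close>

lemma psd_minor:
  assumes M: "psd F M" and fin: "finite F" and ab: "a \<in> F" "b \<in> F"
  shows "(cmod (M a b))\<^sup>2 \<le> Re (M a a) * Re (M b b)"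
proof (cases "a = b")
  case True
  then have "cnj (M a a) = M a a" using M ab by (simp add: psd_hermitian)
  then have "Im (M a a) = 0" by (simp add: complex_eq_iff)
  then have "(cmod (M a a))\<^sup>2 = (Re (M a a))\<^sup>2" by (simp add: cmod_power2)
  then show ?thesis using True by (simp add: power2_eq_square)
next
  case False
  have form: "ip F \<xi> (app F M \<xi>) = cnj (\<xi> a) * (M a a * \<xi> a + M a b * \<xi> b) + cnj (\<xi> b) * (M b a * \<xi> a + M b b * \<xi> b)"
    if "\<And>x. x \<notin> {a, b} \<Longrightarrow> \<xi> x = 0" for \<xi>
  proof -
    have app: "app F M \<xi> x = M x a * \<xi> a + M x b * \<xi> b" for x
    proof -
      have "app F M \<xi> x = (\<Sum>y\<in>{a, b}. M x y * \<xi> y)"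
        unfolding app_def using fin ab that by (intro sum.mono_neutral_right) auto
      then show ?thesis using False by simp
    qed
    have "ip F \<xi> (app F M \<xi>) = (\<Sum>x\<in>{a, b}. cnj (\<xi> x) * app F M \<xi> x)"
      unfolding ip_def using fin ab that by (intro sum.mono_neutral_right) auto
    then show ?thesis using False by (simp add: app)
  qed
  define A B D where "A = Re (M a a)" and "B = M a b" and "D = Re (M b b)"
  have A0: "0 \<le> A" using psd_form[OF M, of "\<lambda>x. if x = a then 1 else 0"] False
    by (subst (asm) form) (auto simp: A_def)
  have D0: "0 \<le> D" using psd_form[OF M, of "\<lambda>x. if x = b then 1 else 0"] False
    by (subst (asm) form) (auto simp: D_def)
  have ba: "M b a = cnj B" using psd_hermitian[OF M ab(2,1)] by (simp add: B_def)
  have quad: "0 \<le> r\<^sup>2 * (cmod B)\<^sup>2 * A - 2 * r * (cmod B)\<^sup>2 + D" for r :: real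
  proof -
    define \<xi> where "\<xi> x = (if x = a then - (of_real r * B) else if x = b then 1 else 0)" for x
    have "0 \<le> Re (ip F \<xi> (app F M \<xi>))" by (rule psd_form[OF M])
    also have "ip F \<xi> (app F M \<xi>) = of_real (r\<^sup>2) * (B * cnj B) * M a a - of_real (2 * r) * (B * cnj B) + M b b"
      using False by (subst form) (auto simp: \<xi>_def ba B_def[symmetric] algebra_simps power2_eq_square)
    also have "\<dots> = of_real (r\<^sup>2 * (cmod B)\<^sup>2) * M a a - of_real (2 * r * (cmod B)\<^sup>2) + M b b"
      by (simp flip: complex_norm_square)
    finally show ?thesis by (simp add: A_def D_def)
  qed
  show ?thesis
  proof (cases "A = 0")
    case True
    have "B = 0"
    proof (rule ccontr)
      assume "B \<noteq> 0"
      then show False using quad[of "(D + 1) / (cmod B)\<^sup>2"] True D0 by simp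
    qed
    then show ?thesis using True by (simp add: B_def A_def)
  next
    case False
    then have "0 < A" using A0 by simp
    then have "(cmod B)\<^sup>2 / A \<le> D" using quad[of "1 / A"] by (simp add: power2_eq_square field_simps)
    then show ?thesis using \<open>0 < A\<close> by (simp add: A_def B_def D_def field_simps)
  qed
qed

text \<open>The Taylor coefficients of \<open>1 - sqrt (1 - x)\<close>, obtained from \<open>T = (x + T\<^sup>2) / 2\<close>.\<close>

fun tc :: "nat \<Rightarrow> real" where
  "tc 0 = 0"
| "tc (Suc 0) = 1 / 2"
| "tc (Suc (Suc m)) = (\<Sum>i<Suc m. tc (Suc i) * tc (Suc m - i)) / 2"

lemma tc_convolution: "(\<Sum>i\<le>m. tc i * tc (m - i)) = 2 * tc m - (if m = 1 then 1 else 0)"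
proof (cases "m < 2")
  case True
  then have "m = 0 \<or> m = 1" by auto
  then show ?thesis by auto
next
  case False
  then obtain k where m: "m = Suc (Suc k)" by (metis Suc_diff_Suc less_2_cases_iff not_less_eq not0_implies_Suc)
  have "(\<Sum>i\<le>m. tc i * tc (m - i)) = (\<Sum>i\<le>Suc k. tc (Suc i) * tc (Suc k - i))"
    unfolding m by (subst sum.atMost_Suc_shift) simp
  also have "\<dots> = (\<Sum>i<Suc k. tc (Suc i) * tc (Suc k - i))"
    by (simp add: lessThan_Suc_atMost)
  finally show ?thesis by (simp add: m)
qed

lemma tc_nonneg: "0 \<le> tc m"
proof (induction m rule: tc.induct)
  case (3 m)
  then show ?case by (auto intro!: sum_nonneg mult_nonneg_nonneg simp del: sum.lessThan_Suc)
qed auto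

text \<open>If s is the sum up to \<open>M\<close>, the sum up to \<open>Suc M\<close> is at most (1
  + s^2) / 2, so the bound 1 propagates. Indeed, as \<open>tc 0 = 0\<close>, a nonzero product with
  \<open>i + j \<le> Suc M\<close> has both indices positive, hence both at most
  \<open>M\<close>.\<close>

lemma tc_sum_le: "(\<Sum>m\<le>M. tc m) \<le> 1"
proof (induction M)
  case (Suc M)
  let ?P = "{(i, j). i + j \<le> Suc M}"
  have fin: "finite ?P" by (rule finite_subset[of _ "{..Suc M} \<times> {..Suc M}"]) auto
  have "(\<Sum>m\<le>Suc M. 2 * tc m - (if m = 1 then 1 else 0)) = (\<Sum>(i, j)\<in>?P. tc i * tc j)"
    by (simp only: sum.triangle_reindex_eq tc_convolution)
  also have "\<dots> = (\<Sum>(i, j)\<in>?P \<inter> {..M} \<times> {..M}. tc i * tc j)"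
  proof (rule sum.mono_neutral_right[OF fin])
    show "\<forall>x\<in>?P - ?P \<inter> {..M} \<times> {..M}. (case x of (i, j) \<Rightarrow> tc i * tc j) = 0"
    proof clarify
      fix i j assume "i + j \<le> Suc M" "(i, j) \<notin> ?P \<inter> {..M} \<times> {..M}"
      then have "i = 0 \<or> j = 0" by auto
      then show "tc i * tc j = 0" by auto
    qed
  qed blast
  also have "\<dots> \<le> (\<Sum>(i, j)\<in>{..M} \<times> {..M}. tc i * tc j)"
    by (rule sum_mono2) (auto intro!: mult_nonneg_nonneg tc_nonneg)
  also have "\<dots> = (\<Sum>i\<le>M. tc i) * (\<Sum>j\<le>M. tc j)"
    by (simp add: sum_product sum.cartesian_product)
  also have "\<dots> \<le> 1 * 1" using Suc by (intro mult_mono sum_nonneg tc_nonneg) auto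
  finally have "2 * (\<Sum>m\<le>Suc M. tc m) - (\<Sum>m\<le>Suc M. if m = 1 then 1 else 0) \<le> 1"
    by (simp only: sum_subtractf sum_distrib_left)
  moreover have "(\<Sum>m\<le>Suc M. if m = 1 then 1 else 0) = (1::real)" by simp
  ultimately show ?case by simp
qed simp

lemma summable_tc: "summable tc"
proof (rule summableI_nonneg_bounded[OF tc_nonneg])
  fix n show "(\<Sum>i<n. tc i) \<le> 1"
    using tc_sum_le[of n] tc_nonneg[of n] by (simp add: lessThan_Suc_atMost[symmetric])
qed

lemma double_sum_member:
  fixes g :: "nat \<Rightarrow> nat \<Rightarrow> real"
  assumes "\<And>s t. 0 \<le> g s t" "s < n" "t < n"
  shows "g s t \<le> (\<Sum>s<n. \<Sum>t<n. g s t)"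
proof -
  have "g s t \<le> (\<Sum>t<n. g s t)" using assms by (intro member_le_sum) auto
  also have "\<dots> \<le> (\<Sum>s<n. \<Sum>t<n. g s t)"
    using assms by (intro member_le_sum[of s "{..<n}" "\<lambda>s. \<Sum>t<n. g s t"]) (auto intro: sum_nonneg)
  finally show ?thesis .
qed

section \<open>Matrices over the algebra as functions of two indices\<close>

definition mm :: "nat \<Rightarrow> (nat \<Rightarrow> nat \<Rightarrow> 'a) \<Rightarrow> (nat \<Rightarrow> nat \<Rightarrow> 'a) \<Rightarrow> nat \<Rightarrow> nat \<Rightarrow> 'a::cstar_algebra" where
  "mm n x y s t = (\<Sum>u<n. x s u * y u t)"

definition one_fun :: "nat \<Rightarrow> nat \<Rightarrow> 'a::cstar_algebra" where
  "one_fun s t = (if s = t then 1 else 0)"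

primrec pw :: "nat \<Rightarrow> (nat \<Rightarrow> nat \<Rightarrow> 'a) \<Rightarrow> nat \<Rightarrow> nat \<Rightarrow> nat \<Rightarrow> 'a::cstar_algebra" where
  "pw n C 0 = one_fun"
| "pw n C (Suc m) = mm n C (pw n C m)"

lemma mm_one_left: "s < n \<Longrightarrow> mm n one_fun x s t = x s t"
  by (simp add: mm_def one_fun_def if_distrib[of "\<lambda>x. x * _"] cong: if_cong)

lemma mm_one_right: "t < n \<Longrightarrow> mm n x one_fun s t = x s t"
  by (simp add: mm_def one_fun_def if_distrib cong: if_cong)

lemma mm_assoc: "mm n (mm n x y) z = mm n x (mm n y z)"
proof (intro ext)
  fix s t
  have "mm n (mm n x y) z s t = (\<Sum>u<n. \<Sum>v<n. x s v * y v u * z u t)"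
    by (simp add: mm_def sum_distrib_right)
  also have "\<dots> = (\<Sum>v<n. \<Sum>u<n. x s v * y v u * z u t)" by (rule sum.swap)
  finally show "mm n (mm n x y) z s t = mm n x (mm n y z) s t"
    by (simp add: mm_def sum_distrib_left mult.assoc)
qed

lemma mm_cong: "(\<And>u. u < n \<Longrightarrow> x s u = x' s u) \<Longrightarrow> (\<And>u. u < n \<Longrightarrow> y u t = y' u t) \<Longrightarrow> mm n x y s t = mm n x' y' s t"
  by (simp add: mm_def)

lemma pw_add: "s < n \<Longrightarrow> mm n (pw n C i) (pw n C j) s t = pw n C (i + j) s t"
proof (induction i arbitrary: s)
  case 0
  then show ?case by (simp add: mm_one_left)
next
  case (Suc i)
  have "mm n (mm n C (pw n C i)) (pw n C j) s t = mm n C (mm n (pw n C i) (pw n C j)) s t"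
    by (simp add: mm_assoc)
  also have "\<dots> = mm n C (pw n C (i + j)) s t" by (intro mm_cong Suc.IH) auto
  finally show ?case by simp
qed

lemma pw_one: "t < n \<Longrightarrow> pw n C 1 s t = C s t"
  by (simp add: mm_one_right)

lemma pw_star:
  assumes C: "\<And>s t. s < n \<Longrightarrow> t < n \<Longrightarrow> star (C s t) = C t s"
  shows "s < n \<Longrightarrow> t < n \<Longrightarrow> star (pw n C m s t) = pw n C m t s"
proof (induction m arbitrary: s t)
  case 0
  then show ?case by (simp add: one_fun_def)
next
  case (Suc m)
  have "star (pw n C (Suc m) s t) = mm n (pw n C m) C t s"
    using Suc by (simp add: mm_def star_sum star_mult C)
  also have "\<dots> = mm n (pw n C m) (pw n C 1) t s"
    using Suc.prems by (intro mm_cong) (auto simp: mm_one_right)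
  also have "\<dots> = pw n C (Suc m) t s" using Suc.prems by (subst pw_add) auto
  finally show ?case .
qed

context uhf
begin

definition idx :: "nat \<Rightarrow> nat \<Rightarrow> (nat \<times> nat) set" where
  "idx n K = {..<n} \<times> {..<p K}"

text \<open>Flattens a matrix over the algebra to a scalar matrix; an index is a pair of a matrix
  index and an index of the infinite matrix.\<close>

definition MF :: "(nat \<Rightarrow> nat \<Rightarrow> 'a) \<Rightarrow> nat \<times> nat \<Rightarrow> nat \<times> nat \<Rightarrow> complex" where
  "MF x a b = ent (x (fst a) (fst b)) (snd a) (snd b)"

definition Opb :: "nat \<Rightarrow> real \<Rightarrow> (nat \<Rightarrow> nat \<Rightarrow> 'a) \<Rightarrow> bool" where
  "Opb n c x \<longleftrightarrow> (\<forall>K. opb (idx n K) c (MF x))"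

definition Psd :: "nat \<Rightarrow> (nat \<Rightarrow> nat \<Rightarrow> 'a) \<Rightarrow> bool" where
  "Psd n x \<longleftrightarrow> (\<forall>K. psd (idx n K) (MF x))"

lemma finite_idx [simp]: "finite (idx n K)"
  by (simp add: idx_def)

lemma idx_mono: "K \<le> L \<Longrightarrow> idx n K \<subseteq> idx n L"
  using p_mono[of K L] by (auto simp: idx_def)

lemma sum_idx: "(\<Sum>a\<in>idx n K. f a) = (\<Sum>s<n. \<Sum>i<p K. f (s, i))"
  by (simp add: idx_def sum.cartesian_product)

lemma sq_idx: "sq (idx n K) \<xi> = (\<Sum>s<n. sq (pset K) (\<lambda>i. \<xi> (s, i)))"
  by (simp add: sq_def sum_idx)

lemma app_idx: "app (idx n K) (MF x) \<xi> (s, i) = (\<Sum>t<n. app (pset K) (ent (x s t)) (\<lambda>j. \<xi> (t, j)) i)"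
  by (simp add: app_def sum_idx MF_def)

lemma ip_idx: "ip (idx n K) \<eta> \<xi> = (\<Sum>s<n. ip (pset K) (\<lambda>i. \<eta> (s, i)) (\<lambda>i. \<xi> (s, i)))"
  by (simp add: ip_def sum_idx)

lemma Psd_cong: "(\<And>s t. s < n \<Longrightarrow> t < n \<Longrightarrow> x s t = y s t) \<Longrightarrow> Psd n x \<longleftrightarrow> Psd n y"
  unfolding Psd_def by (intro all_cong1 psd_cong) (auto simp: MF_def idx_def)

lemma PsdI_large:
  assumes "\<And>K. K0 \<le> K \<Longrightarrow> psd (idx n K) (MF x)"
  shows "Psd n x"
  unfolding Psd_def
proof
  fix K
  have "psd (idx n (max K K0)) (MF x)" by (rule assms) simp
  then show "psd (idx n K) (MF x)" by (rule psd_subset) (auto intro!: idx_mono)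
qed

lemma Psd_star:
  assumes "Psd n x" "s < n" "t < n"
  shows "star (x s t) = x t s"
proof (rule ent_eqI)
  fix k i j assume "i < p k" "j < p k"
  then have "cnj (MF x (s, j) (t, i)) = MF x (t, i) (s, j)"
    using assms by (intro psd_hermitian[of "idx n k"]) (auto simp: Psd_def idx_def)
  then show "ent (star (x s t)) i j = ent (x t s) i j" by (simp add: ent_star MF_def)
qed

text \<open>Cauchy-Schwarz over the \<open>n\<close> block columns. The constant is crude but the
  same for all corners, so convergence of the entries in norm becomes convergence of the whole
  matrix.\<close>

lemma Opb_entries:
  assumes x: "\<And>s t. s < n \<Longrightarrow> t < n \<Longrightarrow> norm (x s t) \<le> d" and d: "0 \<le> d"
  shows "Opb n (real n * d) x"
  unfolding Opb_def opb_def
proof (intro allI)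
  fix K and \<xi> :: "nat \<times> nat \<Rightarrow> complex"
  let ?F = "pset K"
  let ?v = "\<lambda>t j. \<xi> (t, j)"
  have "sq ?F (\<lambda>i. app (idx n K) (MF x) \<xi> (s, i)) \<le> n * (d\<^sup>2 * sq (idx n K) \<xi>)" if "s < n" for s
  proof -
    have "sq ?F (\<lambda>i. app (idx n K) (MF x) \<xi> (s, i))
        = (\<Sum>i<p K. (cmod (\<Sum>t<n. app ?F (ent (x s t)) (?v t) i))\<^sup>2)"
      by (simp add: sq_def app_idx)
    also have "\<dots> \<le> (\<Sum>i<p K. n * (\<Sum>t<n. (cmod (app ?F (ent (x s t)) (?v t) i))\<^sup>2))"
      using cmod_sum_sq_le[of _ "{..<n}"] by (intro sum_mono) simp
    also have "\<dots> = n * (\<Sum>t<n. sq ?F (app ?F (ent (x s t)) (?v t)))"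
      unfolding sq_def sum_distrib_left by (rule sum.swap)
    also have "\<dots> \<le> n * (\<Sum>t<n. d\<^sup>2 * sq ?F (?v t))"
    proof (intro mult_left_mono sum_mono)
      fix t assume "t \<in> {..<n}"
      then have "norm (x s t) \<le> d" using x[OF that] by simp
      then have "opb ?F d (ent (x s t))" by (rule opb_weaken[OF opb_ent norm_ge_zero])
      then show "sq ?F (app ?F (ent (x s t)) (?v t)) \<le> d\<^sup>2 * sq ?F (?v t)" by (simp add: opb_def)
    qed auto
    finally show ?thesis by (simp add: sq_idx sum_distrib_left)
  qed
  then have "sq (idx n K) (app (idx n K) (MF x) \<xi>) \<le> (\<Sum>s<n. n * (d\<^sup>2 * sq (idx n K) \<xi>))"
    unfolding sq_idx[of n K "app _ _ _"] by (intro sum_mono) auto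
  then show "sq (idx n K) (app (idx n K) (MF x) \<xi>) \<le> (real n * d)\<^sup>2 * sq (idx n K) \<xi>"
    by (simp add: power_mult_distrib power2_eq_square mult_ac)
qed

text \<open>Vectors supported in the single block column \<open>t\<close> isolate one entry.\<close>

lemma Opb_norm_le:
  assumes "Opb n c x" "0 \<le> c" "s < n" "t < n"
  shows "norm (x s t) \<le> c"
proof (rule norm_le_opb)
  fix K
  show "opb (pset K) c (ent (x s t))"
    unfolding opb_def
  proof
    fix \<xi> :: "nat \<Rightarrow> complex"
    define v where "v a = (if fst a = t then \<xi> (snd a) else 0)" for a :: "nat \<times> nat"
    have sqv: "sq (idx n K) v = sq (pset K) \<xi>"
    proof -
      have "sq (pset K) (\<lambda>i. v (s', i)) = (if s' = t then sq (pset K) \<xi> else 0)" for s'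
        by (simp add: v_def sq_def)
      then show ?thesis unfolding sq_idx using assms(4) by simp
    qed
    have appv: "app (idx n K) (MF x) v (s, i) = app (pset K) (ent (x s t)) \<xi> i" for i
    proof -
      have "app (pset K) (ent (x s t')) (\<lambda>j. v (t', j)) i =
          (if t' = t then app (pset K) (ent (x s t)) \<xi> i else 0)" for t'
        by (simp add: v_def app_def)
      then show ?thesis unfolding app_idx using assms(4) by simp
    qed
    have "sq (pset K) (app (pset K) (ent (x s t)) \<xi>) = sq (pset K) (\<lambda>i. app (idx n K) (MF x) v (s, i))"
      by (simp add: appv)
    also have "\<dots> \<le> sq (idx n K) (app (idx n K) (MF x) v)"
      unfolding sq_idx using assms(3) by (intro member_le_sum) auto
    also have "\<dots> \<le> c\<^sup>2 * sq (idx n K) v" using assms(1) by (auto simp: Opb_def opb_def)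
    finally show "sq (pset K) (app (pset K) (ent (x s t)) \<xi>) \<le> c\<^sup>2 * sq (pset K) \<xi>"
      by (simp add: sqv)
  qed
qed (use assms in simp)

lemma approx_family:
  assumes "finite A" "0 < e"
  shows "\<exists>L\<ge>K0. \<exists>f. \<forall>a\<in>A. norm (x a - el L (f a)) < e"
  using assms(1)
proof (induction A rule: finite_induct)
  case (insert b A)
  then obtain L f where L: "K0 \<le> L" "\<forall>a\<in>A. norm (x a - el L (f a)) < e" by blast
  obtain M c where M: "L \<le> M" "norm (x b - el M c) < e" using dense[of L "x b", rule_format, OF assms(2)] by blast
  have "\<forall>a\<in>insert b A. norm (x a - el M (if a = b then c else blk (p L) (f a))) < e"
    using L(2) M insert.hyps el_up[OF M(1)] by auto
  then show ?case using L(1) M(1) by (intro exI[of _ M] conjI exI[of _ "\<lambda>a. if a = b then c else blk (p L) (f a)"]) auto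
qed auto

lemma approx_family_seq:
  assumes "finite A"
  shows "\<exists>L f. (\<forall>m. K0 + m \<le> L m) \<and> (\<forall>a\<in>A. (\<lambda>m. el (L m) (f m a)) \<longlonglongrightarrow> x a)"
proof -
  have "\<exists>L f. K0 + m \<le> L \<and> (\<forall>a\<in>A. norm (x a - el L (f a)) < inverse (real (Suc m)))" for m
    using approx_family[OF assms, of "inverse (real (Suc m))" "K0 + m" x] by auto
  then obtain L f where K: "\<And>m. K0 + m \<le> L m"
    "\<And>m. \<forall>a\<in>A. norm (x a - el (L m) (f m a)) < inverse (real (Suc m))"
    by metis
  have "(\<lambda>m. el (L m) (f m a)) \<longlonglongrightarrow> x a" if "a \<in> A" for a
  proof -
    have "(\<lambda>m. el (L m) (f m a) - x a) \<longlonglongrightarrow> 0"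
      by (rule Lim_null_comparison[OF _ LIMSEQ_inverse_real_of_nat])
        (use K(2) that in \<open>auto simp: norm_minus_commute intro!: always_eventually less_imp_le\<close>)
    then show ?thesis using LIM_zero_iff by blast
  qed
  then show ?thesis using K(1) by blast
qed

lemma approx_mat:
  fixes n :: nat
  shows "\<exists>L f. (\<forall>m. K0 + m \<le> L m) \<and> (\<forall>s<n. \<forall>t<n. (\<lambda>m. el (L m) (f m s t)) \<longlonglongrightarrow> x s t)"
proof -
  have "finite ({..<n::nat} \<times> {..<n::nat})" by simp
  from approx_family_seq[OF this, of K0 "\<lambda>(s, t). x s t"]
  obtain L f where "\<forall>m. K0 + m \<le> L m"
    "\<forall>a\<in>{..<n} \<times> {..<n}. (\<lambda>m. el (L m) (f m a)) \<longlonglongrightarrow> (case a of (s, t) \<Rightarrow> x s t)" by blast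
  then show ?thesis by (intro exI[of _ L] exI[of _ "\<lambda>m s t. f m (s, t)"]) auto
qed

text \<open>Cutting to a corner is multiplicative for elements of that level, whose infinite
  matrices are block diagonal there, but not in general. Products of general elements are reached by
  approximation.\<close>

lemma MF_mm:
  assumes "\<And>s t. s < n \<Longrightarrow> t < n \<Longrightarrow> x s t \<in> range (el L)"
    and "\<And>s t. s < n \<Longrightarrow> t < n \<Longrightarrow> y s t \<in> range (el L)"
    and "a \<in> idx n L" "b \<in> idx n L"
  shows "MF (mm n x y) a b = (\<Sum>l\<in>idx n L. MF x a l * MF y l b)"
proof -
  have "MF (mm n x y) a b = (\<Sum>u<n. ent (x (fst a) u * y u (fst b)) (snd a) (snd b))"
    by (simp add: MF_def mm_def ent_sum)
  also have "\<dots> = (\<Sum>u<n. \<Sum>l<p L. ent (x (fst a) u) (snd a) l * ent (y u (fst b)) l (snd b))"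
    using assms by (intro sum.cong refl ent_mult_level) (auto simp: idx_def)
  finally show ?thesis by (simp add: sum_idx MF_def)
qed

lemma MF_tendsto: 
  "((\<lambda>m. x m (fst a) (fst b)) \<longlongrightarrow> y (fst a) (fst b)) G \<Longrightarrow> ((\<lambda>m. MF (x m) a b) \<longlongrightarrow> MF y a b) G"
  unfolding MF_def by (rule ent_tendsto)

lemma mm_tendsto:
  assumes "\<And>u. u < n \<Longrightarrow> ((\<lambda>m. x m s u) \<longlongrightarrow> x' s u) G" "\<And>u. u < n \<Longrightarrow> ((\<lambda>m. y m u t) \<longlongrightarrow> y' u t) G"
  shows "((\<lambda>m. mm n (x m) (y m) s t) \<longlongrightarrow> mm n x' y' s t) G"
  unfolding mm_def by (intro tendsto_sum tendsto_mult) (auto intro: assms)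

lemma Opb_perturb:
  assumes "Opb n c x" "0 \<le> c" "\<And>s t. s < n \<Longrightarrow> t < n \<Longrightarrow> norm (y s t - x s t) \<le> d" "0 \<le> d"
  shows "Opb n (c + real n * d) y"
  unfolding Opb_def
proof
  fix K
  have "opb (idx n K) (real n * d) (MF (\<lambda>s t. y s t - x s t))"
    using Opb_entries[of n "\<lambda>s t. y s t - x s t" d] assms by (simp add: Opb_def)
  then have "opb (idx n K) (c + real n * d) (\<lambda>a b. MF x a b + MF (\<lambda>s t. y s t - x s t) a b)"
    using assms by (intro opb_add) (auto simp: Opb_def)
  then show "opb (idx n K) (c + real n * d) (MF y)" by (simp add: MF_def[abs_def] flip: ent_add)
qed

lemma Opb_mult:
  assumes x: "Opb n c x" and y: "Opb n d y" and cd: "0 \<le> c" "0 \<le> d"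
  shows "Opb n (c * d) (mm n x y)"
  unfolding Opb_def
proof
  fix K
  \<comment> \<open>Stacking \<open>x\<close> on top of \<open>y\<close> makes one application of
    \<open>approx_mat\<close> approximate both at common levels.\<close>
  define z where "z s t = (if s < n then x s t else y (s - n) t)" for s t
  obtain L f where L: "\<forall>m. K + m \<le> L m" and f: "\<forall>s<2*n. \<forall>t<2*n. (\<lambda>m. el (L m) (f m s t)) \<longlonglongrightarrow> z s t"
    using approx_mat[of K "2*n" z] by blast
  define X where "X m s t = el (L m) (f m s t)" for m s t
  define Y where "Y m s t = el (L m) (f m (s + n) t)" for m s t
  have X: "(\<lambda>m. X m s t) \<longlonglongrightarrow> x s t" if "s < n" "t < n" for s t
    using f[rule_format, of s t] that by (simp add: X_def z_def)
  have Y: "(\<lambda>m. Y m s t) \<longlonglongrightarrow> y s t" if "s < n" "t < n" for s t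
    using f[rule_format, of "s + n" t] that by (simp add: Y_def z_def)
  define e where "e m = (\<Sum>s<n. \<Sum>t<n. norm (X m s t - x s t) + norm (Y m s t - y s t))" for m
  have "(\<lambda>m. norm (X m s t - x s t) + norm (Y m s t - y s t)) \<longlonglongrightarrow> norm (x s t - x s t) + norm (y s t - y s t)"
    if "s < n" "t < n" for s t
    using that by (intro tendsto_add tendsto_norm tendsto_diff X Y tendsto_const)
  then have "e \<longlonglongrightarrow> (\<Sum>s<n. \<Sum>t<n. norm (x s t - x s t) + norm (y s t - y s t))"
    unfolding e_def by (intro tendsto_sum) auto
  then have e0: "e \<longlonglongrightarrow> 0" by simp
  have le: "norm (X m s t - x s t) + norm (Y m s t - y s t) \<le> e m" if "s < n" "t < n" for m s t
    unfolding e_def using that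
    by (intro double_sum_member[of "\<lambda>s t. norm (X m s t - x s t) + norm (Y m s t - y s t)"]) auto
  have e_nonneg: "0 \<le> e m" for m by (simp add: e_def sum_nonneg)
  show "opb (idx n K) (c * d) (MF (mm n x y))"
  proof (rule opb_limit)
    fix a b assume "a \<in> idx n K" "b \<in> idx n K"
    then show "(\<lambda>m. MF (mm n (X m) (Y m)) a b) \<longlonglongrightarrow> MF (mm n x y) a b"
      by (intro MF_tendsto mm_tendsto X Y) (auto simp: idx_def)
  next
    have "(\<lambda>m. (c + real n * e m) * (d + real n * e m)) \<longlonglongrightarrow> (c + real n * 0) * (d + real n * 0)"
      by (intro tendsto_intros e0)
    then show "(\<lambda>m. (c + real n * e m) * (d + real n * e m)) \<longlonglongrightarrow> c * d" by simp
  next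
    fix m
    have lX: "norm (X m s t - x s t) \<le> e m" "norm (Y m s t - y s t) \<le> e m" if "s < n" "t < n" for s t
      using le[OF that, of m] norm_ge_zero[of "X m s t - x s t"] norm_ge_zero[of "Y m s t - y s t"] by linarith+
    have "Opb n (c + real n * e m) (X m)" "Opb n (d + real n * e m) (Y m)"
      by (rule Opb_perturb[OF x cd(1) lX(1) e_nonneg]; assumption)
        (rule Opb_perturb[OF y cd(2) lX(2) e_nonneg]; assumption)
    then have "opb (idx n (L m)) ((c + real n * e m) * (d + real n * e m))
       (\<lambda>a b. \<Sum>l\<in>idx n (L m). MF (X m) a l * MF (Y m) l b)"
      by (intro opb_mult) (auto simp: Opb_def)
    then have "opb (idx n (L m)) ((c + real n * e m) * (d + real n * e m)) (MF (mm n (X m) (Y m)))"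
      by (subst opb_cong[OF MF_mm]) (auto simp: X_def Y_def)
    moreover have "K \<le> L m" using L by (meson add_leE)
    ultimately show "opb (idx n K) ((c + real n * e m) * (d + real n * e m)) (MF (mm n (X m) (Y m)))"
      by (rule_tac opb_subset) (auto intro!: idx_mono)
  qed
qed

text \<open>At a finite level the form is |Y \<xi>|^2; entrywise limits preserve positivity of every
  corner.\<close>

lemma Psd_star_mult: "Psd n (mm n (\<lambda>s t. star (y t s)) y)"
  unfolding Psd_def
proof
  fix K
  obtain L f where L: "\<forall>m. K + m \<le> L m" and f: "\<forall>s<n. \<forall>t<n. (\<lambda>m. el (L m) (f m s t)) \<longlonglongrightarrow> y s t"
    using approx_mat[of K n y] by blast
  define Y where "Y m s t = el (L m) (f m s t)" for m s t
  have Y: "(\<lambda>m. Y m s t) \<longlonglongrightarrow> y s t" if "s < n" "t < n" for s t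
    using f that by (simp add: Y_def)
  show "psd (idx n K) (MF (mm n (\<lambda>s t. star (y t s)) y))"
  proof (rule psd_limit)
    fix a b assume "a \<in> idx n K" "b \<in> idx n K"
    then show "(\<lambda>m. MF (mm n (\<lambda>s t. star (Y m t s)) (Y m)) a b) \<longlonglongrightarrow> MF (mm n (\<lambda>s t. star (y t s)) y) a b"
      by (intro MF_tendsto mm_tendsto Y bounded_linear.tendsto[OF bounded_linear_star]) (auto simp: idx_def)
  next
    fix m
    let ?F = "idx n (L m)"
    let ?M = "\<lambda>a b. \<Sum>l\<in>?F. cnj (MF (Y m) l a) * MF (Y m) l b"
    have "psd ?F ?M"
      unfolding psd_def
    proof (intro conjI ballI allI)
      fix a b show "?M b a = cnj (?M a b)" by (simp add: mult.commute)
    next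
      fix \<xi>
      have "ip ?F \<xi> (app ?F ?M \<xi>) = ip ?F (app ?F (MF (Y m)) \<xi>) (app ?F (MF (Y m)) \<xi>)"
        unfolding app_comp[symmetric] by (subst ip_adj) simp
      then show "0 \<le> Re (ip ?F \<xi> (app ?F ?M \<xi>))" by simp
    qed
    moreover have "MF (mm n (\<lambda>s t. star (Y m t s)) (Y m)) a b = ?M a b" if "a \<in> ?F" "b \<in> ?F" for a b
    proof -
      have "Y m s t \<in> range (el (L m))" "star (Y m s t) \<in> range (el (L m))" for s t
        by (auto simp: Y_def el_star)
      then have "MF (mm n (\<lambda>s t. star (Y m t s)) (Y m)) a b =
          (\<Sum>l\<in>?F. MF (\<lambda>s t. star (Y m t s)) a l * MF (Y m) l b)"
        using that by (intro MF_mm) auto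
      then show ?thesis by (simp add: MF_def ent_star)
    qed
    ultimately have "psd ?F (MF (mm n (\<lambda>s t. star (Y m t s)) (Y m)))"
      using psd_cong[of ?F "MF (mm n (\<lambda>s t. star (Y m t s)) (Y m))" ?M] by blast
    moreover have "K \<le> L m" using L by (meson add_leE)
    ultimately show "psd (idx n K) (MF (mm n (\<lambda>s t. star (Y m t s)) (Y m)))"
      by (rule_tac psd_subset) (auto intro!: idx_mono)
  qed
qed

lemma Opb_one: "Opb n 1 one_fun"
proof -
  have "app (idx n K) (MF one_fun) \<xi> a = \<xi> a" if "a \<in> idx n K" for K \<xi> a
  proof -
    have "MF one_fun a b = (if b = a then 1 else 0)" for b
      by (auto simp: MF_def one_fun_def ent_one prod_eq_iff)
    then show ?thesis using that by (simp add: app_def if_distrib[of "\<lambda>x. x * _"] cong: if_cong)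
  qed
  then have "sq (idx n K) (app (idx n K) (MF one_fun) \<xi>) = sq (idx n K) \<xi>" for K \<xi> by (intro sq_cong) auto
  then show ?thesis by (simp add: Opb_def opb_def)
qed

text \<open>
  Square roots: after scaling, \<open>C = 1 - x\<close> is a contraction, and \<open>T = (\<Sum>m. tc m *\<^sub>R C\<^sup>m)\<close>
  satisfies \<open>T\<^sup>2 = 2 T - C\<close>, that is, \<open>(1 - T)\<^sup>2 = x\<close>.
\<close>

lemma Psd_sqrt:
  assumes x: "Psd n x"
  shows "\<exists>y. \<forall>s<n. \<forall>t<n. x s t = mm n (\<lambda>s t. star (y t s)) y s t"
proof -
  define b where "b = (\<Sum>s<n. \<Sum>t<n. norm (x s t))"
  \<comment> \<open>The added 1 keeps \<open>c\<close> positive also when \<open>n\<close> or all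
    entries are 0, so that dividing by it is possible.\<close>
  define c where "c = real n * b + 1"
  have b0: "0 \<le> b" by (simp add: b_def sum_nonneg)
  then have c0: "0 < c" unfolding c_def by (simp add: add_nonneg_pos)
  have "norm (x s t) \<le> b" if "s < n" "t < n" for s t
    unfolding b_def using that by (intro double_sum_member[of "\<lambda>s t. norm (x s t)"]) auto
  then have "Opb n (real n * b) x" using b0 by (intro Opb_entries) auto
  then have xc: "opb (idx n K) c (MF x)" for K
    using b0 by (auto simp: Opb_def c_def intro: opb_weaken[of _ "real n * b"])
  define C where "C s t = one_fun s t - scaleR (1 / c) (x s t)" for s t
  have "Opb n 1 C"
    unfolding Opb_def
  proof
    fix K
    have MFC: "MF C a b = (if a = b then 1 else 0) - MF x a b / of_real c" for a b
      by (auto simp: MF_def C_def ent_diff ent_scaleR one_fun_def ent_one prod_eq_iff)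
    show "opb (idx n K) 1 (MF C)"
      unfolding MFC[abs_def] using x xc c0 by (intro psd_opb_one_minus) (auto simp: Psd_def)
  qed
  then have pw_le: "Opb n 1 (pw n C m)" for m
    by (induction m) (auto intro: Opb_one dest: Opb_mult[of n 1 C 1])
  have C_star: "star (C s t) = C t s" if "s < n" "t < n" for s t
    using Psd_star[OF x that] by (simp add: C_def star_diff star_scaleR one_fun_def)
  have norm_pw: "norm (pw n C m s t) \<le> 1" if "s < n" "t < n" for m s t
    using Opb_norm_le[OF pw_le _ that] by simp
  define a where "a s t m = scaleR (tc m) (pw n C m s t)" for s t m
  have sa: "summable (\<lambda>m. norm (a s t m))" if "s < n" "t < n" for s t
    by (rule summable_comparison_test'[OF summable_tc, of 0])
      (use norm_pw[OF that] tc_nonneg in \<open>auto simp: a_def intro: mult_left_le\<close>)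
  define T where "T s t = (\<Sum>m. a s t m)" for s t
  have T_sums: "a s t sums T s t" if "s < n" "t < n" for s t
    unfolding T_def using summable_norm_cancel[OF sa[OF that]] by (rule summable_sums)
  have TT: "mm n T T s t = 2 * T s t - C s t" if st: "s < n" "t < n" for s t
  proof -
    \<comment> \<open>The coefficient of degree \<open>m\<close> in the Cauchy product. Powers of
      \<open>C\<close> multiply by adding exponents, so \<open>tc_convolution\<close> applies, and
      its correction term at \<open>m = 1\<close> contributes exactly \<open>C\<close>.\<close>
    have conv: "(\<Sum>u<n. \<Sum>i\<le>m. a s u i * a u t (m - i)) =
        2 * a s t m - (if m = 1 then C s t else 0)" for m
    proof -
      have "(\<Sum>u<n. \<Sum>i\<le>m. a s u i * a u t (m - i)) =
          (\<Sum>i\<le>m. \<Sum>u<n. scaleR (tc i * tc (m - i)) (pw n C i s u * pw n C (m - i) u t))"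
        unfolding a_def by (subst sum.swap) (simp add: mult.commute)
      also have "\<dots> = (\<Sum>i\<le>m. scaleR (tc i * tc (m - i)) (mm n (pw n C i) (pw n C (m - i)) s t))"
        by (simp add: mm_def scaleR_sum_right)
      also have "\<dots> = (\<Sum>i\<le>m. scaleR (tc i * tc (m - i)) (pw n C m s t))"
        using st by (intro sum.cong) (auto simp: pw_add)
      also have "\<dots> = scaleR (2 * tc m - (if m = 1 then 1 else 0)) (pw n C m s t)"
        unfolding scaleR_sum_left[symmetric] tc_convolution ..
      also have "\<dots> = 2 * a s t m - (if m = 1 then C s t else 0)"
      proof -
        have gen1: "scaleR (2 * r - d) P = 2 * scaleR r P - scaleR d P" for r d and P :: 'a
          by (simp only: scaleR_left_diff_distrib mult_2 scaleR_left_distrib)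
        have gen: "scaleR (2 * r - (if m = 1 then 1 else 0)) P = 2 * scaleR r P - (if m = 1 then P else 0)"
          for r and P :: 'a unfolding gen1 by simp
        have "(if m = 1 then pw n C m s t else 0) = (if m = 1 then C s t else 0)"
          using pw_one[OF st(2), of C s] by (intro if_cong refl) metis
        then show ?thesis unfolding gen a_def by (rule arg_cong)
      qed
      finally show ?thesis .
    qed
    have "(\<lambda>m. \<Sum>i\<le>m. a s u i * a u t (m - i)) sums (T s u * T u t)" if "u < n" for u
      unfolding T_def using that st by (intro Cauchy_product_sums sa)
    then have "(\<lambda>m. \<Sum>u<n. \<Sum>i\<le>m. a s u i * a u t (m - i)) sums (\<Sum>u<n. T s u * T u t)"
      by (intro sums_sum) auto
    then have "(\<lambda>m. 2 * a s t m - (if m = 1 then C s t else 0)) sums mm n T T s t"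
      by (simp only: conv mm_def)
    moreover have "(\<lambda>m. 2 * a s t m - (if m = 1 then C s t else 0)) sums (2 * T s t - C s t)"
      by (intro sums_diff sums_mult T_sums st sums_single)
    ultimately show ?thesis using sums_unique2 by blast
  qed
  have T_star: "star (T s t) = T t s" if "s < n" "t < n" for s t
  proof -
    have "(\<lambda>m. star (a s t m)) sums star (T s t)"
      using T_sums[OF that] by (rule bounded_linear.sums[OF bounded_linear_star])
    moreover have "(\<lambda>m. star (a s t m)) = a t s"
      using that C_star by (simp add: fun_eq_iff a_def star_scaleR pw_star)
    ultimately show ?thesis using T_sums[OF that(2,1)] sums_unique2 by metis
  qed
  define y where "y s t = scaleR (sqrt c) (one_fun s t - T s t)" for s t
  have "x s t = mm n (\<lambda>s t. star (y t s)) y s t" if st: "s < n" "t < n" for s t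
  proof -
    have "mm n (\<lambda>s t. star (y t s)) y s t = mm n y y s t"
      using st by (intro mm_cong) (auto simp: y_def star_scaleR star_diff T_star one_fun_def)
    also have "\<dots> = scaleR c (\<Sum>u<n. (one_fun s u - T s u) * (one_fun u t - T u t))"
      using c0 by (simp add: mm_def y_def scaleR_sum_right)
    also have "(\<Sum>u<n. (one_fun s u - T s u) * (one_fun u t - T u t)) =
        mm n one_fun one_fun s t - mm n one_fun T s t - mm n T one_fun s t + mm n T T s t"
      by (simp add: mm_def algebra_simps sum.distrib sum_subtractf)
    also have "\<dots> = one_fun s t - C s t"
      using st by (simp add: mm_one_left mm_one_right TT mult_2)
    also have "scaleR c \<dots> = x s t" using c0 by (simp add: C_def)
    finally show ?thesis by simp
  qed
  then show ?thesis by blast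
qed

text \<open>The bridge from factorisations to quadratic forms: \<open>Psd_star_mult\<close> in one
  direction, the square root in the other. It makes positivity testable on finite corners and stable
  under limits.\<close>

lemma mat_positive_iff:
  "mat_positive n X \<longleftrightarrow> X \<in> carrier_mat n n \<and> Psd n (\<lambda>s t. X $$ (s, t))"
proof -
  have eq: "(mat_star Y * Y) $$ (s, t) = mm n (\<lambda>s t. star (Y $$ (t, s))) (\<lambda>s t. Y $$ (s, t)) s t"
    if "Y \<in> carrier_mat n n" "s < n" "t < n" for Y :: "'a mat" and s t
    using that by (auto simp: mat_star_def scalar_prod_def mm_def atLeast0LessThan)
  show ?thesis
  proof safe
    assume "mat_positive n X"
    then obtain Y where Y: "Y \<in> carrier_mat n n" "X = mat_star Y * Y" by (auto simp: mat_positive_def)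
    then show "X \<in> carrier_mat n n" by (auto simp: mat_star_def)
    have "Psd n (mm n (\<lambda>s t. star (Y $$ (t, s))) (\<lambda>s t. Y $$ (s, t)))" by (rule Psd_star_mult)
    then show "Psd n (\<lambda>s t. X $$ (s, t))" unfolding Y(2) by (subst Psd_cong[OF eq[OF Y(1)]])
  next
    assume X: "X \<in> carrier_mat n n" "Psd n (\<lambda>s t. X $$ (s, t))"
    then obtain y where y: "\<forall>s<n. \<forall>t<n. X $$ (s, t) = mm n (\<lambda>s t. star (y t s)) y s t"
      using Psd_sqrt by blast
    define Y where "Y = mat n n (\<lambda>(s, t). y s t)"
    have Yc: "Y \<in> carrier_mat n n" by (simp add: Y_def)
    have "X = mat_star Y * Y"
    proof (rule eq_matI)
      fix s t assume "s < dim_row (mat_star Y * Y)" "t < dim_col (mat_star Y * Y)"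
      then have st: "s < n" "t < n" by (auto simp: mat_star_def Y_def)
      have "X $$ (s, t) = mm n (\<lambda>s t. star (y t s)) y s t" using y st by blast
      also have "\<dots> = mm n (\<lambda>s t. star (Y $$ (t, s))) (\<lambda>s t. Y $$ (s, t)) s t"
        using st by (intro mm_cong) (auto simp: Y_def)
      finally show "X $$ (s, t) = (mat_star Y * Y) $$ (s, t)" by (simp only: eq[OF Yc st])
    qed (use X in \<open>auto simp: mat_star_def Y_def\<close>)
    then show "mat_positive n X" using Yc by (auto simp: mat_positive_def)
  qed
qed

end

section \<open>The diagonal and its bimodules\<close>

definition m2 :: "'a \<Rightarrow> 'a \<Rightarrow> 'a \<Rightarrow> 'a \<Rightarrow> nat \<Rightarrow> nat \<Rightarrow> 'a" where
  "m2 a b c d s t = (if s = 0 then if t = 0 then a else b else if t = 0 then c else d)"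

lemma lessThan_2: "{..<2} = {0, 1::nat}"
  by auto

context uhf
begin

text \<open>A diagonal matrix has blocks of size one.\<close>

lemma norm_dg_le:
  assumes "\<And>i. i < p k \<Longrightarrow> cmod (d i) \<le> M" "0 \<le> M"
  shows "norm (dg k d) \<le> M"
proof -
  have "opb (pset k) (real 1 * M) (\<lambda>i j. if i = j then d i else 0)"
  proof (rule opb_small_blocks[where \<kappa> = "\<lambda>i. i"])
    show "card {a \<in> pset k. a = j} \<le> 1" for j
      by (rule card_le_Suc0_iff_eq[THEN iffD2, simplified One_nat_def[symmetric]]) auto
  qed (use assms in auto)
  then show ?thesis unfolding dg_def using assms(2) by (intro norm_el_le) auto
qed

text \<open>A diagonal factor involves no sum over an intermediate index. The formula therefore
  survives limits and holds on the whole algebra, unlike \<open>ent_mult_level\<close>.\<close>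

lemma ent_dg_mult: "ent (dg k d * x) i j = d (i mod p k) * ent x i j"
proof -
  obtain L c where *: "\<forall>m. k + m \<le> L m" "(\<lambda>m. el (L m) (c m)) \<longlonglongrightarrow> x"
    using approx_seq[of k x] by blast
  have "ent (dg k d * el (L m) (c m)) i j = d (i mod p k) * ent (el (L m) (c m)) i j" for m
  proof -
    have kL: "k \<le> L m" using *(1) by (meson add_leE)
    have "i mod p (L m) mod p k = i mod p k" using p_dvd[OF kL] by (rule mod_mod_cancel)
    then show ?thesis by (simp add: dg_up[OF kL, of d] dg_el ent_blk blk_def)
  qed
  then have "(\<lambda>m. d (i mod p k) * ent (el (L m) (c m)) i j) \<longlonglongrightarrow> ent (dg k d * x) i j"
    using ent_tendsto[OF tendsto_mult_left[OF *(2), of "dg k d"], of i j] by simp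
  moreover have "(\<lambda>m. d (i mod p k) * ent (el (L m) (c m)) i j) \<longlonglongrightarrow> d (i mod p k) * ent x i j"
    by (intro tendsto_mult_left ent_tendsto *)
  ultimately show ?thesis by (rule LIMSEQ_unique)
qed

lemma ent_mult_dg: "ent (x * dg k d) i j = ent x i j * d (j mod p k)"
proof -
  have "ent (x * dg k d) i j = cnj (ent (star (x * dg k d)) j i)" by (simp add: ent_star)
  also have "star (x * dg k d) = dg k (\<lambda>i. cnj (d i)) * star x" by (simp add: star_mult dg_star)
  finally show ?thesis by (simp add: ent_dg_mult ent_star)
qed

definition DA :: "'a set" where "DA = (\<Union>k. range (dg k))"

lemma masa_eq: "uhf_masa p h = closure DA"
  by (simp add: uhf_masa_def diag_eq DA_def)

lemma DA_masa: "DA \<subseteq> uhf_masa p h"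
  by (simp add: masa_eq closure_subset)

lemma dg_DA [intro]: "dg k d \<in> DA"
  by (auto simp: DA_def)

lemma E_DA [intro]: "E k i i \<in> DA"
  by (simp add: E_diag dg_DA)

lemma one_DA [intro]: "1 \<in> DA"
  using dg_DA[of 0 "\<lambda>i. 1"] by (simp add: dg_one)

lemma DA_common:
  assumes "x \<in> DA" "y \<in> DA"
  shows "\<exists>K c d. x = dg K c \<and> y = dg K d"
proof -
  obtain k c k' d where *: "x = dg k c" "y = dg k' d" using assms by (auto simp: DA_def)
  have "x = dg (max k k') (\<lambda>i. c (i mod p k))" "y = dg (max k k') (\<lambda>i. d (i mod p k'))"
    unfolding * by (rule dg_up; simp)+
  then show ?thesis by blast
qed

lemma DA_mult: "x \<in> DA \<Longrightarrow> y \<in> DA \<Longrightarrow> x * y \<in> DA"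
  using DA_common[of x y] by (auto simp: dg_mult)

lemma DA_add: "x \<in> DA \<Longrightarrow> y \<in> DA \<Longrightarrow> x + y \<in> DA"
  using DA_common[of x y] by (auto simp: dg_add)

lemma DA_diff: "x \<in> DA \<Longrightarrow> y \<in> DA \<Longrightarrow> x - y \<in> DA"
  using DA_common[of x y] by (auto simp: dg_diff)

lemma DA_commute: "x \<in> DA \<Longrightarrow> y \<in> DA \<Longrightarrow> x * y = y * x"
  using DA_common[of x y] by (auto simp: dg_mult mult.commute)

lemma DA_scale: "x \<in> DA \<Longrightarrow> scaleC z x \<in> DA"
proof -
  assume "x \<in> DA"
  then obtain k d where "x = dg k d" by (auto simp: DA_def)
  then show ?thesis by (simp add: dg_scale dg_DA)
qed

lemma DA_zero [intro]: "0 \<in> DA"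
  using dg_DA[of 0 "\<lambda>i. 0"] by (simp add: dg_zero)

lemma DA_sum: "(\<And>a. a \<in> A \<Longrightarrow> f a \<in> DA) \<Longrightarrow> (\<Sum>a\<in>A. f a) \<in> DA"
  by (induction A rule: infinite_finite_induct) (auto intro: DA_add)

lemma masa_ent:
  assumes "x \<in> uhf_masa p h" "i \<noteq> j"
  shows "ent x i j = 0"
proof -
  obtain f where f: "\<And>m. f m \<in> DA" "f \<longlonglongrightarrow> x"
    using assms(1) unfolding masa_eq closure_sequential by blast
  have "ent (f m) i j = 0" for m using f(1)[of m] assms(2) by (auto simp: DA_def ent_dg)
  then show ?thesis using ent_tendsto[OF f(2), of i j] by (simp add: LIMSEQ_const_iff)
qed

lemma masa_mult_ent:
  assumes "x \<in> uhf_masa p h"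
  shows "ent (x * y) i j = ent x i i * ent y i j"
proof -
  obtain f where f: "\<And>m. f m \<in> DA" "f \<longlonglongrightarrow> x"
    using assms(1) unfolding masa_eq closure_sequential by blast
  have "ent (f m * y) i j = ent (f m) i i * ent y i j" for m
    using f(1)[of m] by (auto simp: DA_def ent_dg ent_dg_mult)
  then have "(\<lambda>m. ent (f m) i i * ent y i j) \<longlonglongrightarrow> ent (x * y) i j"
    using ent_tendsto[OF tendsto_mult_right[OF f(2), of y], of i j] by simp
  moreover have "(\<lambda>m. ent (f m) i i * ent y i j) \<longlonglongrightarrow> ent x i i * ent y i j"
    by (intro tendsto_mult_right ent_tendsto f)
  ultimately show ?thesis by (rule LIMSEQ_unique)
qed

text \<open>A diagonal with entries 0 and 1 is recovered by rounding from any diagonal at distance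
  below 1/2, and rounding stays in the finite level of the approximant.\<close>

lemma masa_projection_DA:
  assumes x: "x \<in> uhf_masa p h" and proj: "\<And>k i. i < p k \<Longrightarrow> ent x i i = 0 \<or> ent x i i = 1"
  shows "x \<in> DA"
proof -
  obtain y where y: "y \<in> DA" "dist y x < 1 / 2"
    using x[unfolded masa_eq closure_approachable, rule_format, of "1 / 2"] by auto
  obtain k d where kd: "y = dg k d" using y(1) by (auto simp: DA_def)
  have "x = dg k (\<lambda>i. if cmod (d i) \<le> 1 / 2 then 0 else 1)"
  proof (rule ent_eqI)
    fix K i j assume ij: "i < p K" "j < p K"
    show "ent x i j = ent (dg k (\<lambda>i. if cmod (d i) \<le> 1 / 2 then 0 else 1)) i j"
    proof (cases "i = j")
      case True
      have "cmod (ent (y - x) i i) \<le> norm (y - x)" using ij by (intro ent_le) auto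
      then have le: "cmod (d (i mod p k) - ent x i i) < 1 / 2"
        using y(2) by (simp add: ent_diff kd ent_dg dist_norm)
      consider "ent x i i = 0" | "ent x i i = 1" using proj ij by blast
      then show ?thesis
      proof cases
        case 1
        then show ?thesis using le True by (simp add: ent_dg)
      next
        case 2
        have "1 \<le> cmod (d (i mod p k)) + cmod (d (i mod p k) - 1)"
          using norm_triangle_ineq4[of "d (i mod p k)" "d (i mod p k) - 1"] by simp
        then show ?thesis using le 2 True by (simp add: ent_dg)
      qed
    next
      case False
      then show ?thesis using masa_ent[OF x] by (simp add: ent_dg)
    qed
  qed
  then show ?thesis by (metis dg_DA)
qed

lemma masa_square:
  assumes x: "x \<in> uhf_masa p h" and proj: "\<And>k i. i < p k \<Longrightarrow> ent x i i = 0 \<or> ent x i i = 1"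
  shows "x * x = x"
proof (rule ent_eqI)
  fix k i j assume "i < p k" "j < p k"
  then show "ent (x * x) i j = ent x i j"
    using proj[of i k] masa_ent[OF x, of i j] by (cases "i = j") (auto simp: masa_mult_ent[OF x])
qed

lemma form_m2:
  "ip (idx 2 K) \<xi> (app (idx 2 K) (MF (m2 a b c d)) \<xi>) =
     ip (pset K) (\<lambda>i. \<xi> (0, i)) (app (pset K) (ent a) (\<lambda>i. \<xi> (0, i))) +
     ip (pset K) (\<lambda>i. \<xi> (0, i)) (app (pset K) (ent b) (\<lambda>i. \<xi> (1, i))) +
     (ip (pset K) (\<lambda>i. \<xi> (1, i)) (app (pset K) (ent c) (\<lambda>i. \<xi> (0, i))) +
     ip (pset K) (\<lambda>i. \<xi> (1, i)) (app (pset K) (ent d) (\<lambda>i. \<xi> (1, i))))"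
  by (simp add: ip_idx app_idx lessThan_2 m2_def ip_add_right)

lemma app_one: "i < p K \<Longrightarrow> app (pset K) (ent 1) \<xi> i = \<xi> i"
  by (simp add: app_def ent_one if_distrib[of "\<lambda>x. x * _"] cong: if_cong)

lemma ip_app_one: "ip (pset K) \<eta> (app (pset K) (ent 1) \<xi>) = ip (pset K) \<eta> \<xi>"
  by (rule ip_cong) (auto simp: app_one)

lemma app_diagonal:
  assumes "\<And>i j. i \<noteq> j \<Longrightarrow> ent e i j = 0" "i < p K"
  shows "app (pset K) (ent e) \<xi> i = ent e i i * \<xi> i"
proof -
  have "app (pset K) (ent e) \<xi> i = (\<Sum>j<p K. if j = i then ent e i i * \<xi> i else 0)"
    unfolding app_def using assms(1) by (intro sum.cong) auto
  then show ?thesis using assms(2) by simp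
qed

text \<open>Completing the square: the form of this matrix is \<open>\<parallel>e \<xi> + x \<eta>\<parallel>\<^sup>2 + \<parallel>\<eta>\<parallel>\<^sup>2 - \<parallel>x \<eta>\<parallel>\<^sup>2\<close>.\<close>

lemma Psd_m2I:
  assumes e: "e \<in> DA" "\<And>i. ent e i i = 0 \<or> ent e i i = 1" and ex: "e * x = x" and x: "norm x \<le> 1"
  shows "Psd 2 (m2 e x (star x) 1)"
  unfolding Psd_def
proof
  fix K
  let ?F = "pset K"
  have e_off: "ent e i j = 0" if "i \<noteq> j" for i j using e(1) that DA_masa masa_ent by blast
  have e_herm: "cnj (ent e i j) = ent e j i" for i j
    using e(2)[of i] e_off[of i j] e_off[of j i] by (cases "i = j") auto
  have x_ent: "ent x i j = ent e i i * ent x i j" for i j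
    using masa_mult_ent[of e x i j] e(1) DA_masa ex by auto
  show "psd (idx 2 K) (MF (m2 e x (star x) 1))"
    unfolding psd_def
  proof (intro conjI ballI allI)
    fix a b
    show "MF (m2 e x (star x) 1) b a = cnj (MF (m2 e x (star x) 1) a b)"
      by (simp add: MF_def m2_def ent_star e_herm ent_one)
  next
    fix \<xi> :: "nat \<times> nat \<Rightarrow> complex"
    let ?u = "\<lambda>i. \<xi> (0, i)" and ?v = "\<lambda>i. \<xi> (1, i)"
    define w where "w = app ?F (ent x) ?v"
    define u where "u i = ent e i i * ?u i" for i
    have ee: "cnj (ent e i i) = ent e i i" "ent e i i * ent e i i = ent e i i" for i
      using e(2)[of i] by auto
    have wi: "ent e i i * w i = w i" for i
      unfolding w_def app_def sum_distrib_left mult.assoc[symmetric] x_ent[symmetric] ..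
    have 1: "ip ?F ?u (app ?F (ent e) ?u) = ip ?F u u"
    proof -
      have "ip ?F ?u (app ?F (ent e) ?u) = (\<Sum>i<p K. cnj (?u i) * (ent e i i * ?u i))"
        unfolding ip_def by (intro sum.cong) (auto simp: app_diagonal e_off)
      also have "\<dots> = ip ?F u u" unfolding ip_def u_def
      proof (intro sum.cong refl)
        fix i show "cnj (?u i) * (ent e i i * ?u i) = cnj (ent e i i * ?u i) * (ent e i i * ?u i)"
          using e(2)[of i] by auto
      qed
      finally show ?thesis .
    qed
    have 2: "ip ?F ?u w = ip ?F u w"
      unfolding ip_def u_def by (intro sum.cong) (auto simp: ee mult.assoc wi mult.left_commute)
    have 3: "ip ?F ?v (app ?F (ent (star x)) ?u) = ip ?F w ?u"
    proof -
      have "ip ?F w ?u = cnj (ip ?F ?u w)" by (simp add: cnj_ip)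
      also have "ip ?F ?u w = ip ?F (app ?F (\<lambda>a b. cnj (ent x b a)) ?u) ?v"
        unfolding w_def by (rule ip_adj)
      also have "cnj \<dots> = ip ?F ?v (app ?F (\<lambda>a b. cnj (ent x b a)) ?u)" by (rule cnj_ip)
      finally show ?thesis by (simp add: ent_star[abs_def])
    qed
    have "Re (ip ?F w ?u) = Re (ip ?F ?u w)" by (simp flip: cnj_ip[of ?F ?u w])
    then have "Re (ip (idx 2 K) \<xi> (app (idx 2 K) (MF (m2 e x (star x) 1)) \<xi>)) =
        sq ?F u + 2 * Re (ip ?F u w) + sq ?F ?v"
      unfolding form_m2 1 3 ip_app_one w_def[symmetric] 2 by simp
    also have "\<dots> \<ge> sq ?F u + 2 * Re (ip ?F u w) + sq ?F w"
    proof -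
      have "opb ?F 1 (ent x)" by (rule opb_weaken[OF opb_ent norm_ge_zero x])
      then have "sq ?F w \<le> 1\<^sup>2 * sq ?F ?v" by (simp only: opb_def w_def)
      then show ?thesis by simp
    qed
    also have "sq ?F u + 2 * Re (ip ?F u w) + sq ?F w = sq ?F (\<lambda>i. u i - (- 1) * w i)"
      unfolding sq_diff ip_scale_right sq_scale by simp
    finally show "0 \<le> Re (ip (idx 2 K) \<xi> (app (idx 2 K) (MF (m2 e x (star x) 1)) \<xi>))"
      using sq_nonneg by (meson order_trans)
  qed
qed

text \<open>At the vector (- y v, v) the form equals |v|^2 - |y v|^2.\<close>

lemma Psd_m2_norm_le:
  assumes P: "Psd 2 (m2 1 y z 1)"
  shows "norm y \<le> 1"
proof (rule norm_le_opb)
  fix K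
  let ?F = "pset K"
  have z: "z = star y" using Psd_star[OF P, of 0 1] by (simp add: m2_def)
  show "opb ?F 1 (ent y)"
    unfolding opb_def
  proof
    fix v :: "nat \<Rightarrow> complex"
    define w where "w = app ?F (ent y) v"
    define \<xi> where "\<xi> a = (if fst a = 0 then - 1 * w (snd a) else v (snd a))" for a :: "nat \<times> nat"
    have "0 \<le> Re (ip (idx 2 K) \<xi> (app (idx 2 K) (MF (m2 1 y z 1)) \<xi>))"
      using P by (intro psd_form) (simp add: Psd_def)
    also have "\<dots> = sq ?F w - 2 * sq ?F w + sq ?F v"
    proof -
      have "ip ?F v (app ?F (ent z) (\<lambda>i. - 1 * w i)) = - ip ?F v (app ?F (ent z) w)"
        by (subst app_scale, subst ip_scale_right) simp
      also have "ip ?F v (app ?F (ent z) w) = cnj (ip ?F (app ?F (ent z) w) v)" by (rule cnj_ip[symmetric])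
      also have "ip ?F (app ?F (ent z) w) v = ip ?F w w"
        unfolding w_def z by (subst ip_adj[symmetric, where M = "ent y", folded ent_star[abs_def]]) (rule refl)
      finally have 1: "ip ?F v (app ?F (ent z) (\<lambda>i. - 1 * w i)) = - ip ?F w w" by (simp add: cnj_ip)
      have 2: "ip ?F (\<lambda>i. - 1 * w i) (app ?F (ent y) v) = - ip ?F w w"
        by (subst ip_scale_left) (simp flip: w_def)
      have 3: "ip ?F (\<lambda>i. - 1 * w i) (\<lambda>i. - 1 * w i) = ip ?F w w"
        by (subst ip_scale_left, subst ip_scale_right) simp
      have \<xi>: "(\<lambda>i. \<xi> (0, i)) = (\<lambda>i. - 1 * w i)" "(\<lambda>i. \<xi> (1, i)) = v"
        by (simp_all add: \<xi>_def)
      show ?thesis unfolding form_m2 \<xi> ip_app_one 1 2 3 by simp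
    qed
    finally show "sq ?F (app ?F (ent y) v) \<le> 1\<^sup>2 * sq ?F v" by (simp add: w_def)
  qed
qed simp

lemma Psd_minor:
  assumes "Psd n x" "s < n" "t < n" "i < p K" "j < p K"
  shows "(cmod (ent (x s t) i j))\<^sup>2 \<le> Re (ent (x s s) i i) * Re (ent (x t t) j j)"
  using psd_minor[of "idx n K" "MF x" "(s, i)" "(t, j)"] assms by (simp add: Psd_def idx_def MF_def)

text \<open>Compress by the column \<open>(1, - e)\<close>.\<close>

lemma Psd_m2_diff:
  assumes P: "Psd 2 (m2 a e e 1)" and e: "e \<in> DA" "\<And>i. ent e i i = 0 \<or> ent e i i = 1"
  shows "Psd 1 (\<lambda>s t. a - e)"
  unfolding Psd_def
proof
  fix K
  let ?F = "pset K"
  have e_off: "ent e i j = 0" if "i \<noteq> j" for i j using e(1) that DA_masa masa_ent by blast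
  have e_herm: "star e = e"
    using Psd_star[OF P, of 0 1] by (simp add: m2_def)
  have a_herm: "star a = a"
    using Psd_star[OF P, of 0 0] by (simp add: m2_def)
  show "psd (idx 1 K) (MF (\<lambda>s t. a - e))"
    unfolding psd_def
  proof (intro conjI ballI allI)
    fix x y
    have "cnj (ent (a - e) i j) = ent (star (a - e)) j i" for i j by (simp add: ent_star)
    then show "MF (\<lambda>s t. a - e) y x = cnj (MF (\<lambda>s t. a - e) x y)"
      by (simp add: MF_def star_diff a_herm e_herm)
  next
    fix \<zeta> :: "nat \<times> nat \<Rightarrow> complex"
    define v where "v i = \<zeta> (0, i)" for i
    define w where "w i = ent e i i * v i" for i
    define \<xi> where "\<xi> a = (if fst a = 0 then v (snd a) else - 1 * w (snd a))" for a :: "nat \<times> nat"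
    have \<xi>: "(\<lambda>i. \<xi> (0, i)) = v" "(\<lambda>i. \<xi> (1, i)) = (\<lambda>i. - 1 * w i)"
      by (simp_all add: \<xi>_def)
    have ee: "cnj (ent e i i) = ent e i i" "ent e i i * ent e i i = ent e i i" for i
      using e(2)[of i] by auto
    have ev: "app ?F (ent e) v i = w i" if "i < p K" for i
      using that by (simp add: app_diagonal e_off w_def)
    have ew: "app ?F (ent e) w i = w i" if "i < p K" for i
      using that by (simp add: app_diagonal e_off w_def ee flip: mult.assoc)
    have vw: "ip ?F v w = ip ?F w w"
      unfolding ip_def w_def
    proof (intro sum.cong refl)
      fix i show "cnj (v i) * (ent e i i * v i) = cnj (ent e i i * v i) * (ent e i i * v i)"
        using e(2)[of i] by auto
    qed
    have wv: "ip ?F w (app ?F (ent e) v) = ip ?F w w" by (rule ip_cong) (auto simp: ev)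
    have "ip ?F v (app ?F (ent e) w) = ip ?F v w" by (rule ip_cong) (auto simp: ew)
    then have 1: "ip ?F v (app ?F (ent e) (\<lambda>i. - 1 * w i)) = - ip ?F w w"
      by (subst app_scale, subst ip_scale_right) (simp add: vw)
    have 2: "ip ?F (\<lambda>i. - 1 * w i) (app ?F (ent e) v) = - ip ?F w w"
      by (subst ip_scale_left) (simp add: wv)
    have 3: "ip ?F (\<lambda>i. - 1 * w i) (\<lambda>i. - 1 * w i) = ip ?F w w"
      by (subst ip_scale_left, subst ip_scale_right) simp
    have "0 \<le> Re (ip (idx 2 K) \<xi> (app (idx 2 K) (MF (m2 a e e 1)) \<xi>))"
      using P by (intro psd_form) (simp add: Psd_def)
    also have "\<dots> = Re (ip ?F v (app ?F (ent a) v) - ip ?F w w)"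
      unfolding form_m2 \<xi> ip_app_one 1 2 3 by simp
    also have "ip ?F v (app ?F (ent a) v) - ip ?F w w = ip ?F v (app ?F (ent (a - e)) v)"
    proof -
      have "app ?F (ent (a - e)) v = (\<lambda>i. app ?F (ent a) v i - app ?F (ent e) v i)"
        by (simp add: app_def ent_diff fun_eq_iff algebra_simps sum_subtractf)
      moreover have "ip ?F v (app ?F (ent e) v) = ip ?F v w" by (rule ip_cong) (auto simp: ev)
      ultimately show ?thesis by (simp add: ip_diff_right vw)
    qed
    also have "\<dots> = ip (idx 1 K) \<zeta> (app (idx 1 K) (MF (\<lambda>s t. a - e)) \<zeta>)"
      by (simp add: ip_idx app_idx v_def[abs_def])
    finally show "0 \<le> Re (ip (idx 1 K) \<zeta> (app (idx 1 K) (MF (\<lambda>s t. a - e)) \<zeta>))" .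
  qed
qed

section \<open>Pinching to diagonal blocks\<close>

definition pinch :: "nat \<Rightarrow> nat \<Rightarrow> 'a \<Rightarrow> 'a" where
  "pinch k K z = (\<Sum>r<p K div p k. dg K (\<lambda>i. if i div p k = r then 1 else 0) * z *
     dg K (\<lambda>i. if i div p k = r then 1 else 0))"

text \<open>The projections repeat with period \<open>p K\<close>. The class of an index is thus its
  block position modulo \<open>p K\<close>, and entries between different copies of one position
  survive.\<close>

lemma ent_pinch:
  assumes "k \<le> K"
  shows "ent (pinch k K z) i j = (if i mod p K div p k = j mod p K div p k then ent z i j else 0)"
proof -
  have "i mod p K div p k < p K div p k"
    using p_dvd[OF assms] by (metis dvd_mult_div_cancel less_mult_imp_div_less mod_less_divisor mult.commute p_pos)
  moreover have "ent (pinch k K z) i j = (\<Sum>r<p K div p k. if r = i mod p K div p k then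
      (if i mod p K div p k = j mod p K div p k then ent z i j else 0) else 0)"
    unfolding pinch_def ent_sum ent_mult_dg ent_dg_mult by (intro sum.cong) auto
  ultimately show ?thesis by simp
qed

lemma norm_pinch_le:
  assumes "k \<le> K"
  shows "norm (pinch k K z) \<le> norm z"
proof (rule norm_le_opb)
  fix L
  show "opb (pset L) (norm z) (ent (pinch k K z))"
    using opb_pinch[OF opb_ent, of L z "\<lambda>i. i mod p K div p k"] by (simp add: ent_pinch[OF assms, abs_def])
qed simp

lemma pinch_diff: "pinch k K (x - y) = pinch k K x - pinch k K y"
  by (simp add: pinch_def algebra_simps sum_subtractf)

lemma pinch_el:
  assumes "k \<le> K"
  shows "pinch k K (el k c) = el k c"
proof (rule ent_eqI)
  fix L i j
  have *: "i mod p K div p k = i div p k mod (p K div p k)" for i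
  proof -
    obtain r where r: "p K = p k * r" using p_dvd[OF assms] by blast
    then show ?thesis by (simp add: mod_mult2_eq)
  qed
  show "ent (pinch k K (el k c)) i j = ent (el k c) i j"
    unfolding ent_pinch[OF assms] by (auto simp: ent_blk blk_def *)
qed

lemma pinch_el_level:
  assumes "k \<le> K"
  shows "pinch k K (el K c) = el K (\<lambda>i j. if i div p k = j div p k then c i j else 0)"
proof (rule ent_eqI)
  fix L i j
  show "ent (pinch k K (el K c)) i j = ent (el K (\<lambda>i j. if i div p k = j div p k then c i j else 0)) i j"
    unfolding ent_pinch[OF assms] ent_blk by (auto simp: blk_def)
qed

end

locale uhf_system = uhf p h for p :: "nat \<Rightarrow> nat" and h :: "nat \<Rightarrow> complex mat \<Rightarrow> 'a::cstar_algebra" +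
  fixes S :: "'a set"
  assumes system: "concrete_operator_system (uhf_masa p h) S"
begin

lemma S_zero: "0 \<in> S" and S_add: "x \<in> S \<Longrightarrow> y \<in> S \<Longrightarrow> x + y \<in> S" and S_scale: "x \<in> S \<Longrightarrow> scaleC c x \<in> S"
  and S_closed: "closed S" and S_star: "x \<in> S \<Longrightarrow> star x \<in> S" and masa_S: "uhf_masa p h \<subseteq> S"
  using system by (auto simp: concrete_operator_system_def complex_subspace_def)

lemma S_bimod: "d \<in> uhf_masa p h \<Longrightarrow> x \<in> S \<Longrightarrow> d' \<in> uhf_masa p h \<Longrightarrow> d * x * d' \<in> S"
  using system by (simp add: concrete_operator_system_def)

lemma DA_S: "DA \<subseteq> S"
  using DA_masa masa_S by blast

lemma S_one [simp]: "1 \<in> S"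
  using DA_S one_DA by blast

lemma masa_one: "1 \<in> uhf_masa p h"
  using DA_masa one_DA by blast

lemma S_left: "d \<in> DA \<Longrightarrow> x \<in> S \<Longrightarrow> d * x \<in> S"
  using S_bimod[of d x 1] masa_one DA_masa by auto

lemma S_right: "d \<in> DA \<Longrightarrow> x \<in> S \<Longrightarrow> x * d \<in> S"
  using S_bimod[of 1 x d] masa_one DA_masa by auto

lemma S_diff: "x \<in> S \<Longrightarrow> y \<in> S \<Longrightarrow> x - y \<in> S"
  using S_add[of x "- y"] S_scale[of y "-1"] by (simp add: scaleC_minus_one)

lemma S_sum: "(\<And>a. a \<in> A \<Longrightarrow> f a \<in> S) \<Longrightarrow> (\<Sum>a\<in>A. f a) \<in> S"
  by (induction A rule: infinite_finite_induct) (auto intro: S_zero S_add)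

text \<open>Pinching uses only diagonal multipliers and sums, so it does not leave the bimodule;
  cutting directly to a finite level could.\<close>

lemma S_pinch: "x \<in> S \<Longrightarrow> pinch k K x \<in> S"
  unfolding pinch_def by (intro S_sum S_left S_right) auto

lemma norm_E_le: "a < p k \<Longrightarrow> norm (E k a a) \<le> 1"
  unfolding E_diag by (intro norm_dg_le) auto

lemma norm_compress_le: "a < p k \<Longrightarrow> b < p k \<Longrightarrow> norm (E k a a * z * E k b b) \<le> norm z"
proof -
  assume ab: "a < p k" "b < p k"
  have "norm (E k a a * z * E k b b) \<le> norm (E k a a * z) * norm (E k b b)" by (rule norm_mult_ineq)
  also have "\<dots> \<le> norm (E k a a) * norm z * norm (E k b b)" by (intro mult_right_mono norm_mult_ineq) auto
  also have "\<dots> \<le> 1 * norm z * 1" by (intro mult_mono norm_E_le ab) auto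
  finally show ?thesis by simp
qed

text \<open>
  If \<open>y = E k a a * x * E k b b\<close> is close to a nonzero multiple of \<open>E k a b\<close>, then pinching \<open>y\<close> at
  a high level brings it close to some \<open>E k a b * d\<close> with \<open>d\<close> diagonal and boundedly invertible,
  and dividing by \<open>d\<close> approximates \<open>E k a b\<close> within the bimodule.
\<close>

lemma E_in_S:
  assumes x: "x \<in> S" and ab: "a < p k" "b < p k"
    and close: "norm (E k a a * x * E k b b - scaleC l (E k a b)) < cmod l"
  shows "E k a b \<in> S"
proof -
  define y where "y = E k a a * x * E k b b"
  define \<mu> where "\<mu> = cmod l - norm (y - scaleC l (E k a b))"
  have \<mu>: "0 < \<mu>" using close by (simp add: \<mu>_def y_def)
  have yS: "y \<in> S" unfolding y_def using x by (intro S_left S_right) auto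
  have "\<exists>z\<in>S. dist z (E k a b) < e" if e: "0 < e" for e
  proof -
    \<comment> \<open>The bound \<mu> / 2 keeps the relevant entries at modulus at least \<mu> / 2,
      so their inverses are at most 2 / \<mu>. The bound e \<mu> / 4 then leaves a final error of at
      most e / 2.\<close>
    define \<eta> where "\<eta> = min (\<mu> / 2) (e * \<mu> / 4)"
    have \<eta>: "0 < \<eta>" "\<eta> \<le> \<mu> / 2" "\<eta> \<le> e * \<mu> / 4" using \<mu> e by (auto simp: \<eta>_def)
    obtain K c where K: "k \<le> K" "norm (y - el K c) < \<eta>" using dense[of k y] \<eta>(1) by blast
    define t where "t = E k a a * el K c * E k b b"
    define c' where "c' i j = (if i mod p k = a \<and> j mod p k = b then c i j else 0)" for i j
    have t_el: "t = el K c'"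
      unfolding t_def E_diag dg_up[OF K(1)] dg_el el_dg c'_def by (intro el_cong) auto
    have "E k a a * y * E k b b = y"
      using ab by (simp add: y_def mult.assoc E_mult) (simp add: E_mult flip: mult.assoc)
    then have "y - t = E k a a * (y - el K c) * E k b b"
      by (simp add: t_def algebra_simps)
    then have yt: "norm (y - t) < \<eta>" using norm_compress_le[OF ab, of "y - el K c"] K(2) by simp
    have E_el: "E k a b = el K (blk (p k) (\<lambda>i j. if i = a \<and> j = b then 1 else 0))"
      unfolding E_def by (rule el_up[OF K(1)])
    \<comment> \<open>After pinching, a column \<open>j\<close> with residue \<open>b\<close> has
      only one possible nonzero row: the one in the same block with residue \<open>a\<close>. Its
      entry is inverted here.\<close>
    define d where "d j = (if j mod p k = b then inverse (c (j div p k * p k + a) j) else 0)" for j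
    have big: "\<mu> / 2 \<le> cmod (c (j div p k * p k + a) j)" if j: "j < p K" "j mod p k = b" for j
    proof -
      let ?i = "j div p k * p k + a"
      have i: "?i mod p k = a" "?i div p k = j div p k" using ab by auto
      have "?i < p K"
      proof -
        obtain r where r: "p K = p k * r" using p_dvd[OF K(1)] by blast
        have "j div p k < r" using j(1) r by (simp add: less_mult_imp_div_less mult.commute)
        then have "(Suc (j div p k)) * p k \<le> r * p k" by (intro mult_right_mono) auto
        then show ?thesis using ab r by (simp add: mult.commute)
      qed
      define g where "g i j = c' i j - l * blk (p k) (\<lambda>i j. if i = a \<and> j = b then 1 else 0) i j" for i j
      have "t - scaleC l (E k a b) = el K g"
        by (simp add: t_el E_el el_scale el_diff g_def[abs_def])
      then have "cmod (g ?i j) \<le> norm (t - scaleC l (E k a b))"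
        using el_entry_le[OF \<open>?i < p K\<close> j(1), of g] by simp
      moreover have "g ?i j = c ?i j - l"
        unfolding g_def c'_def blk_def using i j by (simp del: mod_mult_self3 div_mult_self3)
      ultimately have "cmod (c ?i j - l) \<le> norm (t - scaleC l (E k a b))" by simp
      also have "\<dots> \<le> norm (t - y) + norm (y - scaleC l (E k a b))"
        using norm_triangle_ineq[of "t - y" "y - scaleC l (E k a b)"] by simp
      also have "\<dots> \<le> \<mu> / 2 + (cmod l - \<mu>)" using yt \<eta>(2) by (simp add: norm_minus_commute \<mu>_def)
      finally have "cmod (c ?i j - l) \<le> cmod l - \<mu> / 2" by simp
      moreover have "cmod l \<le> cmod (c ?i j) + cmod (c ?i j - l)"
        using norm_triangle_ineq4[of "c ?i j" "c ?i j - l"] by simp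
      ultimately show ?thesis by simp
    qed
    have norm_d: "norm (dg K d) \<le> 2 / \<mu>"
    proof (rule norm_dg_le)
      fix j assume j: "j < p K"
      show "cmod (d j) \<le> 2 / \<mu>"
      proof (cases "j mod p k = b")
        case True
        have "inverse (cmod (c (j div p k * p k + a) j)) \<le> inverse (\<mu> / 2)"
          using big[OF j True] \<mu> by (intro le_imp_inverse_le) auto
        then show ?thesis using True by (simp add: d_def norm_inverse)
      qed (use \<mu> in \<open>simp add: d_def\<close>)
    qed (use \<mu> in simp)
    have td: "pinch k K t * dg K d = E k a b"
      unfolding t_el pinch_el_level[OF K(1)] el_dg E_el
    proof (intro el_cong)
      fix i j assume ij: "i < p K" "j < p K"
      have "c i j * inverse (c (j div p k * p k + a) j) = 1"
        if "i div p k = j div p k" "i mod p k = a" "j mod p k = b"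
      proof -
        have "i = j div p k * p k + a" using that div_mult_mod_eq[of i "p k"] by simp
        moreover have "c (j div p k * p k + a) j \<noteq> 0" using big[OF ij(2) that(3)] \<mu> by auto
        ultimately show ?thesis by simp
      qed
      then show "(if i div p k = j div p k then c' i j else 0) * d j =
          blk (p k) (\<lambda>i j. if i = a \<and> j = b then 1 else 0) i j"
        by (auto simp: blk_def c'_def d_def)
    qed
    define z where "z = pinch k K y * dg K d"
    have "z \<in> S" unfolding z_def using yS by (intro S_right S_pinch) auto
    moreover have "norm (z - E k a b) < e"
    proof -
      have "z - E k a b = pinch k K (y - t) * dg K d"
        unfolding z_def td[symmetric] pinch_diff by (simp add: left_diff_distrib)
      then have "norm (z - E k a b) \<le> norm (pinch k K (y - t)) * norm (dg K d)"
        by (simp add: norm_mult_ineq)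
      also have "\<dots> \<le> \<eta> * (2 / \<mu>)"
        using norm_pinch_le[OF K(1), of "y - t"] yt norm_d \<eta>(1) by (intro mult_mono) auto
      also have "\<dots> \<le> e * \<mu> / 4 * (2 / \<mu>)" using \<eta>(3) \<mu> by (intro mult_right_mono) auto
      also have "\<dots> < e" using \<mu> e by simp
      finally show ?thesis .
    qed
    ultimately show ?thesis by (auto simp: dist_norm)
  qed
  then have "E k a b \<in> closure S" by (simp add: closure_approachable)
  then show ?thesis using S_closed by simp
qed

lemma E_in_S_level:
  assumes "el k c \<in> S" "i < p k" "j < p k" "c i j \<noteq> 0"
  shows "E k i j \<in> S"
  using E_in_S[OF assms(1-3), of "c i j"] assms by (simp add: E_el_E)

text \<open>An approximant of \<open>x\<close> at a high level need not lie in S. As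
  \<open>x\<close> is near level \<open>m\<close>, pinching the approximant to blocks of size
  \<open>p m\<close> moves it little. Its entries above \<delta> belong to matrix units of S by
  \<open>E_in_S\<close>; the others are discarded, and the discarded part is small because the block
  size is fixed before the high level is chosen.\<close>

lemma section_dense: "S \<subseteq> closure (\<Union>k. S \<inter> range (el k))"
proof
  fix x assume x: "x \<in> S"
  have "\<exists>z\<in>(\<Union>k. S \<inter> range (el k)). dist z x < e" if e: "0 < e" for e
  proof -
    obtain m c0 where m: "norm (x - el m c0) < e / 4" using dense[of 0 x, rule_format, of "e / 4"] e by auto
    \<comment> \<open>Discarding entries of modulus at most \<delta> in blocks of size
      \<open>p m\<close> costs at most p m \<delta> = e / 4, whatever the level
      \<open>K\<close>.\<close>
    define \<delta> where "\<delta> = e / (4 * real (p m))"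
    have pm: "0 < real (p m)" by simp
    have \<delta>: "0 < \<delta>" "real (p m) * \<delta> = e / 4" unfolding \<delta>_def using e pm by auto
    have \<delta>_le: "\<delta> \<le> e / 4"
    proof -
      have "1 * \<delta> \<le> real (p m) * \<delta>" using \<delta>(1) Suc_leI[OF p_pos[of m]] by (intro mult_right_mono) auto
      then show ?thesis using \<delta>(2) by simp
    qed
    obtain K c where K: "m \<le> K" "norm (x - el K c) < \<delta>" using dense[of m x] \<delta>(1) by blast
    define c' where "c' i j = (if i div p m = j div p m then c i j else 0)" for i j
    define c'' where "c'' i j = (if cmod (c' i j) \<le> \<delta> then 0 else c' i j)" for i j
    have pinch_c: "pinch m K (el K c) = el K c'"
      unfolding c'_def by (rule pinch_el_level[OF K(1)])
    have unit: "E K i j \<in> S" if ij: "i < p K" "j < p K" and big: "\<delta> < cmod (c i j)" for i j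
    proof (rule E_in_S[OF x ij])
      have "E K i i * x * E K j j - scaleC (c i j) (E K i j) = E K i i * (x - el K c) * E K j j"
        by (simp add: algebra_simps E_el_E[OF ij, symmetric])
      also have "norm \<dots> \<le> norm (x - el K c)" by (rule norm_compress_le[OF ij])
      finally show "norm (E K i i * x * E K j j - scaleC (c i j) (E K i j)) < cmod (c i j)"
        using K(2) big by simp
    qed
    have "el K c'' \<in> S"
      unfolding el_expand
    proof (intro S_sum)
      fix i j assume "i \<in> pset K" "j \<in> pset K"
      then show "scaleC (c'' i j) (E K i j) \<in> S"
        using unit[of i j] \<delta>(1) by (cases "cmod (c' i j) \<le> \<delta>") (auto simp: c''_def c'_def S_zero intro!: S_scale split: if_splits)
    qed
    moreover have "norm (el K c'' - x) < e"
    proof -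
      have "norm (el K (\<lambda>i j. c' i j - c'' i j)) \<le> real (p m) * \<delta>"
      proof (intro norm_el_le opb_small_blocks[where \<kappa> = "\<lambda>i. i div p m"])
        fix k
        have "{a \<in> pset K. a div p m = k} \<subseteq> {k * p m..<k * p m + p m}"
          by (auto simp: div_mult_mod_eq dest: sym) (metis add_strict_left_mono div_mult_mod_eq mod_less_divisor p_pos)
        then have "card {a \<in> pset K. a div p m = k} \<le> card {k * p m..<k * p m + p m}"
          by (intro card_mono) auto
        then show "card {a \<in> pset K. a div p m = k} \<le> p m" by simp
      qed (use \<delta>(1) in \<open>auto simp: c''_def c'_def\<close>)
      then have 1: "norm (el K c' - el K c'') \<le> e / 4" by (simp add: el_diff \<delta>(2))
      have 2: "norm (pinch m K x - el K c') \<le> e / 4"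
        using norm_pinch_le[OF K(1), of "x - el K c"] K(2) \<delta>_le by (simp add: pinch_diff pinch_c)
      have 3: "norm (pinch m K x - el m c0) < e / 4"
        using norm_pinch_le[OF K(1), of "x - el m c0"] m by (simp add: pinch_diff pinch_el[OF K(1)])
      have tri: "norm (a' - d') \<le> norm (a - a') + norm (b - a) + norm (b - d) + norm (d' - d)" for a a' b d d' :: 'a
      proof -
        have "a' - d' = - (a - a') - (b - a) + (b - d) - (d' - d)" by simp
        then have "norm (a' - d') \<le> norm (- (a - a') - (b - a) + (b - d)) + norm (d' - d)"
          by (metis norm_triangle_ineq4)
        also have "norm (- (a - a') - (b - a) + (b - d)) \<le> norm (- (a - a') - (b - a)) + norm (b - d)"
          by (rule norm_triangle_ineq)
        also have "norm (- (a - a') - (b - a)) \<le> norm (a - a') + norm (b - a)"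
          using norm_triangle_ineq4[of "- (a - a')" "b - a"] by (simp add: norm_minus_commute)
        finally show ?thesis by simp
      qed
      have "norm (el K c'' - x) \<le> norm (el K c' - el K c'') + norm (pinch m K x - el K c') + norm (pinch m K x - el m c0) + norm (x - el m c0)"
        by (rule tri)
      also have "\<dots> < e" using 1 2 3 m by linarith
      finally show ?thesis .
    qed
    ultimately show ?thesis by (auto simp: dist_norm intro!: bexI[of _ "el K c''"])
  qed
  then show "x \<in> closure (\<Union>k. S \<inter> range (el k))" by (simp only: closure_approachable) blast
qed

end

section \<open>Complete order isomorphisms preserving the diagonal\<close>

lemma m2_map: "f (m2 a b c d s t) = m2 (f a) (f b) (f c) (f d) s t"
  by (simp add: m2_def)

lemma norm_normalized_le:
  fixes x :: "'a::cstar_algebra"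
  shows "norm (scaleC (complex_of_real (1 / (norm x + 1))) x) \<le> 1" "complex_of_real (1 / (norm x + 1)) \<noteq> 0"
proof -
  have 0: "0 < norm x + 1" by (simp add: add_nonneg_pos)
  have "norm (scaleC (complex_of_real (1 / (norm x + 1))) x) = norm x / (norm x + 1)"
    unfolding scaleC_of_real using 0 by simp
  also have "\<dots> \<le> 1" using 0 by (simp add: divide_le_eq)
  finally show "norm (scaleC (complex_of_real (1 / (norm x + 1))) x) \<le> 1" .
  show "complex_of_real (1 / (norm x + 1)) \<noteq> 0" unfolding of_real_eq_0_iff using 0 by simp
qed

lemma psd_diag:
  assumes "psd F M" "finite F" "a \<in> F"
  shows "0 \<le> Re (M a a)"
proof -
  let ?x = "\<lambda>x. if x = a then 1 else (0::complex)"
  have "ip F ?x (app F M ?x) = (\<Sum>x\<in>F. if x = a then M a a else 0)"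
    unfolding ip_def using assms(2,3) by (intro sum.cong) (auto simp: app_single)
  then show ?thesis using psd_form[OF assms(1), of ?x] assms(2,3) by simp
qed

context uhf
begin

lemma Psd_diag: "Psd n x \<Longrightarrow> s < n \<Longrightarrow> i < p K \<Longrightarrow> 0 \<le> Re (ent (x s s) i i)"
  using psd_diag[of "idx n K" "MF x" "(s, i)"] by (simp add: Psd_def idx_def MF_def)

section \<open>Finite-level projections of the diagonal and elements with nonnegative
  entries\<close>

definition isproj :: "'a \<Rightarrow> bool" where "isproj e \<longleftrightarrow> e \<in> DA \<and> e * e = e"

lemma DA_star: "d \<in> DA \<Longrightarrow> star d \<in> DA"
proof -
  assume "d \<in> DA"
  then obtain k \<delta> where "d = dg k \<delta>" by (auto simp: DA_def)
  then show ?thesis by (simp add: dg_star dg_DA)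
qed

lemma DA_off: "d \<in> DA \<Longrightarrow> i \<noteq> j \<Longrightarrow> ent d i j = 0"
  using masa_ent DA_masa by blast

lemma DA_mult_ent: "d \<in> DA \<Longrightarrow> ent (d * y) i j = ent d i i * ent y i j"
  using masa_mult_ent DA_masa by blast

lemma isproj_ent: "isproj e \<Longrightarrow> ent e i i = 0 \<or> ent e i i = 1"
  using DA_mult_ent[of e e i i] by (auto simp: isproj_def)

lemma isproj_star: "isproj e \<Longrightarrow> star e = e"
proof (rule ent_eqI)
  fix i j assume e: "isproj e"
  then show "ent (star e) i j = ent e i j"
    using isproj_ent[OF e, of i] DA_off[of e i j] DA_off[of e j i]
    by (cases "i = j") (auto simp: ent_star isproj_def)
qed

lemma isproj_norm: "isproj e \<Longrightarrow> norm e \<le> 1"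
  using norm_selfadjoint_projection[of e] isproj_star[of e] by (cases "e = 0") (auto simp: isproj_def)

lemma isproj_norm_cases: "isproj e \<Longrightarrow> norm e = 0 \<or> norm e = 1"
  using norm_selfadjoint_projection[of e] isproj_star[of e] by (cases "e = 0") (auto simp: isproj_def)

lemma isproj_mult: "isproj e \<Longrightarrow> isproj f \<Longrightarrow> isproj (e * f)"
proof -
  assume *: "isproj e" "isproj f"
  have "e * f * (e * f) = e * (f * e) * f" by (simp add: mult.assoc)
  also have "f * e = e * f" using * by (intro DA_commute) (auto simp: isproj_def)
  also have "e * (e * f) * f = (e * e) * (f * f)" by (simp add: mult.assoc)
  finally show ?thesis using * by (simp add: isproj_def DA_mult)
qed

lemma isproj_diff: "isproj e \<Longrightarrow> isproj f \<Longrightarrow> e * f = f \<Longrightarrow> isproj (e - f)"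
  unfolding isproj_def using DA_commute[of e f] by (auto simp: DA_diff algebra_simps)

lemma isproj_one: "isproj 1"
  by (auto simp: isproj_def)

lemma isproj_E: "i < p k \<Longrightarrow> isproj (E k i i)"
  by (auto simp: isproj_def E_mult)

lemma isproj_DA: "isproj e \<Longrightarrow> e \<in> DA"
  by (simp add: isproj_def)

lemma el_DA: "(\<And>i j. i < p K \<Longrightarrow> j < p K \<Longrightarrow> i \<noteq> j \<Longrightarrow> c i j = 0) \<Longrightarrow> el K c \<in> DA"
proof -
  assume *: "\<And>i j. i < p K \<Longrightarrow> j < p K \<Longrightarrow> i \<noteq> j \<Longrightarrow> c i j = 0"
  have "el K c = dg K (\<lambda>i. c i i)" unfolding dg_def using * by (intro el_cong) auto
  then show ?thesis by auto
qed

lemma DA_level: "d \<in> DA \<Longrightarrow> \<exists>K\<ge>k. \<exists>\<delta>. d = dg K \<delta>"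
proof -
  assume "d \<in> DA"
  then obtain k' \<delta> where "d = dg k' \<delta>" by (auto simp: DA_def)
  then have "d = dg (max k k') (\<lambda>i. \<delta> (i mod p k'))" using dg_up[of k' "max k k'"] by simp
  then show ?thesis by (intro exI[of _ "max k k'"] conjI exI[of _ "\<lambda>i. \<delta> (i mod p k')"]; simp)
qed

lemma E_conj_DA:
  assumes "d \<in> DA"
  shows "E k i j * d * E k j i \<in> DA"
proof -
  obtain K \<delta> where K: "k \<le> K" "d = dg K \<delta>" using DA_level[OF assms, of k] by blast
  show ?thesis
    unfolding E_def el_up[OF K(1)] K(2) el_dg el_mult
  proof (rule el_DA, rule sum.neutral, rule ballI)
    fix x y l :: nat assume xy: "x \<noteq> y"
    \<comment> \<open>The intermediate index \<open>l\<close> puts \<open>x\<close> and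
      \<open>y\<close> in the same block, and the units give both the residue \<open>i\<close>;
      distinct \<open>x\<close> and \<open>y\<close> cannot satisfy this.\<close>
    have "x div p k \<noteq> y div p k \<or> x mod p k \<noteq> y mod p k"
      using xy by (metis div_mult_mod_eq)
    then show "blk (p k) (\<lambda>ia ja. if ia = i \<and> ja = j then 1 else 0) x l * \<delta> l *
        blk (p k) (\<lambda>ia ja. if ia = j \<and> ja = i then 1 else 0) l y = 0"
      by (auto simp: blk_def)
  qed
qed

lemma E_DA_commute: "d \<in> DA \<Longrightarrow> E k i i * d = d * E k i i"
  by (rule DA_commute) auto

text \<open>The normal form of an implementing element. Its action on the diagonal determines the
  moduli of its entries, and nonnegativity determines the entries from these
  (\<open>nn_unique\<close>); the class is closed under sums and products.\<close>

definition nn :: "'a \<Rightarrow> bool" where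
  "nn u \<longleftrightarrow> u \<in> lvl \<and> (\<forall>i j. \<exists>r\<ge>0. ent u i j = of_real r)"

lemma nn_ent:
  assumes "nn u"
  shows "ent u i j = of_real (Re (ent u i j))" "0 \<le> Re (ent u i j)"
proof -
  obtain r where "0 \<le> r" "ent u i j = complex_of_real r" using assms unfolding nn_def by blast
  then show "ent u i j = of_real (Re (ent u i j))" "0 \<le> Re (ent u i j)" by auto
qed

lemma nn_level:
  assumes "nn u"
  shows "\<exists>K\<ge>k. u = el K (ent u)"
proof -
  obtain k' c where "u = el k' c" using assms by (auto simp: nn_def lvl_def)
  then have "u \<in> range (el (max k k'))" using level_mono[of k' "max k k'"] by auto
  then show ?thesis using el_ent by (metis max.cobounded1)
qed

lemma nn_el:
  assumes "\<And>i j. i < p K \<Longrightarrow> j < p K \<Longrightarrow> \<exists>r\<ge>0. c i j = of_real r"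
  shows "nn (el K c)"
  unfolding nn_def
proof (intro conjI allI)
  show "el K c \<in> lvl" by (auto simp: lvl_def)
  fix i j
  show "\<exists>r\<ge>0. ent (el K c) i j = of_real r"
    using assms[of "i mod p K" "j mod p K"] by (auto simp: ent_blk blk_def intro: exI[of _ 0])
qed

lemma nn_E: "nn (E k i j)"
  unfolding E_def by (rule nn_el) (auto intro: exI[of _ 0] exI[of _ 1])

lemma nn_isproj: "isproj e \<Longrightarrow> nn e"
proof -
  assume e: "isproj e"
  obtain k d where kd: "e = dg k d" using e by (auto simp: isproj_def DA_def)
  show ?thesis unfolding kd dg_def
  proof (rule nn_el)
    fix i j assume ij: "i < p k" "j < p k"
    have "d i = 0 \<or> d i = 1" using isproj_ent[OF e, of i] ij by (simp add: kd ent_dg)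
    then show "\<exists>r\<ge>0. (if i = j then d i else 0) = of_real r"
      by (auto intro: exI[of _ 0] exI[of _ 1])
  qed
qed

lemma nn_common:
  assumes "nn u" "nn w"
  shows "\<exists>K\<ge>k. u = el K (ent u) \<and> w = el K (ent w)"
proof -
  obtain K where K: "k \<le> K" "u = el K (ent u)" using nn_level[OF assms(1)] by blast
  obtain L where L: "K \<le> L" "w = el L (ent w)" using nn_level[OF assms(2)] by blast
  have "u \<in> range (el L)" using K(2) level_mono[OF L(1)] by blast
  then have "u = el L (ent u)" by (rule el_ent)
  then show ?thesis using K L order.trans by blast
qed

lemma nn_mult:
  assumes "nn u" "nn w"
  shows "nn (u * w)"
proof -
  obtain K where K: "u = el K (ent u)" "w = el K (ent w)" using nn_common[OF assms, of 0] by blast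
  have "u * w = el K (\<lambda>i j. \<Sum>l<p K. ent u i l * ent w l j)" using K el_mult by metis
  moreover have "nn (el K (\<lambda>i j. \<Sum>l<p K. ent u i l * ent w l j))"
  proof (rule nn_el)
    fix i j
    have "(\<Sum>l<p K. ent u i l * ent w l j) = (\<Sum>l<p K. of_real (Re (ent u i l)) * of_real (Re (ent w l j)))"
      by (intro sum.cong refl arg_cong2[where f = "(*)"] nn_ent assms)
    then show "\<exists>r\<ge>0. (\<Sum>l<p K. ent u i l * ent w l j) = complex_of_real r"
      using nn_ent(2) assms
      by (intro exI[of _ "\<Sum>l<p K. Re (ent u i l) * Re (ent w l j)"]) (auto intro!: sum_nonneg mult_nonneg_nonneg)
  qed
  ultimately show ?thesis by simp
qed

lemma nn_add:
  assumes "nn u" "nn w"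
  shows "nn (u + w)"
proof -
  obtain K where K: "u = el K (ent u)" "w = el K (ent w)" using nn_common[OF assms, of 0] by blast
  have "u + w = el K (\<lambda>i j. ent u i j + ent w i j)" using K el_add by metis
  moreover have "nn (el K (\<lambda>i j. ent u i j + ent w i j))"
  proof (rule nn_el)
    fix i j
    obtain a b where "0 \<le> a \<and> ent u i j = complex_of_real a" "0 \<le> b \<and> ent w i j = complex_of_real b"
      using nn_ent[OF assms(1), of i j] nn_ent[OF assms(2), of i j] by blast
    then show "\<exists>r\<ge>0. ent u i j + ent w i j = complex_of_real r"
      by (intro exI[of _ "a + b"]) auto
  qed
  ultimately show ?thesis by simp
qed

lemma nn_zero: "nn 0"
  using nn_el[of 0 "\<lambda>i j. 0"] by (auto simp: el_zero)

lemma nn_sum: "(\<And>a. a \<in> A \<Longrightarrow> nn (f a)) \<Longrightarrow> nn (\<Sum>a\<in>A. f a)"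
  by (induction A rule: infinite_finite_induct) (auto intro: nn_add nn_zero)

lemma ent_conj_E:
  assumes "i < p K" "j < p K"
  shows "ent (el K c * E K j j * star (el K c)) i i = of_real ((cmod (c i j))\<^sup>2)"
proof -
  have "el K c * E K j j * star (el K c) =
      el K (\<lambda>a b. \<Sum>l<p K. c a l * (if l = j then 1 else 0) * cnj (c b l))"
    by (simp add: E_diag el_dg el_star el_mult)
  moreover have "(\<Sum>l<p K. c i l * (if l = j then 1 else 0) * cnj (c i l)) =
      (\<Sum>l<p K. if l = j then c i j * cnj (c i j) else 0)"
    by (intro sum.cong) auto
  ultimately show ?thesis using assms unfolding complex_norm_square by (simp add: ent_el)
qed

text \<open>The square of the \<open>(a, b)\<close> entry of \<open>u\<close> is the \<open>(a, a)\<close> entry of \<open>u * E k b b * star u\<close>.\<close>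

lemma nn_unique:
  assumes nn: "nn u" "nn w" and eq: "\<And>k b. b < p k \<Longrightarrow> u * E k b b * star u = w * E k b b * star w"
  shows "u = w"
proof (rule ent_eqI)
  fix k i j assume ij: "i < p k" "j < p k"
  obtain K where K: "k \<le> K" "u = el K (ent u)" "w = el K (ent w)" using nn_common[OF nn] by blast
  have ij': "i < p K" "j < p K" using ij p_mono[OF K(1)] by auto
  have "complex_of_real ((cmod (ent u i j))\<^sup>2) = complex_of_real ((cmod (ent w i j))\<^sup>2)"
    using ent_conj_E[OF ij', of "ent u"] ent_conj_E[OF ij', of "ent w"] eq[OF ij'(2)] K(2,3) by metis
  then have "(cmod (ent u i j))\<^sup>2 = (cmod (ent w i j))\<^sup>2" by (simp only: of_real_eq_iff)
  then have "cmod (ent u i j) = cmod (ent w i j)" by simp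
  moreover obtain a b where "0 \<le> a \<and> ent u i j = complex_of_real a" "0 \<le> b \<and> ent w i j = complex_of_real b"
    using nn_ent[OF nn(1), of i j] nn_ent[OF nn(2), of i j] by blast
  ultimately show "ent u i j = ent w i j" by auto
qed

end

locale uhf_pair = A: uhf_system p \<alpha> S + B: uhf_system q \<beta> T
  for p \<alpha> S q \<beta> T
begin

lemma cp_Psd:
  assumes cp: "completely_positive_map S0 T0 f" and x: "A.Psd n x"
    and S0: "\<And>s t. s < n \<Longrightarrow> t < n \<Longrightarrow> x s t \<in> S0"
  shows "B.Psd n (\<lambda>s t. f (x s t))"
proof -
  define X where "X = mat n n (\<lambda>(s, t). x s t)"
  have "A.Psd n (\<lambda>s t. X $$ (s, t))" using x by (subst A.Psd_cong[where y = x]) (auto simp: X_def)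
  then have "mat_positive n X" unfolding A.mat_positive_iff by (simp add: X_def)
  moreover have "elements_mat X \<subseteq> S0" using S0 by (auto simp: elements_mat_def X_def)
  ultimately have "mat_positive n (map_mat f X)" using cp by (simp add: completely_positive_map_def)
  then have "B.Psd n (\<lambda>s t. map_mat f X $$ (s, t))" unfolding B.mat_positive_iff by simp
  then show ?thesis by (subst (asm) B.Psd_cong[where y = "\<lambda>s t. f (x s t)"]) (auto simp: X_def)
qed

lemma cpI:
  assumes "f ` S0 \<subseteq> T0" "complex_linear_on S0 f"
    and Psd: "\<And>n x. A.Psd n x \<Longrightarrow> (\<And>s t. s < n \<Longrightarrow> t < n \<Longrightarrow> x s t \<in> S0) \<Longrightarrow> B.Psd n (\<lambda>s t. f (x s t))"
  shows "completely_positive_map S0 T0 f"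
  unfolding completely_positive_map_def
proof (intro conjI allI impI assms(1,2))
  fix n X assume X: "mat_positive n X \<and> elements_mat X \<subseteq> S0"
  then have c: "X \<in> carrier_mat n n" and P: "A.Psd n (\<lambda>s t. X $$ (s, t))"
    by (auto simp: A.mat_positive_iff)
  have "X $$ (s, t) \<in> S0" if "s < n" "t < n" for s t
    using X elements_matI[OF c that refl] by blast
  then have "B.Psd n (\<lambda>s t. f (X $$ (s, t)))" by (rule Psd[OF P])
  then have "B.Psd n (\<lambda>s t. map_mat f X $$ (s, t))"
    using c by (subst B.Psd_cong[where y = "\<lambda>s t. f (X $$ (s, t))"]) auto
  then show "mat_positive n (map_mat f X)" using c by (simp add: B.mat_positive_iff)
qed

lemma cp_Psd_m2:
  assumes "completely_positive_map S0 T0 f" "A.Psd 2 (m2 a b c d)" "a \<in> S0" "b \<in> S0" "c \<in> S0" "d \<in> S0"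
  shows "B.Psd 2 (m2 (f a) (f b) (f c) (f d))"
proof -
  have "B.Psd 2 (\<lambda>s t. f (m2 a b c d s t))"
    by (rule cp_Psd[OF assms(1,2)]) (auto simp: m2_def assms(3-))
  then show ?thesis by (simp only: m2_map)
qed

text \<open>For |x| \<le> 1 the matrix with rows (1, x) and (x*, 1) is positive, so its image is
  hermitian and the off-diagonal entries of the image are adjoint to each other. Scaling reduces to
  this case.\<close>

lemma cp_star:
  fixes f :: "'a \<Rightarrow> 'b"
  assumes cp: "completely_positive_map S0 T0 f" and S0: "complex_subspace S0" "1 \<in> S0"
    and x: "x \<in> S0" "star x \<in> S0"
  shows "f (star x) = star (f x)"
proof -
  define r where "r = complex_of_real (1 / (norm x + 1))"
  have r: "r \<noteq> 0" "cnj r = r" unfolding r_def by (rule norm_normalized_le) simp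
  have "norm (scaleC r x) \<le> 1" unfolding r_def by (rule norm_normalized_le)
  then have "A.Psd 2 (m2 1 (scaleC r x) (star (scaleC r x)) 1)"
    by (intro A.Psd_m2I) (auto simp: A.ent_one)
  moreover have "scaleC r x \<in> S0" "star (scaleC r x) \<in> S0"
    using S0 x by (auto simp: complex_subspace_def star_scaleC)
  ultimately have "B.Psd 2 (m2 (f 1) (f (scaleC r x)) (f (star (scaleC r x))) (f 1))"
    using cp S0 by (intro cp_Psd_m2) auto
  from B.Psd_star[OF this, of 0 1] have "star (f (scaleC r x)) = f (scaleC r (star x))"
    by (simp add: m2_def star_scaleC r)
  then have "scaleC r (star (f x)) = scaleC r (f (star x))"
    using cp x by (simp add: completely_positive_map_def complex_linear_on_def star_scaleC r)
  then have "scaleC (inverse r) (scaleC r (star (f x))) = scaleC (inverse r) (scaleC r (f (star x)))" by simp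
  then show ?thesis using r by (simp add: scaleC_scaleC)
qed

text \<open>The same positive matrix as in \<open>cp_star\<close>; as \<phi>(1) = 1 for a unital
  map, \<open>Psd_m2_norm_le\<close> applies to its image.\<close>

lemma ucp_contractive:
  fixes f :: "'a \<Rightarrow> 'b"
  assumes ucp: "ucp_map S0 T0 f" and S0: "complex_subspace S0" "1 \<in> S0"
    and x: "x \<in> S0" "star x \<in> S0"
  shows "norm (f x) \<le> norm x"
proof (cases "x = 0")
  case True
  have "f (scaleC 0 x) = scaleC 0 (f x)"
    using ucp x by (simp only: ucp_map_def completely_positive_map_def complex_linear_on_def)
  then show ?thesis using True by simp
next
  case False
  define r where "r = complex_of_real (1 / norm x)"
  have r: "r \<noteq> 0" "cnj r = r" "cmod r = 1 / norm x" using False by (auto simp: r_def norm_divide)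
  have "norm (scaleC r x) \<le> 1" using False by (simp add: norm_scaleC r)
  then have "A.Psd 2 (m2 1 (scaleC r x) (star (scaleC r x)) 1)"
    by (intro A.Psd_m2I) (auto simp: A.ent_one)
  moreover have "scaleC r x \<in> S0" "star (scaleC r x) \<in> S0"
    using S0 x by (auto simp: complex_subspace_def star_scaleC)
  ultimately have "B.Psd 2 (m2 (f 1) (f (scaleC r x)) (f (star (scaleC r x))) (f 1))"
    using ucp S0 by (intro cp_Psd_m2[of S0 T0]) (auto simp: ucp_map_def)
  then have "B.Psd 2 (m2 1 (f (scaleC r x)) (f (star (scaleC r x))) 1)" using ucp by (simp add: ucp_map_def)
  then have "norm (f (scaleC r x)) \<le> 1" by (rule B.Psd_m2_norm_le)
  moreover have "f (scaleC r x) = scaleC r (f x)"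
    using ucp x by (simp only: ucp_map_def completely_positive_map_def complex_linear_on_def)
  ultimately have "norm (f x) / norm x \<le> 1" by (simp add: norm_scaleC r)
  then show ?thesis using False by (simp add: field_simps)
qed

end

text \<open>The inverse is a parameter, which makes the assumptions symmetric: by
  \<open>swap\<close> every result about \<phi> is available for \<psi>.\<close>

locale masa_iso = uhf_pair p \<alpha> S q \<beta> T for p \<alpha> S q \<beta> T +
  fixes \<phi> \<psi>
  assumes ucp_phi: "ucp_map S T \<phi>" and ucp_psi: "ucp_map T S \<psi>"
    and psi_phi [simp]: "x \<in> S \<Longrightarrow> \<psi> (\<phi> x) = x" and phi_psi [simp]: "y \<in> T \<Longrightarrow> \<phi> (\<psi> y) = y"
    and phi_masa: "\<phi> ` uhf_masa p \<alpha> \<subseteq> uhf_masa q \<beta>" and psi_masa: "\<psi> ` uhf_masa q \<beta> \<subseteq> uhf_masa p \<alpha>"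
begin

lemma swap: "masa_iso q \<beta> T p \<alpha> S \<psi> \<phi>"
  by (intro masa_iso.intro masa_iso_axioms.intro uhf_pair.intro A.uhf_system_axioms B.uhf_system_axioms)
    (use ucp_phi ucp_psi phi_masa psi_masa in auto)

lemma cp_phi: "completely_positive_map S T \<phi>" and phi_one [simp]: "\<phi> 1 = 1"
  using ucp_phi by (auto simp: ucp_map_def)

lemma phi_T [intro]: "x \<in> S \<Longrightarrow> \<phi> x \<in> T"
  and phi_add: "x \<in> S \<Longrightarrow> y \<in> S \<Longrightarrow> \<phi> (x + y) = \<phi> x + \<phi> y"
  and phi_scale: "x \<in> S \<Longrightarrow> \<phi> (scaleC c x) = scaleC c (\<phi> x)"
  using cp_phi by (auto simp: completely_positive_map_def complex_linear_on_def)

lemma phi_zero [simp]: "\<phi> 0 = 0"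
  using phi_scale[OF A.S_zero, of 0] by simp

lemma phi_diff: "x \<in> S \<Longrightarrow> y \<in> S \<Longrightarrow> \<phi> (x - y) = \<phi> x - \<phi> y"
  using phi_add[of "x - y" y] A.S_diff by auto

lemma phi_sum: "(\<And>a. a \<in> I \<Longrightarrow> f a \<in> S) \<Longrightarrow> \<phi> (\<Sum>a\<in>I. f a) = (\<Sum>a\<in>I. \<phi> (f a))"
  by (induction I rule: infinite_finite_induct) (auto simp: phi_add A.S_sum)

lemma S_subspace: "complex_subspace S"
  using A.S_zero A.S_add A.S_scale by (simp add: complex_subspace_def)

lemma phi_star: "x \<in> S \<Longrightarrow> \<phi> (star x) = star (\<phi> x)"
  by (rule cp_star[OF cp_phi S_subspace]) (auto intro: A.S_star)

lemma phi_contractive: "x \<in> S \<Longrightarrow> norm (\<phi> x) \<le> norm x"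
  by (rule ucp_contractive[OF ucp_phi S_subspace]) (auto intro: A.S_star)

lemmas psi_S [intro] = masa_iso.phi_T[OF swap]
lemmas psi_contractive = masa_iso.phi_contractive[OF swap]
lemmas psi_scale = masa_iso.phi_scale[OF swap]
lemmas psi_sum = masa_iso.phi_sum[OF swap]
lemmas psi_zero [simp] = masa_iso.phi_zero[OF swap]
lemmas psi_one [simp] = masa_iso.phi_one[OF swap]

lemma phi_norm: "x \<in> S \<Longrightarrow> norm (\<phi> x) = norm x"
  using phi_contractive[of x] psi_contractive[OF phi_T, of x] by simp

text \<open>
  A projection \<open>e\<close> of the diagonal is mapped to a projection: \<open>h = \<phi> e\<close> satisfies \<open>h\<^sup>2 \<le> h\<close> by the
  Schwarz inequality for \<open>\<phi>\<close>, and \<open>h \<le> h\<^sup>2\<close> by the one for \<open>\<psi>\<close> at \<open>h\<close>.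
\<close>

lemma phi_isproj:
  assumes e: "A.isproj e"
  shows "B.isproj (\<phi> e)"
proof -
  define h where "h = \<phi> e"
  have eDA: "e \<in> A.DA" "e * e = e" and eS: "e \<in> S" using e A.DA_S by (auto simp: A.isproj_def)
  have e_star: "star e = e" by (rule A.isproj_star[OF e])
  have hT: "h \<in> T" using eS by (auto simp: h_def)
  have hm: "h \<in> uhf_masa q \<beta>" using eDA A.DA_masa phi_masa by (auto simp: h_def)
  have h_star: "star h = h" using phi_star[OF eS] e_star by (simp add: h_def)
  have "A.Psd 2 (m2 e e (star e) 1)"
    using A.isproj_norm[OF e] A.isproj_ent[OF e] eDA by (intro A.Psd_m2I) auto
  then have "B.Psd 2 (m2 h h h 1)"
    using cp_Psd_m2[OF cp_phi, of e e e 1] eS by (simp add: e_star h_def)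
  then have le1: "(cmod (B.ent h i i))\<^sup>2 \<le> Re (B.ent h i i)" if "i < q k" for i k
    using B.Psd_minor[of 2 "m2 h h h 1" 0 1 i k i] that by (simp add: m2_def B.ent_one)
  have hhT: "h * h \<in> T" using B.S_bimod[OF hm hT B.masa_one] by simp
  \<comment> \<open>This is \<open>Y\<^sup>* Y\<close> for the matrix \<open>Y\<close> with rows (h,
    1) and (0, 0).\<close>
  have "B.Psd 2 (m2 (h * h) h h 1)"
  proof -
    have "B.Psd 2 (mm 2 (\<lambda>s t. star (m2 h 1 0 0 t s)) (m2 h 1 0 0))" by (rule B.Psd_star_mult)
    moreover have "mm 2 (\<lambda>s t. star (m2 h 1 0 0 t s)) (m2 h 1 0 0) s t = m2 (h * h) h h 1 s t"
      if "s < 2" "t < 2" for s t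
      using that by (auto simp: mm_def lessThan_2 m2_def h_star less_2_cases_iff)
    ultimately show ?thesis by (subst B.Psd_cong[symmetric]) auto
  qed
  then have "A.Psd 2 (m2 (\<psi> (h * h)) (\<psi> h) (\<psi> h) (\<psi> 1))"
    by (rule uhf_pair.cp_Psd_m2[OF masa_iso.axioms(1)[OF swap] masa_iso.cp_phi[OF swap]]) (use hT hhT in auto)
  moreover have "\<psi> h = e" using eS by (simp add: h_def)
  ultimately have "A.Psd 2 (m2 (\<psi> (h * h)) e e 1)" by simp
  then have "A.Psd 1 (\<lambda>s t. \<psi> (h * h) - e)"
    using eDA A.isproj_ent[OF e] by (intro A.Psd_m2_diff) auto
  then have "B.Psd 1 (\<lambda>s t. \<phi> (\<psi> (h * h) - e))"
    using cp_phi hhT eS by (intro cp_Psd) (auto intro: A.S_diff)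
  then have "B.Psd 1 (\<lambda>s t. h * h - h)"
    using hhT eS psi_S[OF hhT] by (simp add: phi_diff h_def[symmetric])
  then have le2: "0 \<le> Re (B.ent (h * h - h) i i)" if "i < q k" for i k
    using B.Psd_diag[of 1 "\<lambda>s t. h * h - h" 0] that by simp
  have ent01: "B.ent h i i = 0 \<or> B.ent h i i = 1" if i: "i < q k" for i k
  proof -
    have "cnj (B.ent h i i) = B.ent h i i" using B.ent_star[of h i i] by (simp add: h_star)
    then have im: "Im (B.ent h i i) = 0" by (simp add: complex_eq_iff)
    then have "(Re (B.ent h i i))\<^sup>2 \<le> Re (B.ent h i i)" using le1[OF i] by (simp add: cmod_power2)
    moreover have "Re (B.ent h i i) \<le> (Re (B.ent h i i))\<^sup>2"
      using le2[OF i] im by (simp add: B.ent_diff B.masa_mult_ent[OF hm] power2_eq_square)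
    ultimately have "Re (B.ent h i i) * (Re (B.ent h i i) - 1) = 0"
      by (simp add: power2_eq_square algebra_simps)
    then have "Re (B.ent h i i) = 0 \<or> Re (B.ent h i i) = 1" by auto
    then show ?thesis using im by (auto simp: complex_eq_iff)
  qed
  have "h \<in> B.DA" by (rule B.masa_projection_DA[OF hm]) (rule ent01)
  moreover have "h * h = h" by (rule B.masa_square[OF hm]) (rule ent01)
  ultimately show ?thesis by (simp add: B.isproj_def h_def)
qed

text \<open>Up to scaling, the matrix with rows (e, y) and (y*, 1) is positive, and so is its image.
  Its minors bound the entries of \<phi>(y) in row i by the diagonal entry of \<phi>(e), so rows
  where the projection \<phi>(e) vanishes are zero.\<close>

lemma phi_corner:
  assumes e: "A.isproj e" and y: "y \<in> S" and ey: "e * y = y"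
  shows "\<phi> e * \<phi> y = \<phi> y"
proof -
  define r where "r = complex_of_real (1 / (norm y + 1))"
  have r: "r \<noteq> 0" unfolding r_def by (rule norm_normalized_le)
  have le: "norm (scaleC r y) \<le> 1" unfolding r_def by (rule norm_normalized_le)
  have yS: "scaleC r y \<in> S" using y by (rule A.S_scale)
  have eDA: "e \<in> A.DA" and eS: "e \<in> S" using e A.DA_S by (auto simp: A.isproj_def)
  have "A.Psd 2 (m2 e (scaleC r y) (star (scaleC r y)) 1)"
    using A.isproj_ent[OF e] le ey by (intro A.Psd_m2I eDA) (auto simp: scaleC_mult_right)
  then have P: "B.Psd 2 (m2 (\<phi> e) (\<phi> (scaleC r y)) (\<phi> (star (scaleC r y))) (\<phi> 1))"
    using cp_phi eS yS A.S_star[OF yS] by (intro cp_Psd_m2) auto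
  have h: "B.isproj (\<phi> e)" using e by (rule phi_isproj)
  show ?thesis
  proof (rule B.ent_eqI)
    fix k i j assume ij: "i < q k" "j < q k"
    have "(cmod (B.ent (\<phi> (scaleC r y)) i j))\<^sup>2 \<le> Re (B.ent (\<phi> e) i i)"
      using B.Psd_minor[OF P, of 0 1 i k j] ij by (simp add: m2_def B.ent_one)
    then have "B.ent (\<phi> e) i i = 0 \<Longrightarrow> B.ent (\<phi> y) i j = 0"
      using r y by (simp add: phi_scale B.ent_scale)
    then show "B.ent (\<phi> e * \<phi> y) i j = B.ent (\<phi> y) i j"
      using B.isproj_ent[OF h, of i] by (auto simp: B.DA_mult_ent[OF B.isproj_DA[OF h]])
  qed
qed

text \<open>Split \<open>x\<close> into \<open>e * x\<close> and \<open>(1 - e) * x\<close> and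
  apply \<open>phi_corner\<close> with the complementary projections: \<phi>(e) fixes the image of
  the first part and kills that of the second.\<close>

lemma phi_proj_left:
  assumes e: "A.isproj e" and x: "x \<in> S"
  shows "\<phi> (e * x) = \<phi> e * \<phi> x"
proof -
  have eDA: "e \<in> A.DA" "e * e = e" and eS: "e \<in> S" using e A.DA_S by (auto simp: A.isproj_def)
  have e': "A.isproj (1 - e)" using A.isproj_diff[OF A.isproj_one e] by simp
  have exS: "e * x \<in> S" "(1 - e) * x \<in> S" using x A.isproj_DA[OF e] A.isproj_DA[OF e'] by (auto intro: A.S_left)
  have 1: "\<phi> e * \<phi> (e * x) = \<phi> (e * x)"
    using eDA by (intro phi_corner e exS) (simp flip: mult.assoc)
  have "\<phi> (1 - e) * \<phi> ((1 - e) * x) = \<phi> ((1 - e) * x)"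
    using e' by (intro phi_corner e' exS) (simp add: A.isproj_def flip: mult.assoc)
  then have "\<phi> ((1 - e) * x) = \<phi> ((1 - e) * x) - \<phi> e * \<phi> ((1 - e) * x)"
    using eS by (simp add: phi_diff left_diff_distrib)
  then have 2: "\<phi> e * \<phi> ((1 - e) * x) = 0" by simp
  have "\<phi> x = \<phi> (e * x + (1 - e) * x)" by (simp add: left_diff_distrib)
  then have "\<phi> x = \<phi> (e * x) + \<phi> ((1 - e) * x)" using exS by (simp only: phi_add)
  then show ?thesis using 1 2 by (simp add: distrib_left)
qed

text \<open>The assumption on the masas only places the image in the closure. It lies in a finite
  level because \<open>d\<close> is a finite combination of projections, whose images do.\<close>

lemma phi_DA:
  assumes "d \<in> A.DA"
  shows "\<phi> d \<in> B.DA"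
proof -
  obtain k \<delta> where d: "d = A.dg k \<delta>" using assms by (auto simp: A.DA_def)
  have E: "A.E k i i \<in> S" for i using A.DA_S by blast
  have "\<phi> d = (\<Sum>i<p k. scaleC (\<delta> i) (\<phi> (A.E k i i)))"
    unfolding d A.dg_expand using E by (simp add: phi_sum phi_scale A.S_scale)
  also have "\<dots> \<in> B.DA"
    by (intro B.DA_sum B.DA_scale B.isproj_DA phi_isproj A.isproj_E) auto
  finally show ?thesis .
qed

lemma phi_left:
  assumes "d \<in> A.DA" and x: "x \<in> S"
  shows "\<phi> (d * x) = \<phi> d * \<phi> x"
proof -
  obtain k \<delta> where d: "d = A.dg k \<delta>" using assms by (auto simp: A.DA_def)
  have E: "A.E k i i \<in> S" for i using A.DA_S by blast
  have Ex: "A.E k i i * x \<in> S" for i using x by (intro A.S_left) auto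
  have "\<phi> d = (\<Sum>i<p k. scaleC (\<delta> i) (\<phi> (A.E k i i)))"
    unfolding d A.dg_expand using E by (simp add: phi_sum phi_scale A.S_scale)
  moreover have "\<phi> (d * x) = (\<Sum>i<p k. scaleC (\<delta> i) (\<phi> (A.E k i i * x)))"
    unfolding d A.dg_expand using Ex
    by (simp add: phi_sum phi_scale A.S_scale sum_distrib_right scaleC_mult_left)
  moreover have "\<phi> (A.E k i i * x) = \<phi> (A.E k i i) * \<phi> x" if "i < p k" for i
    using that x by (intro phi_proj_left A.isproj_E)
  ultimately show ?thesis by (simp add: sum_distrib_right scaleC_mult_left)
qed

lemma phi_right:
  assumes "d \<in> A.DA" and x: "x \<in> S"
  shows "\<phi> (x * d) = \<phi> x * \<phi> d"
proof -
  have "\<phi> (x * d) = \<phi> (star (star d * star x))" by (simp add: star_mult star_star)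
  also have "\<dots> = star (\<phi> (star d * star x))"
    using assms by (intro phi_star A.S_left A.DA_star A.S_star)
  also have "\<dots> = star (\<phi> (star d) * \<phi> (star x))"
    using assms by (subst phi_left) (auto intro: A.DA_star A.S_star)
  also have "\<dots> = \<phi> x * \<phi> d"
    using assms A.DA_S by (simp add: phi_star subset_iff star_mult star_star)
  finally show ?thesis .
qed

lemmas psi_DA = masa_iso.phi_DA[OF swap]
lemmas psi_left = masa_iso.phi_left[OF swap]
lemmas psi_isproj = masa_iso.phi_isproj[OF swap]

lemma phi_surj_DA: "s \<in> B.DA \<Longrightarrow> \<exists>d\<in>A.DA. s = \<phi> d"
  by (rule bexI[of _ "\<psi> s"]) (use psi_DA B.DA_S in \<open>auto simp: subset_iff\<close>)

end

section \<open>Images of matrix units\<close>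

lemma sum_conj:
  fixes w :: "'i \<Rightarrow> 'a::cstar_algebra"
  assumes "finite G" "\<And>g g'. g \<in> G \<Longrightarrow> g' \<in> G \<Longrightarrow> g \<noteq> g' \<Longrightarrow> w g * d * star (w g') = 0"
  shows "(\<Sum>g\<in>G. w g) * d * star (\<Sum>g\<in>G. w g) = (\<Sum>g\<in>G. w g * d * star (w g))"
proof -
  have "(\<Sum>g\<in>G. w g) * d * star (\<Sum>g\<in>G. w g) = (\<Sum>g\<in>G. \<Sum>g'\<in>G. w g * d * star (w g'))"
    unfolding star_sum sum_distrib_right sum_distrib_left by (rule sum.swap)
  also have "\<dots> = (\<Sum>g\<in>G. w g * d * star (w g))"
  proof (rule sum.cong[OF refl])
    fix g assume g: "g \<in> G"
    have "(\<Sum>g'\<in>G. w g * d * star (w g')) = (\<Sum>g'\<in>G. if g' = g then w g * d * star (w g) else 0)"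
      using assms(2) g by (intro sum.cong) auto
    then show "(\<Sum>g'\<in>G. w g * d * star (w g')) = w g * d * star (w g)" using assms(1) g by simp
  qed
  finally show ?thesis .
qed

context uhf
begin

lemma isproj_conj:
  assumes x: "isproj x" and ab: "a < p n" "b < p n"
  shows "isproj (E n a b * x * E n b a)"
proof -
  have "E n a b * x * E n b a * (E n a b * x * E n b a) = E n a b * x * (E n b a * E n a b) * x * E n b a"
    by (simp add: mult.assoc)
  also have "E n b a * E n a b = E n b b" using ab by (simp add: E_mult)
  also have "E n a b * x * E n b b * x * E n b a = E n a b * (x * E n b b) * x * E n b a"
    by (simp add: mult.assoc)
  also have "x * E n b b = E n b b * x" using isproj_DA[OF x] by (intro DA_commute) auto
  also have "E n a b * (E n b b * x) * x * E n b a = (E n a b * E n b b) * (x * x) * E n b a"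
    by (simp add: mult.assoc)
  also have "\<dots> = E n a b * x * E n b a" using x ab by (simp add: isproj_def E_mult)
  finally show ?thesis using E_conj_DA isproj_DA[OF x] by (simp add: isproj_def)
qed

lemma E_cross:
  assumes "b < p n" "b' < p n" "b \<noteq> b'" "d \<in> DA"
  shows "E n a b * d * star (E n a' b') = 0"
proof -
  have "E n a b * d * star (E n a' b') = E n a b * (E n b b * d) * (E n b' b' * E n b' a')"
    using assms by (simp add: E_star E_mult flip: mult.assoc)
  also have "E n b b * d = d * E n b b" by (rule E_DA_commute[OF assms(4)])
  also have "E n a b * (d * E n b b) * (E n b' b' * E n b' a') =
      E n a b * d * (E n b b * E n b' b') * E n b' a'" by (simp add: mult.assoc)
  also have "\<dots> = 0" using assms by (simp add: E_mult)
  finally show ?thesis .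
qed

end

context masa_iso
begin

text \<open>\<open>R w u\<close>: under \<open>\<phi>\<close>, the map \<open>d \<mapsto> w d w\<^sup>*\<close> on the diagonal corresponds to \<open>s \<mapsto> u s u\<^sup>*\<close>.\<close>

definition R :: "'a \<Rightarrow> 'b \<Rightarrow> bool" where
  "R w u \<longleftrightarrow> A.nn w \<and> B.nn u \<and> (\<forall>d\<in>A.DA. w * d * star w \<in> A.DA \<and> u * \<phi> d * star u = \<phi> (w * d * star w))"

lemma R_imp_swap: "R w u \<Longrightarrow> masa_iso.R q \<beta> p \<alpha> \<psi> u w"
  unfolding masa_iso.R_def[OF swap] R_def
proof safe
  fix s assume *: "\<forall>d\<in>A.DA. w * d * star w \<in> A.DA \<and> u * \<phi> d * star u = \<phi> (w * d * star w)" and s: "s \<in> B.DA"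
  obtain d where d: "d \<in> A.DA" "s = \<phi> d" using phi_surj_DA[OF s] by blast
  then have 1: "w * d * star w \<in> A.DA" "u * s * star u = \<phi> (w * d * star w)" using * by auto
  show "u * s * star u \<in> B.DA" using 1 phi_DA by simp
  have "\<psi> s = d" using d A.DA_S by auto
  then show "w * \<psi> s * star w = \<psi> (u * s * star u)" using 1 A.DA_S by auto
qed

text \<open>Every diagonal unit on the B side is the image of some diagonal element, so both
  candidates conjugate all of them alike and \<open>nn_unique\<close> applies.\<close>

lemma R_unique_right:
  assumes "R w u" "R w u'"
  shows "u = u'"
proof (rule B.nn_unique)
  fix k b
  obtain d where d: "d \<in> A.DA" "B.E k b b = \<phi> d" using phi_surj_DA[OF B.E_DA] by blast
  then show "u * B.E k b b * star u = u' * B.E k b b * star u'" using assms by (simp add: R_def)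
qed (use assms in \<open>auto simp: R_def\<close>)

lemma R_unique_left: "R w u \<Longrightarrow> R w' u \<Longrightarrow> w = w'"
  using masa_iso.R_unique_right[OF swap R_imp_swap R_imp_swap] .

text \<open>Conjugations compose. Neither factor nor the product has to lie in S, which is what
  makes the relation more flexible than \<phi> itself.\<close>

lemma R_mult:
  assumes "R w u" "R w' u'"
  shows "R (w * w') (u * u')"
  unfolding R_def
proof (intro conjI ballI)
  show "A.nn (w * w')" "B.nn (u * u')" using assms by (auto simp: R_def intro: A.nn_mult B.nn_mult)
  fix d assume d: "d \<in> A.DA"
  have e: "w * w' * d * star (w * w') = w * (w' * d * star w') * star w"
    by (simp add: star_mult mult.assoc)
  have "w' * d * star w' \<in> A.DA" using assms d by (simp add: R_def)
  then have 2: "w * (w' * d * star w') * star w \<in> A.DA"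
    "u * \<phi> (w' * d * star w') * star u = \<phi> (w * (w' * d * star w') * star w)"
    using assms(1) by (auto simp: R_def)
  show "w * w' * d * star (w * w') \<in> A.DA" unfolding e by (rule 2)
  have "u * u' * \<phi> d * star (u * u') = u * (u' * \<phi> d * star u') * star u"
    by (simp add: star_mult mult.assoc)
  also have "u' * \<phi> d * star u' = \<phi> (w' * d * star w')" using assms(2) d by (simp add: R_def)
  finally show "u * u' * \<phi> d * star (u * u') = \<phi> (w * w' * d * star (w * w'))" unfolding e 2(2) .
qed

lemma R_isproj:
  assumes e: "A.isproj e"
  shows "R e (\<phi> e)"
  unfolding R_def
proof (intro conjI ballI)
  note h = phi_isproj[OF e]
  show "A.nn e" "B.nn (\<phi> e)" by (rule A.nn_isproj[OF e], rule B.nn_isproj[OF h])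
  fix d assume d: "d \<in> A.DA"
  have s: "star e = e" "star (\<phi> e) = \<phi> e" using A.isproj_star[OF e] B.isproj_star[OF h] by auto
  have eD: "e \<in> A.DA" by (rule A.isproj_DA[OF e])
  show "e * d * star e \<in> A.DA" unfolding s using eD d by (intro A.DA_mult)
  have "\<phi> (e * d * e) = \<phi> (e * d) * \<phi> e"
    using eD d A.DA_S A.DA_mult by (intro phi_right) auto
  also have "\<phi> (e * d) = \<phi> e * \<phi> d" using eD d A.DA_S by (intro phi_left) auto
  finally show "\<phi> e * \<phi> d * star (\<phi> e) = \<phi> (e * d * star e)" unfolding s ..
qed

text \<open>Vanishing cross terms make conjugation by a sum the sum of the conjugations.\<close>

lemma R_sum:
  assumes fin: "finite G" and R: "\<And>g. g \<in> G \<Longrightarrow> R (w g) (u g)"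
    and w0: "\<And>g g' d. g \<in> G \<Longrightarrow> g' \<in> G \<Longrightarrow> g \<noteq> g' \<Longrightarrow> d \<in> A.DA \<Longrightarrow> w g * d * star (w g') = 0"
    and u0: "\<And>g g' d. g \<in> G \<Longrightarrow> g' \<in> G \<Longrightarrow> g \<noteq> g' \<Longrightarrow> d \<in> A.DA \<Longrightarrow> u g * \<phi> d * star (u g') = 0"
  shows "R (\<Sum>g\<in>G. w g) (\<Sum>g\<in>G. u g)"
  unfolding R_def
proof (intro conjI ballI)
  show "A.nn (\<Sum>g\<in>G. w g)" "B.nn (\<Sum>g\<in>G. u g)" using R by (auto simp: R_def intro: A.nn_sum B.nn_sum)
  fix d assume d: "d \<in> A.DA"
  have 1: "(\<Sum>g\<in>G. w g) * d * star (\<Sum>g\<in>G. w g) = (\<Sum>g\<in>G. w g * d * star (w g))"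
    using w0 d by (intro sum_conj fin) auto
  have 2: "(\<Sum>g\<in>G. u g) * \<phi> d * star (\<Sum>g\<in>G. u g) = (\<Sum>g\<in>G. u g * \<phi> d * star (u g))"
    using u0 d by (intro sum_conj fin) auto
  have DA: "w g * d * star (w g) \<in> A.DA" if "g \<in> G" for g using R[OF that] d by (simp add: R_def)
  show "(\<Sum>g\<in>G. w g) * d * star (\<Sum>g\<in>G. w g) \<in> A.DA" unfolding 1 by (intro A.DA_sum DA)
  have "\<phi> (\<Sum>g\<in>G. w g * d * star (w g)) = (\<Sum>g\<in>G. \<phi> (w g * d * star (w g)))"
    using DA A.DA_S by (intro phi_sum) auto
  also have "\<dots> = (\<Sum>g\<in>G. u g * \<phi> d * star (u g))" using R d by (intro sum.cong) (auto simp: R_def)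
  finally show "(\<Sum>g\<in>G. u g) * \<phi> d * star (\<Sum>g\<in>G. u g) = \<phi> ((\<Sum>g\<in>G. w g) * d * star (\<Sum>g\<in>G. w g))"
    unfolding 1 2 ..
qed

text \<open>With f = 1 - e, the element u \<phi>(f) times its adjoint is the image of w f w* = 0, so
  it vanishes by the C*-identity.\<close>

lemma R_support:
  assumes R: "R w u" and e: "A.isproj e" and we: "w * e = w"
  shows "u * \<phi> e = u"
proof -
  let ?f = "1 - e"
  have f: "A.isproj ?f" using A.isproj_diff[OF A.isproj_one e] by simp
  have h: "B.isproj (\<phi> ?f)" using f by (rule phi_isproj)
  have "w * ?f = 0" using we by (simp add: right_diff_distrib)
  then have "u * \<phi> ?f * star u = 0" using R A.isproj_DA[OF f] by (auto simp: R_def)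
  moreover have "(u * \<phi> ?f) * star (u * \<phi> ?f) = u * (\<phi> ?f * \<phi> ?f) * star u"
    using B.isproj_star[OF h] by (simp add: star_mult mult.assoc)
  ultimately have "(u * \<phi> ?f) * star (u * \<phi> ?f) = 0" using h by (simp add: B.isproj_def)
  then have "u * \<phi> ?f = 0" by (simp add: mult_star_eq_0)
  moreover have "\<phi> ?f = 1 - \<phi> e" using A.isproj_DA[OF e] A.DA_S by (auto simp: phi_diff)
  ultimately show ?thesis by (simp add: right_diff_distrib)
qed

end

section \<open>The image of a single matrix unit\<close>

locale masa_iso_unit = masa_iso p \<alpha> S q \<beta> T \<phi> \<psi> for p \<alpha> S q \<beta> T \<phi> \<psi> +
  fixes k i j :: nat
  assumes ij: "i < p k" "j < p k" and E_S: "A.E k i j \<in> S"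
begin

abbreviation "e \<equiv> A.E k i j"

definition "v = \<phi> e"

text \<open>Plays the role of conjugation of \<open>s\<close> by \<open>v\<close>. It is computed in
  the domain, where \<open>e\<close> is known to be a partial isometry, because \<phi> is
  multiplicative only against the diagonal.\<close>

definition "th s = \<phi> (e * \<psi> s * star e)"

lemma e_conj_DA: "d \<in> A.DA \<Longrightarrow> e * d * star e \<in> A.DA" "d \<in> A.DA \<Longrightarrow> star e * d * e \<in> A.DA"
  unfolding A.E_star by (rule A.E_conj_DA, assumption)+

lemma e_move: "d \<in> A.DA \<Longrightarrow> e * d * star e * e = e * d"
proof -
  assume d: "d \<in> A.DA"
  have "e * d * star e * e = e * (d * A.E k j j)" using ij by (simp add: A.E_star mult.assoc A.E_mult)
  also have "d * A.E k j j = A.E k j j * d" by (rule A.E_DA_commute[OF d, symmetric])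
  also have "e * (A.E k j j * d) = e * d" using ij by (simp add: A.E_mult flip: mult.assoc)
  finally show ?thesis .
qed

lemma vT: "v \<in> T"
  using E_S by (auto simp: v_def)

lemma th_DA: "s \<in> B.DA \<Longrightarrow> th s \<in> B.DA"
  unfolding th_def by (intro phi_DA e_conj_DA psi_DA)

lemma psi_th: "s \<in> B.DA \<Longrightarrow> \<psi> (th s) = e * \<psi> s * star e"
  unfolding th_def using e_conj_DA psi_DA A.DA_S by (intro psi_phi) blast

lemma th_mult:
  assumes s: "s \<in> B.DA" "t \<in> B.DA"
  shows "th (s * t) = th s * th t"
proof -
  have "th s * th t = \<phi> (e * \<psi> s * star e * (e * \<psi> t * star e))"
    unfolding th_def using s e_conj_DA psi_DA A.DA_S by (intro phi_left[symmetric]) auto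
  also have "e * \<psi> s * star e * (e * \<psi> t * star e) = (e * \<psi> s * star e * e) * \<psi> t * star e"
    by (simp add: mult.assoc)
  also have "e * \<psi> s * star e * e = e * \<psi> s" by (intro e_move psi_DA s)
  also have "e * \<psi> s * \<psi> t * star e = e * (\<psi> s * \<psi> t) * star e" by (simp add: mult.assoc)
  also have "\<psi> s * \<psi> t = \<psi> (s * t)" using s B.DA_S by (intro psi_left[symmetric]) auto
  finally show ?thesis by (simp add: th_def)
qed

lemma th_isproj: "B.isproj s \<Longrightarrow> B.isproj (th s)"
  unfolding B.isproj_def using th_DA th_mult[of s s] by auto

lemma th_zero: "th 0 = 0"
  by (simp add: th_def)

lemma th_sum:
  assumes "\<And>a. a \<in> I \<Longrightarrow> f a \<in> B.DA"
  shows "th (\<Sum>a\<in>I. scaleC (z a) (f a)) = (\<Sum>a\<in>I. scaleC (z a) (th (f a)))"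
proof -
  have fT: "f a \<in> T" if "a \<in> I" for a using assms that B.DA_S by blast
  have fS: "e * \<psi> (f a) * star e \<in> S" if "a \<in> I" for a
    using assms[OF that] e_conj_DA psi_DA A.DA_S by blast
  have "\<psi> (\<Sum>a\<in>I. scaleC (z a) (f a)) = (\<Sum>a\<in>I. scaleC (z a) (\<psi> (f a)))"
    using fT by (subst psi_sum) (auto simp: psi_scale intro: B.S_scale)
  then have "e * \<psi> (\<Sum>a\<in>I. scaleC (z a) (f a)) * star e = (\<Sum>a\<in>I. scaleC (z a) (e * \<psi> (f a) * star e))"
    by (simp add: sum_distrib_left sum_distrib_right scaleC_mult_left scaleC_mult_right)
  then show ?thesis unfolding th_def using fS by (simp add: phi_sum phi_scale A.S_scale)
qed

lemma v_mult: "s \<in> B.DA \<Longrightarrow> v * s = \<phi> (e * \<psi> s)"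
  using phi_right[OF psi_DA E_S, of s] B.DA_S by (auto simp: v_def)

lemma v_move: "s \<in> B.DA \<Longrightarrow> v * s = th s * v"
proof -
  assume s: "s \<in> B.DA"
  have "v * s = \<phi> (e * \<psi> s * star e * e)" using s by (simp add: v_mult e_move psi_DA)
  also have "\<dots> = th s * v" unfolding th_def v_def
    using s e_conj_DA psi_DA E_S by (intro phi_left) auto
  finally show ?thesis .
qed

lemma v_mult_eq_0:
  assumes "s \<in> B.DA" "v * s = 0"
  shows "th s = 0"
proof -
  have "e * \<psi> s \<in> S" using assms E_S by (intro A.S_right psi_DA)
  then have "e * \<psi> s = 0" using phi_norm[of "e * \<psi> s"] v_mult[OF assms(1)] assms(2) by simp
  then show ?thesis by (simp add: th_def)
qed

text \<open>A gap: such a compression is the isometric image of P e for a diagonal projection P, and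
  (P e)(P e)* is again a projection. Compressions of small norm therefore vanish.\<close>

lemma norm_compress_v:
  assumes "B.isproj t" "B.isproj s"
  shows "norm (t * v * s) = 0 \<or> norm (t * v * s) = 1"
proof -
  define P where "P = \<psi> t * (e * \<psi> s * star e)"
  note pt = psi_isproj[OF assms(1)] and ps = psi_isproj[OF assms(2)]
  have DA: "\<psi> t \<in> A.DA" "\<psi> s \<in> A.DA" using pt ps by (auto intro: A.isproj_DA)
  have P: "A.isproj P" unfolding P_def A.E_star
    by (intro A.isproj_mult pt A.isproj_conj ps ij)
  have Pe: "P * e = \<psi> t * e * \<psi> s" unfolding P_def using e_move[OF DA(2)] by (simp add: mult.assoc)
  have "t * v * s = t * \<phi> (e * \<psi> s)" using assms by (simp add: v_mult B.isproj_DA mult.assoc)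
  also have "\<dots> = \<phi> (\<psi> t) * \<phi> (e * \<psi> s)" using B.isproj_DA[OF assms(1)] B.DA_S by auto
  also have "\<phi> (\<psi> t) * \<phi> (e * \<psi> s) = \<phi> (\<psi> t * (e * \<psi> s))"
    using DA E_S by (intro phi_left[symmetric] A.S_right) auto
  also have "norm \<dots> = norm (\<psi> t * (e * \<psi> s))"
    using DA E_S by (intro phi_norm A.S_left A.S_right)
  also have "\<psi> t * (e * \<psi> s) = P * e" by (simp add: Pe mult.assoc)
  finally have n: "norm (t * v * s) = norm (P * e)" .
  have "(P * e) * star (P * e) = P * A.E k i i * P"
    using A.isproj_star[OF P] ij by (simp add: star_mult A.E_star mult.assoc) (simp add: A.E_mult flip: mult.assoc)
  moreover have "A.isproj (P * A.E k i i * P)" using ij by (intro A.isproj_mult P A.isproj_E)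
  ultimately have "norm ((P * e) * star (P * e)) = 0 \<or> norm ((P * e) * star (P * e)) = 1"
    using A.isproj_norm_cases by metis
  moreover have "norm ((P * e) * star (P * e)) = (norm (P * e))\<^sup>2"
    using norm_star_mult[of "star (P * e)"] by (simp add: star_star)
  ultimately show ?thesis unfolding n by (auto simp: power2_eq_1_iff)
      (metis norm_ge_zero not_one_le_zero neg_0_le_iff_le)
qed

text \<open>Why 1/3: an entry of modulus above 1/3 exceeds the distance from \<open>v\<close> to its
  approximant, so its unit is really present in \<open>v\<close>. An entry of modulus at most 1/3
  leaves a compression of norm below 2/3, which is zero by the gap in
  \<open>norm_compress_v\<close>.\<close>

context
  fixes n :: nat and c :: "nat \<Rightarrow> nat \<Rightarrow> complex" and a b :: nat
  assumes close: "norm (v - B.el n c) < 1 / 3" and ab: "a < q n" "b < q n" and big: "1 / 3 < cmod (c a b)"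
begin

lemma unit_T: "B.E n a b \<in> T"
proof (rule B.E_in_S[OF vT ab])
  have "B.E n a a * v * B.E n b b - scaleC (c a b) (B.E n a b) = B.E n a a * (v - B.el n c) * B.E n b b"
    by (simp add: algebra_simps B.E_el_E[OF ab, symmetric])
  also have "norm \<dots> \<le> norm (v - B.el n c)" by (rule B.norm_compress_le[OF ab])
  finally show "norm (B.E n a a * v * B.E n b b - scaleC (c a b) (B.E n a b)) < cmod (c a b)"
    using close big by simp
qed

abbreviation "f \<equiv> B.E n a b"
abbreviation "g \<equiv> B.E n b a"
abbreviation "fa \<equiv> B.E n a a"
abbreviation "fb \<equiv> B.E n b b"

lemma fg: "f * g = fa" "g * f = fb" "f * fb = f" "fb * g = g" "fa * f = f" "g * fa = g" "fa * fa = fa" "fb * fb = fb"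
  using ab by (auto simp: B.E_mult)

lemma K_mult:
  assumes "fb * r = r"
  shows "f * s * g * (f * r * g) = f * (s * r) * g"
proof -
  have "f * s * g * (f * r * g) = f * s * ((g * f) * r) * g" by (simp add: mult.assoc)
  then show ?thesis using assms by (simp add: fg mult.assoc)
qed

lemma K_cancel: "fb * r = r \<Longrightarrow> r * fb = r \<Longrightarrow> g * (f * r * g) * f = r"
proof -
  assume r: "fb * r = r" "r * fb = r"
  have "g * (f * r * g) * f = (g * f) * r * (g * f)" by (simp add: mult.assoc)
  then show ?thesis using r by (simp add: fg)
qed

text \<open>Otherwise \<open>K = f * r * g\<close> satisfies K v r = K th(r) v = 0, whereas the
  approximant gives K (el n c) r = c a b f r, of norm above 1/3. This contradicts the distance from
  \<open>v\<close>.\<close>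

lemma unit_nonzero:
  assumes r: "B.isproj r" "fb * r = r" "r \<noteq> 0"
  shows "f * r * g * th r \<noteq> 0"
proof
  assume 0: "f * r * g * th r = 0"
  let ?K = "f * r * g"
  have rDA: "r \<in> B.DA" and rr: "r * r = r" using r(1) by (auto simp: B.isproj_def)
  have rfb: "r * fb = r" using B.E_DA_commute[OF rDA] r(2) by metis
  have "?K * v * r = ?K * (th r * v)" by (simp add: v_move[OF rDA] mult.assoc)
  also have "\<dots> = 0" using 0 by (simp flip: mult.assoc)
  finally have Kv: "?K * v * r = 0" .
  have "g * B.el n c * fb = (g * fa) * B.el n c * fb" by (simp add: fg)
  also have "\<dots> = g * (fa * B.el n c * fb)" by (simp add: mult.assoc)
  also have "\<dots> = scaleC (c a b) fb" by (simp add: B.E_el_E[OF ab] scaleC_mult_right fg)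
  finally have gyf: "g * B.el n c * fb = scaleC (c a b) fb" .
  have "?K * B.el n c * r = f * r * (g * B.el n c * fb) * r"
    using r(2) by (simp add: mult.assoc)
  also have "\<dots> = f * r * scaleC (c a b) fb * r" by (simp only: gyf)
  also have "\<dots> = scaleC (c a b) (f * (r * (fb * r)))"
    by (simp add: scaleC_mult_left scaleC_mult_right mult.assoc)
  also have "\<dots> = scaleC (c a b) (f * r)" by (simp only: r(2) rr)
  finally have Ky: "?K * B.el n c * r = scaleC (c a b) (f * r)" .
  have "star (f * r) * (f * r) = r * (g * f) * r"
    using B.isproj_star[OF r(1)] by (simp add: star_mult B.E_star mult.assoc)
  then have "star (f * r) * (f * r) = r" using rr rfb by (simp add: fg)
  then have "(norm (f * r))\<^sup>2 = norm r" using norm_star_mult[of "f * r"] by simp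
  moreover have "norm r = 1" using B.isproj_norm_cases[OF r(1)] r(3) by auto
  ultimately have "norm (f * r) = 1" by (simp add: power2_eq_1_iff) (smt (verit) norm_ge_zero)
  then have "cmod (c a b) = norm (?K * B.el n c * r - ?K * v * r)"
    unfolding Kv Ky by (simp add: norm_scaleC)
  also have "?K * B.el n c * r - ?K * v * r = ?K * (B.el n c - v) * r" by (simp add: algebra_simps)
  also have "norm \<dots> \<le> norm (?K * (B.el n c - v)) * norm r" by (rule norm_mult_ineq)
  also have "\<dots> \<le> norm ?K * norm (B.el n c - v) * norm r" by (intro mult_right_mono norm_mult_ineq) auto
  also have "\<dots> \<le> 1 * norm (B.el n c - v) * 1"
    by (intro mult_mono B.isproj_norm r B.isproj_conj ab) auto
  finally show False using close big by (simp add: norm_minus_commute)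
qed

text \<open>The part \<open>s'\<close> of \<open>f * r * g\<close> not under \<open>th r\<close> is
  carried back by \<open>f\<close> to a projection s \<le> r. Then th s \<le> th r is orthogonal to
  \<open>s' = f * s * g\<close>, and \<open>unit_nonzero\<close> forces s = 0.\<close>

lemma unit_le:
  assumes r: "B.isproj r" "fb * r = r"
  shows "f * r * g * th r = f * r * g"
proof -
  let ?K = "f * r * g"
  note Kp = B.isproj_conj[OF r(1) ab] and tp = th_isproj[OF r(1)]
  have rDA: "r \<in> B.DA" by (rule B.isproj_DA[OF r(1)])
  have rfb: "r * fb = r" using B.E_DA_commute[OF rDA] r(2) by metis
  have KK: "?K * ?K = ?K" and tt: "th r * th r = th r" using Kp tp by (auto simp: B.isproj_def)
  have com: "th r * ?K = ?K * th r" using B.isproj_DA[OF Kp] B.isproj_DA[OF tp] by (rule B.DA_commute[symmetric])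
  have "?K * (?K * th r) = (?K * ?K) * th r" by (rule mult.assoc[symmetric])
  then have "?K * (?K * th r) = ?K * th r" by (simp only: KK)
  then have sp: "B.isproj (?K - ?K * th r)" by (intro B.isproj_diff Kp B.isproj_mult tp)
  define s' where "s' = ?K - ?K * th r"
  define s where "s = g * s' * f"
  have s'p: "B.isproj s'" using sp by (simp add: s'_def)
  have s_p: "B.isproj s" unfolding s_def by (rule B.isproj_conj[OF s'p ab(2,1)])
  have fbs: "fb * s = s" by (simp add: s_def fg flip: mult.assoc)
  have fas': "fa * s' = s'" unfolding s'_def by (simp add: fg right_diff_distrib flip: mult.assoc)
  then have s'fa: "s' * fa = s'" using B.E_DA_commute[OF B.isproj_DA[OF s'p], of n a] by simp
  have Ks: "f * s * g = s'"
  proof -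
    have "f * s * g = fa * s' * fa" unfolding s_def fg(1)[symmetric] by (simp add: mult.assoc)
    then show ?thesis by (simp add: fas' s'fa)
  qed
  have s'K: "s' * ?K = s'"
  proof -
    have "s' * ?K = ?K * ?K - ?K * (th r * ?K)" by (simp add: s'_def left_diff_distrib mult.assoc)
    also have "?K * (th r * ?K) = ?K * ?K * th r" unfolding com by (rule mult.assoc[symmetric])
    finally show ?thesis by (simp only: KK s'_def)
  qed
  have s't: "s' * th r = 0"
  proof -
    have "s' * th r = ?K * th r - ?K * (th r * th r)" by (simp add: s'_def left_diff_distrib mult.assoc)
    then show ?thesis by (simp add: tt)
  qed
  have sr: "s * r = s"
  proof -
    have "s * r = g * s' * (f * (r * fb))" by (simp add: s_def rfb mult.assoc)
    also have "\<dots> = g * (s' * ?K) * f" unfolding fg(2)[symmetric] by (simp add: mult.assoc)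
    also have "\<dots> = s" by (simp only: s'K s_def)
    finally show ?thesis .
  qed
  have "th s = th (r * s)" using sr B.DA_commute[OF rDA B.isproj_DA[OF s_p]] by simp
  also have "\<dots> = th r * th s" by (rule th_mult[OF rDA B.isproj_DA[OF s_p]])
  finally have "s' * th s = s' * th r * th s" by (metis mult.assoc)
  then have "f * s * g * th s = 0" by (simp add: Ks s't)
  then have "s = 0" using unit_nonzero[OF s_p fbs] by blast
  then have "s' = 0" using Ks by simp
  then show ?thesis by (simp add: s'_def)
qed

text \<open>For the inequality opposite to \<open>unit_le\<close>, the part \<open>t\<close> of
  \<open>th r\<close> not under \<open>f * r * g\<close> has the form \<open>th z\<close> with z
  \<le> r. By \<open>unit_le\<close>, \<open>f * z * g\<close> lies under \<open>t\<close>; it also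
  lies under \<open>f * r * g\<close>, which is orthogonal to \<open>t\<close>. Hence it vanishes,
  and so does z.\<close>

lemma th_unit:
  assumes r: "B.isproj r" "fb * r = r"
  shows "th r = f * r * g"
proof -
  let ?K = "f * r * g"
  note Kp = B.isproj_conj[OF r(1) ab] and tp = th_isproj[OF r(1)]
  have rDA: "r \<in> B.DA" by (rule B.isproj_DA[OF r(1)])
  have com: "th r * ?K = ?K * th r" using B.isproj_DA[OF Kp] B.isproj_DA[OF tp] by (rule B.DA_commute[symmetric])
  define t where "t = th r - th r * ?K"
  have "th r * (th r * ?K) = th r * ?K" using tp by (simp add: B.isproj_def flip: mult.assoc)
  then have t_p: "B.isproj t" unfolding t_def by (intro B.isproj_diff tp B.isproj_mult Kp)
  have tDA: "t \<in> B.DA" by (rule B.isproj_DA[OF t_p])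
  have ptDA: "\<psi> t \<in> A.DA" and prDA: "\<psi> r \<in> A.DA" using tDA rDA by (auto intro: psi_DA)
  \<comment> \<open>Conjugation by \<open>star e\<close> inverts \<open>th\<close> on
    \<open>t\<close>, because \<psi>(t) lies under the range projection of \<open>e\<close>.\<close>
  define z where "z = \<phi> (star e * \<psi> t * e)"
  have psz: "\<psi> z = star e * \<psi> t * e" unfolding z_def using e_conj_DA(2)[OF ptDA] A.DA_S by auto
  have zp: "B.isproj z" unfolding z_def
    by (rule phi_isproj) (simp add: A.E_star A.isproj_conj[OF psi_isproj[OF t_p] ij(2,1)])
  have Et: "A.E k i i * \<psi> t = \<psi> t"
  proof -
    have "t = th r * (1 - ?K)" by (simp add: t_def right_diff_distrib)
    then have "\<psi> t = \<psi> (th r) * \<psi> (1 - ?K)"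
      using th_DA[OF rDA] B.DA_S by (metis B.DA_diff B.isproj_DA B.one_DA Kp psi_left subset_iff)
    moreover have "A.E k i i * \<psi> (th r) = \<psi> (th r)"
      unfolding psi_th[OF rDA] using ij by (simp add: A.E_mult flip: mult.assoc)
    ultimately show ?thesis by (simp flip: mult.assoc)
  qed
  have thz: "th z = t"
  proof -
    have "e * \<psi> z * star e = (e * star e) * \<psi> t * (e * star e)" by (simp add: psz mult.assoc)
    also have "e * star e = A.E k i i" using ij by (simp add: A.E_star A.E_mult)
    also have "A.E k i i * \<psi> t * A.E k i i = \<psi> t" using Et A.E_DA_commute[OF ptDA, of k i] by simp
    finally show ?thesis using tDA B.DA_S by (auto simp: th_def)
  qed
  have zr: "z * r = z"
  proof -
    have "e * \<psi> r = \<psi> (th r) * e" by (simp add: psi_th[OF rDA] e_move[OF prDA])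
    then have "star e * \<psi> t * e * \<psi> r = star e * (\<psi> t * \<psi> (th r)) * e" by (simp add: mult.assoc)
    also have "\<psi> t * \<psi> (th r) = \<psi> (t * th r)"
      using tDA th_DA[OF rDA] B.DA_S by (intro psi_left[symmetric]) auto
    also have "t * th r = t"
    proof -
      have "t * th r = th r * th r - th r * (?K * th r)" by (simp add: t_def left_diff_distrib mult.assoc)
      also have "th r * (?K * th r) = th r * th r * ?K"
        unfolding com[symmetric] by (rule mult.assoc[symmetric])
      also have "th r * th r - th r * th r * ?K = t" using tp by (simp add: B.isproj_def t_def)
      finally show ?thesis .
    qed
    finally have "star e * \<psi> t * e * \<psi> r = star e * \<psi> t * e" .
    moreover have "z * r = \<phi> (star e * \<psi> t * e * \<psi> r)"
    proof -
      have "star e * \<psi> t * e \<in> S" using e_conj_DA(2)[OF ptDA] A.DA_S by blast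
      moreover have "\<phi> (\<psi> r) = r" using rDA B.DA_S by auto
      ultimately show ?thesis by (simp add: z_def phi_right[OF prDA])
    qed
    ultimately show ?thesis by (simp add: z_def)
  qed
  have zDA: "z \<in> B.DA" by (rule B.isproj_DA[OF zp])
  have rz: "r * z = z" using zr B.DA_commute[OF rDA zDA] by simp
  have fbz: "fb * z = z"
  proof -
    have "fb * (r * z) = r * z" using r(2) by (simp flip: mult.assoc)
    then show ?thesis by (simp add: rz)
  qed
  have fzgt: "f * z * g * t = f * z * g" using unit_le[OF zp fbz] thz by simp
  have fzgK: "f * z * g * ?K = f * z * g" using K_mult[OF r(2), of z] by (simp add: zr)
  have "?K * t = ?K * th r - (?K * th r) * ?K" by (simp add: t_def right_diff_distrib mult.assoc)
  then have Kt: "?K * t = 0" using Kp by (simp add: unit_le[OF r] B.isproj_def)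
  have "f * z * g = f * z * g * ?K * t" by (simp only: fzgt fzgK)
  also have "\<dots> = f * z * g * (?K * t)" by (rule mult.assoc)
  finally have fzg: "f * z * g = 0" by (simp only: Kt mult_zero_right)
  have zfb: "z * fb = z" using B.E_DA_commute[OF zDA] fbz by metis
  have "z = 0" using K_cancel[OF fbz zfb] by (simp add: fzg)
  then have "t = 0" using thz th_zero by simp
  then show ?thesis using com unit_le[OF r] by (simp add: t_def)
qed

text \<open>Linear extension of \<open>th_unit\<close>; the factor \<open>fb\<close> cuts every
  projection in the expansion of \<open>d\<close> to the source of the unit.\<close>

lemma th_unit_DA:
  assumes "d \<in> B.DA"
  shows "th (fb * d) = f * d * g"
proof -
  obtain M \<delta> where M: "d = B.dg M \<delta>" using assms by (auto simp: B.DA_def)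
  have "fb * d = (\<Sum>x<q M. scaleC (\<delta> x) (fb * B.E M x x))"
    unfolding M B.dg_expand by (simp add: sum_distrib_left scaleC_mult_right)
  then have "th (fb * d) = (\<Sum>x<q M. scaleC (\<delta> x) (th (fb * B.E M x x)))"
    by (simp add: th_sum B.DA_mult B.E_DA)
  also have "\<dots> = (\<Sum>x<q M. scaleC (\<delta> x) (f * B.E M x x * g))"
  proof (intro sum.cong refl)
    fix x assume x: "x \<in> {..<q M}"
    have "th (fb * B.E M x x) = f * (fb * B.E M x x) * g"
      using x ab by (intro th_unit B.isproj_mult B.isproj_E) (auto simp: fg simp flip: mult.assoc)
    then show "scaleC (\<delta> x) (th (fb * B.E M x x)) = scaleC (\<delta> x) (f * B.E M x x * g)"
      by (simp add: fg flip: mult.assoc)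
  qed
  also have "\<dots> = f * d * g"
    unfolding M B.dg_expand by (simp add: sum_distrib_left sum_distrib_right scaleC_mult_left scaleC_mult_right)
  finally show ?thesis .
qed

end

text \<open>
  The partial isometry \<open>v = \<phi> e\<close> need not lie in any \<open>B\<^sub>n\<close>, but it normalises the diagonal, and the
  matrix units \<open>B.E n a b\<close> on which it is not small implement the same partial automorphism of the
  diagonal. Their sum replaces \<open>v\<close>.
\<close>

lemma unit_image:
  "\<exists>N. \<forall>n\<ge>N. \<exists>G\<subseteq>{..<q n} \<times> {..<q n}. (\<forall>(a, b)\<in>G. B.E n a b \<in> T) \<and> inj_on snd G \<and>
     R e (\<Sum>(a, b)\<in>G. B.E n a b)"
proof -
  obtain N c0 where N: "norm (v - B.el N c0) < 1 / 3" using B.dense[of 0 v, rule_format, of "1 / 3"] by auto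
  show ?thesis
  proof (intro exI[of _ N] allI impI)
    fix n assume n: "N \<le> n"
    define c where "c = blk (q N) c0"
    have close: "norm (v - B.el n c) < 1 / 3" using N B.el_up[OF n] by (simp add: c_def)
    define G where "G = {(a, b). a < q n \<and> b < q n \<and> 1 / 3 < cmod (c a b)}"
    have GD: "a < q n" "b < q n" "1 / 3 < cmod (c a b)" if "(a, b) \<in> G" for a b using that by (auto simp: G_def)
    have Gsub: "G \<subseteq> {..<q n} \<times> {..<q n}" by (auto simp: G_def)
    have finG: "finite G" by (rule finite_subset[OF Gsub]) auto
    note th_G = th_unit_DA[OF close GD]
    have th_E: "th (B.E n b b) = B.E n a a" if "(a, b) \<in> G" for a b
      using th_G[OF that that that, of "B.E n b b"] GD[OF that] by (simp add: B.E_DA B.E_mult)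
    have E_ne: "B.E n a a \<noteq> B.E n a' a'" if "a < q n" "a \<noteq> a'" for a a'
      using B.el_inj[of n "\<lambda>i j. if i = a \<and> j = a then 1 else 0" "\<lambda>i j. if i = a' \<and> j = a' then 1 else 0" a a] that
      by (auto simp: B.E_def)
    \<comment> \<open>Two large entries in one column would give \<open>th\<close> two different
      values at the same diagonal unit.\<close>
    have inj: "inj_on snd G"
    proof (rule inj_onI)
      fix x y assume xy: "x \<in> G" "y \<in> G" "snd x = snd y"
      then have "B.E n (fst x) (fst x) = B.E n (fst y) (fst y)"
        using th_E[of "fst x" "snd x"] th_E[of "fst y" "snd y"] by (metis prod.collapse)
      moreover have "fst x < q n" using GD(1)[of "fst x" "snd x"] xy(1) by simp
      ultimately have "fst x = fst y" using E_ne[of "fst x" "fst y"] by blast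
      then show "x = y" using xy by (simp add: prod_eq_iff)
    qed
    define u where "u = (\<Sum>(a, b)\<in>G. B.E n a b)"
    \<comment> \<open>In a column without large entries all compressions of \<open>v\<close> have
      norm below 1, hence vanish, so \<open>v\<close> kills the column and \<open>th\<close>
      vanishes on it.\<close>
    have small: "th (B.E n b b) = 0" if b: "b < q n" "b \<notin> snd ` G" for b
    proof (rule v_mult_eq_0)
      have "B.E n a a * v * B.E n b b = 0" if a: "a < q n" for a
      proof -
        have "(a, b) \<notin> G" using b(2) by force
        then have le: "cmod (c a b) \<le> 1 / 3" using a b by (auto simp: G_def)
        have "B.E n a b * star (B.E n a b) = B.E n a a" using a b by (simp add: B.E_star B.E_mult)
        then have "(norm (B.E n a b))\<^sup>2 \<le> 1\<^sup>2"
          using norm_star_mult[of "star (B.E n a b)"] B.norm_E_le[OF a] by (simp add: star_star)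
        then have nE: "norm (B.E n a b) \<le> 1" by (rule power2_le_imp_le) simp
        have "B.E n a a * v * B.E n b b = scaleC (c a b) (B.E n a b) + B.E n a a * (v - B.el n c) * B.E n b b"
          using B.E_el_E[OF a b(1), of c] by (simp add: algebra_simps)
        then have "norm (B.E n a a * v * B.E n b b) \<le> norm (scaleC (c a b) (B.E n a b)) + norm (B.E n a a * (v - B.el n c) * B.E n b b)"
          by (metis norm_triangle_ineq)
        also have "norm (scaleC (c a b) (B.E n a b)) \<le> 1 / 3 * 1"
          unfolding norm_scaleC using le nE by (intro mult_mono) auto
        also have "norm (B.E n a a * (v - B.el n c) * B.E n b b) \<le> norm (v - B.el n c)"
          by (rule B.norm_compress_le[OF a b(1)])
        finally have "norm (B.E n a a * v * B.E n b b) < 1" using close by simp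
        then show ?thesis using norm_compress_v[OF B.isproj_E[OF a] B.isproj_E[OF b(1)]] by auto
      qed
      then have "(\<Sum>a<q n. B.E n a a) * v * B.E n b b = 0"
        by (simp add: sum_distrib_right)
      then show "v * B.E n b b = 0" by (simp flip: B.one_expand)
    qed (rule B.E_DA)
    have "R e u"
      unfolding R_def
    proof (intro conjI ballI)
      show "A.nn e" by (rule A.nn_E)
      show "B.nn u" unfolding u_def by (intro B.nn_sum) (auto intro: B.nn_E)
      fix d assume d: "d \<in> A.DA"
      show "e * d * star e \<in> A.DA" by (rule e_conj_DA[OF d])
      define s where "s = \<phi> d"
      have s: "s \<in> B.DA" "\<psi> s = d" using d phi_DA A.DA_S by (auto simp: s_def)
      have "u * s * star u = (\<Sum>x\<in>G. (case x of (a, b) \<Rightarrow> B.E n a b) * s * star (case x of (a, b) \<Rightarrow> B.E n a b))"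
        unfolding u_def
      proof (intro sum_conj finG)
        fix x y assume xy: "x \<in> G" "y \<in> G" "x \<noteq> y"
        obtain a b a' b' where [simp]: "x = (a, b)" "y = (a', b')" by (metis surj_pair)
        have bb: "b \<noteq> b'" using inj_onD[OF inj _ xy(1,2)] xy(3) by auto
        have "b < q n" "b' < q n" using GD xy by auto
        then have "B.E n a b * s * star (B.E n a' b') = 0" using bb s(1) by (intro B.E_cross)
        then show "(case x of (a, b) \<Rightarrow> B.E n a b) * s * star (case y of (a, b) \<Rightarrow> B.E n a b) = 0" by simp
      qed
      \<comment> \<open>Each unit of \<open>G\<close> conjugates \<open>s\<close> to
        \<open>th\<close> of the part of \<open>s\<close> in its column; columns outside
        \<open>G\<close> contribute 0, so all columns may be summed.\<close>
      also have "\<dots> = (\<Sum>x\<in>G. th (B.E n (snd x) (snd x) * s))"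
        using th_G s(1) by (intro sum.cong) (auto simp: B.E_star)
      also have "\<dots> = (\<Sum>b\<in>snd ` G. th (B.E n b b * s))"
        using inj by (simp add: sum.reindex)
      also have "\<dots> = (\<Sum>b<q n. th (B.E n b b * s))"
      proof (intro sum.mono_neutral_left ballI)
        fix b assume "b \<in> {..<q n} - snd ` G"
        then have "th (B.E n b b) = 0" by (intro small) auto
        then show "th (B.E n b b * s) = 0" using th_mult[OF B.E_DA s(1)] by simp
      qed (use Gsub in auto)
      also have "\<dots> = th ((\<Sum>b<q n. B.E n b b) * s)"
        using th_sum[of "{..<q n}" "\<lambda>b. B.E n b b * s" "\<lambda>b. 1"] s(1)
        by (simp add: sum_distrib_right B.DA_mult B.E_DA)
      also have "\<dots> = \<phi> (e * d * star e)" by (simp add: th_def s(2) flip: B.one_expand)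
      finally show "u * \<phi> d * star u = \<phi> (e * d * star e)" by (simp add: s_def)
    qed
    moreover have "\<forall>(a, b)\<in>G. B.E n a b \<in> T" using unit_T[OF close GD] by auto
    ultimately show "\<exists>G\<subseteq>{..<q n} \<times> {..<q n}. (\<forall>(a, b)\<in>G. B.E n a b \<in> T) \<and> inj_on snd G \<and>
        R e (\<Sum>(a, b)\<in>G. B.E n a b)"
      using Gsub inj unfolding u_def by blast
  qed
qed

end

section \<open>The maps between sections\<close>

lemma subspace_sum:
  assumes "complex_subspace X" "\<And>a. a \<in> I \<Longrightarrow> f a \<in> X"
  shows "(\<Sum>a\<in>I. f a) \<in> X"
  using assms(2) assms(1)
  by (induction I rule: infinite_finite_induct) (auto simp: complex_subspace_def)

lemma subspace_scale: "complex_subspace X \<Longrightarrow> x \<in> X \<Longrightarrow> scaleC c x \<in> X"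
  by (simp add: complex_subspace_def)

context uhf
begin

lemma el_subspace: "complex_subspace (range (el k))"
  unfolding complex_subspace_def
proof (intro conjI ballI allI)
  show "0 \<in> range (el k)" by (simp flip: el_zero[of k])
qed (auto simp: el_add el_scale)

lemma dg_subspace: "complex_subspace (range (dg k))"
  unfolding complex_subspace_def
proof (intro conjI ballI allI)
  show "0 \<in> range (dg k)" by (simp flip: dg_zero[of k])
qed (auto simp: dg_add dg_scale)

lemma E_level [intro]: "E k i j \<in> range (el k)"
  by (auto simp: E_def)

lemma dg_level: "range (dg k) \<subseteq> range (el k)"
  by (auto simp: dg_def)

lemma form_sum:
  "ip F u (app F (ent (\<Sum>a\<in>I. scaleC (z a) (y a))) v) = (\<Sum>a\<in>I. z a * ip F u (app F (ent (y a)) v))"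
proof -
  have "app F (ent (\<Sum>a\<in>I. scaleC (z a) (y a))) v = (\<lambda>x. \<Sum>a\<in>I. z a * app F (ent (y a)) v x)"
  proof
    fix x
    have "app F (ent (\<Sum>a\<in>I. scaleC (z a) (y a))) v x = (\<Sum>b\<in>F. \<Sum>a\<in>I. z a * (ent (y a) x b * v b))"
      by (simp add: app_def ent_sum ent_scale sum_distrib_right mult.assoc)
    also have "\<dots> = (\<Sum>a\<in>I. \<Sum>b\<in>F. z a * (ent (y a) x b * v b))" by (rule sum.swap)
    finally show "app F (ent (\<Sum>a\<in>I. scaleC (z a) (y a))) v x = (\<Sum>a\<in>I. z a * app F (ent (y a)) v x)"
      by (simp add: app_def sum_distrib_left)
  qed
  then have "ip F u (app F (ent (\<Sum>a\<in>I. scaleC (z a) (y a))) v)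
      = (\<Sum>x\<in>F. \<Sum>a\<in>I. z a * (cnj (u x) * app F (ent (y a)) v x))"
    by (simp add: ip_def sum_distrib_left mult.left_commute)
  also have "\<dots> = (\<Sum>a\<in>I. \<Sum>x\<in>F. z a * (cnj (u x) * app F (ent (y a)) v x))" by (rule sum.swap)
  finally show ?thesis by (simp add: ip_def sum_distrib_left)
qed

lemma form_mult_star:
  assumes "w \<in> range (el K)" "w' \<in> range (el K)"
  shows "ip (pset K) u (app (pset K) (ent (w * star w')) v) =
    (\<Sum>l<p K. cnj (app (pset K) (\<lambda>a b. cnj (ent w b a)) u l) * app (pset K) (\<lambda>a b. cnj (ent w' b a)) v l)"
proof -
  have s: "star w' \<in> range (el K)" using assms(2) by (auto simp: el_star)
  have "ip (pset K) u (app (pset K) (ent (w * star w')) v) =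
      ip (pset K) u (app (pset K) (ent w) (app (pset K) (\<lambda>a b. cnj (ent w' b a)) v))"
    unfolding app_comp using ent_mult_level[OF assms(1) s]
    by (intro ip_cong app_cong refl) (auto simp: ent_star)
  also have "\<dots> = ip (pset K) (app (pset K) (\<lambda>a b. cnj (ent w b a)) u) (app (pset K) (\<lambda>a b. cnj (ent w' b a)) v)"
    by (rule ip_adj)
  finally show ?thesis by (simp add: ip_def)
qed

lemma form_idx:
  "ip (idx n K) \<xi> (app (idx n K) (MF x) \<xi>) =
     (\<Sum>s<n. \<Sum>t<n. ip (pset K) (\<lambda>i. \<xi> (s, i)) (app (pset K) (ent (x s t)) (\<lambda>i. \<xi> (t, i))))"
proof -
  have "ip (pset K) u (\<lambda>i. \<Sum>t<n. g t i) = (\<Sum>t<n. ip (pset K) u (g t))" for u g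
    unfolding ip_def sum_distrib_left by (rule sum.swap)
  then show ?thesis unfolding ip_idx app_idx by simp
qed

lemma ent_E: "a < p n \<Longrightarrow> b < p n \<Longrightarrow> ent (E n i j) a b = (if a = i \<and> b = j then 1 else 0)"
  by (simp add: E_def ent_el)

end

context uhf_system
begin

definition sec :: "nat \<Rightarrow> 'a set" where "sec k = S \<inter> range (el k)"

lemma section_eq: "uhf_section p h S k = sec k"
  by (simp add: uhf_section_def level_eq sec_def)

lemma sec_subspace: "complex_subspace (sec k)"
  using el_subspace[of k] S_zero S_add S_scale by (auto simp: complex_subspace_def sec_def)

lemma one_sec [simp]: "1 \<in> sec k"
  using dg_one[of k] dg_level[of k] by (auto simp: sec_def)

lemma star_sec: "x \<in> sec k \<Longrightarrow> star x \<in> sec k"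
  using S_star by (auto simp: sec_def el_star)

lemma sec_mono: "k \<le> l \<Longrightarrow> sec k \<subseteq> sec l"
  using level_mono[of k l] by (simp add: sec_def) blast

lemma sec_unit: "x \<in> sec k \<Longrightarrow> i < p k \<Longrightarrow> j < p k \<Longrightarrow> ent x i j \<noteq> 0 \<Longrightarrow> E k i j \<in> S"
  using E_in_S_level[of k "ent x"] el_ent[of x k] by (simp add: sec_def)

end

context masa_iso
begin

section \<open>Sums of partners of matrix units as maps between sections\<close>

definition U :: "'a \<Rightarrow> 'b" where "U w = (THE u. R w u)"

lemma U_eq: "R w u \<Longrightarrow> U w = u"
  unfolding U_def using R_unique_right by blast

text \<open>On \<open>A.sec m\<close> nonzero coefficients occur only at units in S
  (\<open>sec_unit\<close>), and these have partners. The unspecified value of \<open>U\<close>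
  elsewhere is then multiplied by 0.\<close>

definition Phi :: "nat \<Rightarrow> 'a \<Rightarrow> 'b" where
  "Phi m x = (\<Sum>i<p m. \<Sum>j<p m. scaleC (A.ent x i j) (U (A.E m i j)))"

text \<open>Level \<open>n\<close> resolves the partners of all units of level \<open>m\<close> into
  matrix units of T, and contains the images of the diagonal units.\<close>

definition good :: "nat \<Rightarrow> nat \<Rightarrow> bool" where
  "good m n \<longleftrightarrow> (\<forall>i<p m. \<forall>j<p m. A.E m i j \<in> S \<longrightarrow>
      (\<exists>G\<subseteq>{..<q n} \<times> {..<q n}. (\<forall>(a, b)\<in>G. B.E n a b \<in> T) \<and> inj_on snd G \<and>
        R (A.E m i j) (\<Sum>(a, b)\<in>G. B.E n a b))) \<and>
    (\<forall>i<p m. \<phi> (A.E m i i) \<in> range (B.dg n))"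

lemma unit_ex:
  assumes "i < p m" "j < p m" "A.E m i j \<in> S"
  shows "\<exists>N. \<forall>n\<ge>N. \<exists>G\<subseteq>{..<q n} \<times> {..<q n}. (\<forall>(a, b)\<in>G. B.E n a b \<in> T) \<and> inj_on snd G \<and>
        R (A.E m i j) (\<Sum>(a, b)\<in>G. B.E n a b)"
proof -
  interpret u: masa_iso_unit p \<alpha> S q \<beta> T \<phi> \<psi> m i j by unfold_locales (fact assms)+
  show ?thesis by (rule u.unit_image)
qed

lemma unit_R: "i < p m \<Longrightarrow> j < p m \<Longrightarrow> A.E m i j \<in> S \<Longrightarrow> R (A.E m i j) (U (A.E m i j))"
  using unit_ex[of i m j] U_eq by (metis order_refl)

lemma good_ex: "\<exists>N. \<forall>n\<ge>N. good m n"
proof -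
  have 1: "\<forall>\<^sub>F n in sequentially. A.E m i j \<in> S \<longrightarrow>
      (\<exists>G\<subseteq>{..<q n} \<times> {..<q n}. (\<forall>(a, b)\<in>G. B.E n a b \<in> T) \<and> inj_on snd G \<and>
        R (A.E m i j) (\<Sum>(a, b)\<in>G. B.E n a b))" if "i < p m" "j < p m" for i j
    using unit_ex[OF that] unfolding eventually_sequentially by (cases "A.E m i j \<in> S") auto
  have 2: "\<forall>\<^sub>F n in sequentially. \<phi> (A.E m i i) \<in> range (B.dg n)" for i
  proof -
    obtain N where "\<phi> (A.E m i i) \<in> range (B.dg N)" using phi_DA[OF A.E_DA] unfolding B.DA_def by blast
    then show ?thesis unfolding eventually_sequentially using B.diag_mono by blast
  qed
  have "\<forall>\<^sub>F n in sequentially. (\<forall>i\<in>{..<p m}. \<forall>j\<in>{..<p m}. A.E m i j \<in> S \<longrightarrow>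
      (\<exists>G\<subseteq>{..<q n} \<times> {..<q n}. (\<forall>(a, b)\<in>G. B.E n a b \<in> T) \<and> inj_on snd G \<and>
        R (A.E m i j) (\<Sum>(a, b)\<in>G. B.E n a b))) \<and> (\<forall>i\<in>{..<p m}. \<phi> (A.E m i i) \<in> range (B.dg n))"
    by (intro eventually_conj eventually_ball_finite finite_lessThan ballI 1 2) auto
  then have "\<forall>\<^sub>F n in sequentially. good m n"
    by (rule eventually_mono) (auto simp: good_def)
  then show ?thesis by (simp add: eventually_sequentially)
qed

lemma Phi_add: "Phi m (x + y) = Phi m x + Phi m y"
  by (simp add: Phi_def A.ent_add scaleC_add_left sum.distrib)

lemma Phi_scale: "Phi m (scaleC c x) = scaleC c (Phi m x)"
  by (simp add: Phi_def A.ent_scale scaleC_sum_right scaleC_scaleC)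

lemma Phi_zero: "Phi m 0 = 0"
  using Phi_scale[of m 0 0] by simp

lemma Phi_sum: "Phi m (\<Sum>a\<in>I. f a) = (\<Sum>a\<in>I. Phi m (f a))"
  by (induction I rule: infinite_finite_induct) (auto simp: Phi_add Phi_zero)

lemma Phi_E: "i < p m \<Longrightarrow> j < p m \<Longrightarrow> Phi m (A.E m i j) = U (A.E m i j)"
proof -
  assume ij: "i < p m" "j < p m"
  have "scaleC (A.ent (A.E m i j) a b) (U (A.E m a b)) = (if a = i then if b = j then U (A.E m i j) else 0 else 0)"
    if "a < p m" "b < p m" for a b using that by (simp add: A.ent_E)
  then have "Phi m (A.E m i j) = (\<Sum>a<p m. \<Sum>b<p m. if a = i then if b = j then U (A.E m i j) else 0 else 0)"
    unfolding Phi_def by (intro sum.cong) auto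
  also have "\<dots> = (\<Sum>a<p m. if a = i then U (A.E m i j) else 0)"
    using ij by (intro sum.cong refl) auto
  finally show ?thesis using ij by simp
qed

lemma U_diag: "i < p m \<Longrightarrow> U (A.E m i i) = \<phi> (A.E m i i)"
  by (intro U_eq R_isproj A.isproj_E)

lemma Phi_one: "Phi m 1 = 1"
proof -
  have "Phi m 1 = (\<Sum>i<p m. Phi m (A.E m i i))" unfolding A.one_expand[of m] by (rule Phi_sum)
  also have "\<dots> = (\<Sum>i<p m. \<phi> (A.E m i i))" by (intro sum.cong) (auto simp: Phi_E U_diag)
  also have "\<dots> = \<phi> (\<Sum>i<p m. A.E m i i)" using A.DA_S by (subst phi_sum) auto
  finally show ?thesis by (simp flip: A.one_expand)
qed

lemma Phi_in_subspace:
  assumes X: "complex_subspace X"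
    and U: "\<And>i j. i < p m \<Longrightarrow> j < p m \<Longrightarrow> A.ent x i j \<noteq> 0 \<Longrightarrow> U (A.E m i j) \<in> X"
  shows "Phi m x \<in> X"
  unfolding Phi_def
proof (intro subspace_sum[OF X])
  fix i j assume "i \<in> {..<p m}" "j \<in> {..<p m}"
  then show "scaleC (A.ent x i j) (U (A.E m i j)) \<in> X"
    using U[of i j] X by (cases "A.ent x i j = 0") (auto simp: complex_subspace_def)
qed

lemma Phi_sec:
  assumes "good m n" and x: "x \<in> A.sec m"
  shows "Phi m x \<in> B.sec n"
proof (rule Phi_in_subspace[OF B.sec_subspace])
  fix i j assume ij: "i < p m" "j < p m" "A.ent x i j \<noteq> 0"
  then have "A.E m i j \<in> S" using A.sec_unit[OF x] by blast
  then obtain G where G: "\<forall>(a, b)\<in>G. B.E n a b \<in> T" "R (A.E m i j) (\<Sum>(a, b)\<in>G. B.E n a b)"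
    using assms(1) ij unfolding good_def by blast
  have "(\<Sum>(a, b)\<in>G. B.E n a b) \<in> B.sec n"
    using G(1) by (intro subspace_sum[OF B.sec_subspace]) (auto simp: B.sec_def)
  then show "U (A.E m i j) \<in> B.sec n" using U_eq[OF G(2)] by simp
qed

lemma Phi_diag:
  assumes "good m n" and x: "x \<in> range (A.dg m)"
  shows "Phi m x \<in> range (B.dg n)"
proof (rule Phi_in_subspace[OF B.dg_subspace])
  fix i j assume ij: "i < p m" "j < p m" "A.ent x i j \<noteq> 0"
  then have "i = j" using A.DA_off[of x i j] x by (auto simp: A.DA_def)
  then show "U (A.E m i j) \<in> range (B.dg n)"
    using assms(1) ij by (simp add: U_diag good_def)
qed

text \<open>The partner is a sum of matrix units of T, each with its own partner back on the A side.
  These are pairwise orthogonal, so their sum is related to the same element as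
  \<open>A.E m i j\<close>, and uniqueness identifies the two.\<close>

lemma Phi_unit_inverse:
  assumes good: "good m n" and ij: "i < p m" "j < p m" and S: "A.E m i j \<in> S"
  shows "masa_iso.Phi q \<beta> p \<alpha> \<psi> n (U (A.E m i j)) = A.E m i j"
proof -
  interpret sw: masa_iso q \<beta> T p \<alpha> S \<psi> \<phi> by (rule swap)
  obtain G where G: "G \<subseteq> {..<q n} \<times> {..<q n}" "\<forall>(a, b)\<in>G. B.E n a b \<in> T" "inj_on snd G"
    "R (A.E m i j) (\<Sum>(a, b)\<in>G. B.E n a b)"
    using good ij S unfolding good_def by blast
  have fin: "finite G" by (rule finite_subset[OF G(1)]) auto
  define f where "f x = B.E n (fst x) (snd x)" for x
  define w where "w x = sw.U (f x)" for x
  have GD: "fst x < q n" "snd x < q n" "f x \<in> T" if "x \<in> G" for x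
    using G(1,2) that by (auto simp: f_def)
  have Rw: "sw.R (f x) (w x)" if "x \<in> G" for x
    unfolding w_def f_def using GD[OF that] by (intro sw.unit_R) (auto simp: f_def)
  have R: "R (w x) (f x)" if "x \<in> G" for x using sw.R_imp_swap[OF Rw[OF that]] .
  have "R (\<Sum>x\<in>G. w x) (\<Sum>x\<in>G. f x)"
  proof (rule R_sum[OF fin R])
    fix x y d assume xy: "x \<in> G" "y \<in> G" "x \<noteq> y" and d: "d \<in> A.DA"
    have b: "snd x \<noteq> snd y" using inj_onD[OF G(3) _ xy(1,2)] xy(3) by auto
    show "f x * \<phi> d * star (f y) = 0"
      unfolding f_def by (intro B.E_cross GD xy b phi_DA d)
    \<comment> \<open>Orthogonality of the \<open>w x\<close> comes from their source projections,
      the images under \<psi> of distinct diagonal units, as \<open>snd\<close> is injective on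
      \<open>G\<close>.\<close>
    let ?e = "\<lambda>x. B.E n (snd x) (snd x)"
    have e: "B.isproj (?e x)" "B.isproj (?e y)" by (intro B.isproj_E GD xy)+
    have wx: "w x * \<psi> (?e x) = w x" "w y * \<psi> (?e y) = w y"
      using sw.R_support[OF Rw e(1)] sw.R_support[OF Rw e(2)] xy GD by (auto simp: f_def B.E_mult)
    have D: "\<psi> (?e x) \<in> A.DA" "\<psi> (?e y) \<in> A.DA" by (auto intro: psi_DA)
    have "\<psi> (?e x) * \<psi> (?e y) = \<psi> (?e x * ?e y)"
      using B.DA_S by (intro psi_left[symmetric]) auto
    also have "\<dots> = 0" using GD xy b by (simp add: B.E_mult)
    finally have 0: "\<psi> (?e x) * \<psi> (?e y) = 0" .
    have "star (\<psi> (?e y)) = \<psi> (?e y)" by (rule A.isproj_star[OF psi_isproj[OF e(2)]])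
    then have "w x * d * star (w y) = (w x * \<psi> (?e x)) * d * (\<psi> (?e y) * star (w y))"
      using wx star_mult[of "w y" "\<psi> (?e y)"] by simp
    also have "\<dots> = w x * (\<psi> (?e x) * d) * \<psi> (?e y) * star (w y)" by (simp add: mult.assoc)
    also have "\<psi> (?e x) * d = d * \<psi> (?e x)" by (rule A.DA_commute[OF D(1) d])
    also have "w x * (d * \<psi> (?e x)) * \<psi> (?e y) * star (w y) = w x * d * (\<psi> (?e x) * \<psi> (?e y)) * star (w y)"
      by (simp add: mult.assoc)
    finally show "w x * d * star (w y) = 0" by (simp add: 0)
  qed
  moreover have sumf: "(\<Sum>x\<in>G. f x) = (\<Sum>(a, b)\<in>G. B.E n a b)"
    by (intro sum.cong) (auto simp: f_def)
  ultimately have eq: "(\<Sum>x\<in>G. w x) = A.E m i j" using R_unique_left G(4) by metis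
  have "sw.Phi n (\<Sum>x\<in>G. f x) = (\<Sum>x\<in>G. w x)"
    unfolding sw.Phi_sum w_def using GD by (intro sum.cong) (auto simp: f_def sw.Phi_E)
  then show ?thesis using U_eq[OF G(4)] eq sumf by simp
qed

lemma Phi_inverse:
  assumes good: "good m n" and x: "x \<in> A.sec m"
  shows "masa_iso.Phi q \<beta> p \<alpha> \<psi> n (Phi m x) = x"
proof -
  interpret sw: masa_iso q \<beta> T p \<alpha> S \<psi> \<phi> by (rule swap)
  have "sw.Phi n (Phi m x) = (\<Sum>i<p m. \<Sum>j<p m. scaleC (A.ent x i j) (sw.Phi n (U (A.E m i j))))"
    by (simp only: Phi_def sw.Phi_sum sw.Phi_scale)
  also have "\<dots> = (\<Sum>i<p m. \<Sum>j<p m. scaleC (A.ent x i j) (A.E m i j))"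
  proof (intro sum.cong refl)
    fix i j assume "i \<in> {..<p m}" "j \<in> {..<p m}"
    then show "scaleC (A.ent x i j) (sw.Phi n (U (A.E m i j))) = scaleC (A.ent x i j) (A.E m i j)"
      using Phi_unit_inverse[OF good, of i j] A.sec_unit[OF x, of i j] by (cases "A.ent x i j = 0") auto
  qed
  also have "\<dots> = A.el m (A.ent x)" by (rule A.el_expand[symmetric])
  also have "\<dots> = x" using x by (intro A.el_ent[symmetric]) (simp add: A.sec_def)
  finally show ?thesis .
qed

lemma R_adjoint:
  assumes ij: "i < p m" "j < p m" and R: "R (A.E m i j) u" "R (A.E m j i) u'"
  shows "u' = star u"
proof -
  let ?f = "\<lambda>i. \<phi> (A.E m i i)"
  have uu': "u * u' = ?f i"
    using R_mult[OF R] ij R_unique_right[OF _ R_isproj[OF A.isproj_E[OF ij(1)]]] by (simp add: A.E_mult)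
  have u'u: "u' * u = ?f j"
    using R_mult[OF R(2,1)] ij R_unique_right[OF _ R_isproj[OF A.isproj_E[OF ij(2)]]] by (simp add: A.E_mult)
  have uus: "u * star u = ?f i"
  proof -
    have "u * \<phi> 1 * star u = \<phi> (A.E m i j * 1 * star (A.E m i j))" using R(1) A.one_DA unfolding R_def by blast
    then show ?thesis using ij by (simp add: A.E_star A.E_mult)
  qed
  have ufj: "u * ?f j = u" using ij by (intro R_support[OF R(1)] A.isproj_E) (auto simp: A.E_mult)
  have u'fi: "u' * ?f i = u'" using ij by (intro R_support[OF R(2)] A.isproj_E) (auto simp: A.E_mult)
  have s: "star (?f j) = ?f j" using ij by (intro B.isproj_star phi_isproj A.isproj_E)
  have "u' = u' * (u * star u)" by (simp only: uus u'fi)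
  also have "\<dots> = ?f j * star u" by (simp only: mult.assoc[symmetric] u'u)
  also have "\<dots> = star (u * ?f j)" by (simp only: star_mult s)
  also have "\<dots> = star u" by (simp only: ufj)
  finally show ?thesis .
qed

text \<open>
  The indices \<open>i\<close>, \<open>j\<close> for which both \<open>A.E m i j\<close> and \<open>A.E m j i\<close> have a partner form an
  equivalence relation. With a representative \<open>r i\<close> of each class and \<open>W i\<close> the partner of
  \<open>A.E m i (r i)\<close> one has \<open>U (A.E m i j) = W i * star (W j)\<close>.
\<close>

lemma unit_factorization:
  "\<exists>r W. (\<forall>i<p m. r i < p m \<and> W i \<in> B.lvl) \<and>
     (\<forall>i<p m. \<forall>j<p m. A.E m i j \<in> S \<longrightarrow> r i = r j \<and> U (A.E m i j) = W i * star (W j))"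
proof -
  define eqv where "eqv i j \<longleftrightarrow> i < p m \<and> j < p m \<and> (\<exists>u u'. R (A.E m i j) u \<and> R (A.E m j i) u')" for i j
  have refl: "eqv i i" if "i < p m" for i
    using that R_isproj[OF A.isproj_E[OF that]] by (auto simp: eqv_def)
  have sym: "eqv j i" if "eqv i j" for i j using that by (auto simp: eqv_def)
  have trans: "eqv i l" if ij: "eqv i j" and jl: "eqv j l" for i j l
  proof -
    obtain u u' v v' where R: "R (A.E m i j) u" "R (A.E m j i) u'" "R (A.E m j l) v" "R (A.E m l j) v'"
      using ij jl by (auto simp: eqv_def)
    have b: "i < p m" "j < p m" "l < p m" using ij jl by (auto simp: eqv_def)
    have "R (A.E m i l) (u * v)" "R (A.E m l i) (v' * u')"
      using R_mult[OF R(1,3)] R_mult[OF R(4,2)] b by (auto simp: A.E_mult)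
    then show ?thesis using b by (auto simp: eqv_def)
  qed
  define r where "r i = (LEAST j. eqv i j)" for i
  define W where "W i = U (A.E m i (r i))" for i
  have r: "eqv i (r i)" if "i < p m" for i unfolding r_def by (rule LeastI[of "eqv i" i, OF refl[OF that]])
  have RW: "R (A.E m i (r i)) (W i)" if "i < p m" for i
  proof -
    from r[OF that] obtain u where "R (A.E m i (r i)) u" by (auto simp: eqv_def)
    then show ?thesis using U_eq by (simp add: W_def)
  qed
  have r_eq: "r i = r j" if "eqv i j" for i j
  proof -
    have "eqv i = eqv j" using that sym trans by (intro ext) blast
    then show ?thesis by (simp add: r_def)
  qed
  have eqv: "eqv i j" if "i < p m" "j < p m" "A.E m i j \<in> S" for i j
    using unit_R[of i m j] unit_R[of j m i] that A.S_star[OF that(3)] by (auto simp: eqv_def A.E_star)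
  have UW: "U (A.E m i j) = W i * star (W j)" if ij: "i < p m" "j < p m" and rr: "r i = r j" for i j
  proof -
    from r[OF ij(2)] obtain u' where u': "R (A.E m (r j) j) u'" by (auto simp: eqv_def)
    have rj: "r j < p m" using r[OF ij(2)] by (simp add: eqv_def)
    have "u' = star (W j)" by (rule R_adjoint[OF ij(2) rj RW[OF ij(2)] u'])
    then have "R (A.E m i (r j) * A.E m (r j) j) (W i * star (W j))"
      using R_mult[OF RW[OF ij(1)] u'] by (simp add: rr)
    then show ?thesis using rj ij by (intro U_eq) (simp add: A.E_mult)
  qed
  have "r i < p m \<and> W i \<in> B.lvl" if "i < p m" for i
    using r[OF that] RW[OF that] by (auto simp: eqv_def R_def B.nn_def)
  moreover have "r i = r j \<and> U (A.E m i j) = W i * star (W j)" if "i < p m" "j < p m" "A.E m i j \<in> S" for i j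
    using r_eq[OF eqv[OF that]] UW[OF that(1,2)] by simp
  ultimately show ?thesis by (intro exI[of _ r] exI[of _ W]) blast
qed

text \<open>Substituting W i (W j)* for the partners turns the form of the image at \<xi> into a
  sum, over coordinates \<open>l\<close> and classes \<open>c\<close>, of forms of \<open>x\<close>
  in the corner of level \<open>m\<close>. Every summand is nonnegative, for all matrix sizes
  alike.\<close>

lemma Psd_Phi:
  assumes x: "A.Psd N x" and sec: "\<And>s t. s < N \<Longrightarrow> t < N \<Longrightarrow> x s t \<in> A.sec m"
  shows "B.Psd N (\<lambda>s t. Phi m (x s t))"
proof -
  obtain r W where rW: "\<forall>i<p m. r i < p m \<and> W i \<in> B.lvl"
    "\<forall>i<p m. \<forall>j<p m. A.E m i j \<in> S \<longrightarrow> r i = r j \<and> U (A.E m i j) = W i * star (W j)"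
    using unit_factorization[of m] by blast
  have r: "r i < p m" and W: "W i \<in> B.lvl" if "i < p m" for i using rW(1) that by auto
  have rS: "r i = r j" and UW: "U (A.E m i j) = W i * star (W j)"
    if "i < p m" "j < p m" "A.E m i j \<in> S" for i j using rW(2) that by auto
  have "\<forall>\<^sub>F K in sequentially. \<forall>i\<in>{..<p m}. W i \<in> range (B.el K)"
  proof (intro eventually_ball_finite finite_lessThan ballI)
    fix i assume "i \<in> {..<p m}"
    then obtain K where "W i \<in> range (B.el K)" using W[of i] by (auto simp: B.lvl_def)
    then show "\<forall>\<^sub>F K in sequentially. W i \<in> range (B.el K)"
      unfolding eventually_sequentially using B.level_mono by blast
  qed
  then obtain K0 where K0: "\<And>K i. K0 \<le> K \<Longrightarrow> i < p m \<Longrightarrow> W i \<in> range (B.el K)"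
    by (auto simp: eventually_sequentially)
  define X where "X s t i j = A.ent (x s t) i j" for s t i j
  have X0: "X s t i j = 0" if "s < N" "t < N" "i < p m" "j < p m" "r i \<noteq> r j" for s t i j
    using rS[of i j] A.sec_unit[OF sec[of s t], of i j] that by (auto simp: X_def)
  have Phi: "Phi m (x s t) = (\<Sum>(i, j)\<in>{..<p m} \<times> {..<p m}. scaleC (X s t i j) (W i * star (W j)))"
    if st: "s < N" "t < N" for s t
  proof -
    have "Phi m (x s t) = (\<Sum>i<p m. \<Sum>j<p m. scaleC (X s t i j) (W i * star (W j)))"
      unfolding Phi_def
    proof (intro sum.cong refl)
      fix i j assume "i \<in> {..<p m}" "j \<in> {..<p m}"
      then show "scaleC (A.ent (x s t) i j) (U (A.E m i j)) = scaleC (X s t i j) (W i * star (W j))"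
        using UW[of i j] A.sec_unit[OF sec[OF st], of i j]
        by (cases "A.ent (x s t) i j = 0") (auto simp: X_def)
    qed
    then show ?thesis by (simp add: sum.cartesian_product)
  qed
  let ?y = "\<lambda>s t. Phi m (x s t)"
  have Xs: "cnj (X s t i j) = X t s j i" if "s < N" "t < N" for s t i j
    using A.ent_star[of "x s t" j i] A.Psd_star[OF x that] by (simp add: X_def)
  have star_y: "star (?y s t) = ?y t s" if "s < N" "t < N" for s t
  proof -
    have "star (?y s t) = (\<Sum>i<p m. \<Sum>j<p m. scaleC (X t s j i) (W j * star (W i)))"
      using that by (simp add: Phi star_sum star_scaleC star_mult star_star Xs flip: sum.cartesian_product)
    also have "\<dots> = (\<Sum>j<p m. \<Sum>i<p m. scaleC (X t s j i) (W j * star (W i)))" by (rule sum.swap)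
    finally show ?thesis using that by (simp add: Phi flip: sum.cartesian_product)
  qed
  show ?thesis
  proof (rule B.PsdI_large[where ?K0.0 = K0])
    fix K assume K: "K0 \<le> K"
    let ?F = "B.pset K"
    show "psd (B.idx N K) (B.MF ?y)"
      unfolding psd_def
    proof (intro conjI ballI allI)
      fix a b assume "a \<in> B.idx N K" "b \<in> B.idx N K"
      then have "fst a < N" "fst b < N" by (auto simp: B.idx_def)
      then show "B.MF ?y b a = cnj (B.MF ?y a b)"
        using star_y[of "fst a" "fst b"] B.ent_star[of "?y (fst a) (fst b)"] by (simp add: B.MF_def)
    next
      fix \<xi> :: "nat \<times> nat \<Rightarrow> complex"
      \<comment> \<open>Coordinate \<open>l\<close> of \<open>star (W i)\<close> applied to block
        \<open>s\<close> of \<xi>.\<close>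
      define \<eta> where "\<eta> l s i = app ?F (\<lambda>a b. cnj (B.ent (W i) b a)) (\<lambda>a. \<xi> (s, a)) l" for l s i
      \<comment> \<open>The part of \<eta> in the class with representative \<open>c\<close>. The
        coefficients \<open>X\<close> vanish between different classes, so summing over
        \<open>c\<close> recovers the full sum over \<open>i\<close> and \<open>j\<close>.\<close>
      define \<zeta> where "\<zeta> l c x = (if r (snd x) = c then \<eta> l (fst x) (snd x) else 0)" for l c and x :: "nat \<times> nat"
      let ?P = "{..<N} \<times> {..<N} \<times> {..<p m} \<times> {..<p m}"
      have form_y: "ip (B.idx N K) \<xi> (app (B.idx N K) (B.MF ?y) \<xi>) =
          (\<Sum>s<N. \<Sum>t<N. \<Sum>i<p m. \<Sum>j<p m. X s t i j * (\<Sum>l<q K. cnj (\<eta> l s i) * \<eta> l t j))"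
        unfolding B.form_idx
      proof (intro sum.cong refl)
        fix s t assume "s \<in> {..<N}" "t \<in> {..<N}"
        then have "ip ?F (\<lambda>i. \<xi> (s, i)) (app ?F (B.ent (?y s t)) (\<lambda>i. \<xi> (t, i))) =
            (\<Sum>(i, j)\<in>{..<p m} \<times> {..<p m}. X s t i j *
              ip ?F (\<lambda>i. \<xi> (s, i)) (app ?F (B.ent (W i * star (W j))) (\<lambda>i. \<xi> (t, i))))"
          using B.form_sum[of ?F "\<lambda>i. \<xi> (s, i)" "\<lambda>(i, j). X s t i j" "\<lambda>(i, j). W i * star (W j)"
              "{..<p m} \<times> {..<p m}" "\<lambda>i. \<xi> (t, i)"]
          by (simp add: Phi case_prod_unfold)
        also have "\<dots> = (\<Sum>(i, j)\<in>{..<p m} \<times> {..<p m}. X s t i j * (\<Sum>l<q K. cnj (\<eta> l s i) * \<eta> l t j))"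
          unfolding \<eta>_def using K0[OF K] by (intro sum.cong refl) (auto simp: B.form_mult_star)
        finally show "ip ?F (\<lambda>i. \<xi> (s, i)) (app ?F (B.ent (?y s t)) (\<lambda>i. \<xi> (t, i))) =
            (\<Sum>i<p m. \<Sum>j<p m. X s t i j * (\<Sum>l<q K. cnj (\<eta> l s i) * \<eta> l t j))"
          by (simp add: sum.cartesian_product)
      qed
      also have "\<dots> = (\<Sum>(s, t, i, j)\<in>?P. X s t i j * (\<Sum>l<q K. cnj (\<eta> l s i) * \<eta> l t j))"
        by (simp add: sum.cartesian_product)
      also have "\<dots> = (\<Sum>(s, t, i, j)\<in>?P. \<Sum>(l, c)\<in>{..<q K} \<times> {..<p m}.
          cnj (\<zeta> l c (s, i)) * (X s t i j * \<zeta> l c (t, j)))"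
      proof -
        have "X s t i j * (\<Sum>l<q K. cnj (\<eta> l s i) * \<eta> l t j) =
            (\<Sum>(l, c)\<in>{..<q K} \<times> {..<p m}. cnj (\<zeta> l c (s, i)) * (X s t i j * \<zeta> l c (t, j)))"
          if st: "s < N" "t < N" and ij: "i < p m" "j < p m" for s t i j
        proof -
        have "(\<Sum>c<p m. cnj (\<zeta> l c (s, i)) * (X s t i j * \<zeta> l c (t, j))) = X s t i j * (cnj (\<eta> l s i) * \<eta> l t j)" for l
        proof -
          have "cnj (\<zeta> l c (s, i)) * (X s t i j * \<zeta> l c (t, j)) =
              (if c = r i then X s t i j * (cnj (\<eta> l s i) * \<eta> l t j) else 0)" for c
            using X0[of s t i j] st ij by (auto simp: \<zeta>_def)
          then show ?thesis using r ij by simp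
        qed
        then show ?thesis
          by (simp add: sum_distrib_left flip: sum.cartesian_product)
        qed
        then show ?thesis
          by (intro sum.cong refl) (simp only: mem_Times_iff lessThan_iff case_prod_unfold)
      qed
      also have "\<dots> = (\<Sum>(l, c)\<in>{..<q K} \<times> {..<p m}. \<Sum>(s, t, i, j)\<in>?P.
          cnj (\<zeta> l c (s, i)) * (X s t i j * \<zeta> l c (t, j)))"
        unfolding case_prod_unfold by (rule sum.swap)
      also have "\<dots> = (\<Sum>(l, c)\<in>{..<q K} \<times> {..<p m}. ip (A.idx N m) (\<zeta> l c) (app (A.idx N m) (A.MF x) (\<zeta> l c)))"
      proof -
        have *: "(\<Sum>(s, t, i, j)\<in>?P. cnj (\<zeta> l c (s, i)) * (X s t i j * \<zeta> l c (t, j))) =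
            ip (A.idx N m) (\<zeta> l c) (app (A.idx N m) (A.MF x) (\<zeta> l c))" for l c
        proof -
        have "ip (A.idx N m) (\<zeta> l c) (app (A.idx N m) (A.MF x) (\<zeta> l c)) =
            (\<Sum>s<N. \<Sum>t<N. \<Sum>i<p m. \<Sum>j<p m. cnj (\<zeta> l c (s, i)) * (X s t i j * \<zeta> l c (t, j)))"
          unfolding A.form_idx by (simp add: ip_def app_def X_def sum_distrib_left)
        then show ?thesis by (simp add: sum.cartesian_product)
        qed
        show ?thesis by (simp only: *)
      qed
      finally have "Re (ip (B.idx N K) \<xi> (app (B.idx N K) (B.MF ?y) \<xi>)) =
          (\<Sum>(l, c)\<in>{..<q K} \<times> {..<p m}. Re (ip (A.idx N m) (\<zeta> l c) (app (A.idx N m) (A.MF x) (\<zeta> l c))))"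
        by (simp add: case_prod_unfold)
      also have "\<dots> \<ge> 0"
      proof -
        have "psd (A.idx N m) (A.MF x)" using x by (simp add: A.Psd_def)
        then show ?thesis unfolding case_prod_unfold by (intro sum_nonneg psd_form)
      qed
      finally show "0 \<le> Re (ip (B.idx N K) \<xi> (app (B.idx N K) (B.MF ?y) \<xi>))" .
    qed
  qed
qed

lemma Phi_ucp:
  assumes "good m n"
  shows "ucp_map (A.sec m) (B.sec n) (Phi m)"
  unfolding ucp_map_def
proof (intro conjI cpI)
  show "Phi m ` A.sec m \<subseteq> B.sec n" using Phi_sec[OF assms] by blast
  show "complex_linear_on (A.sec m) (Phi m)" by (simp add: complex_linear_on_def Phi_add Phi_scale)
  show "Phi m 1 = 1" by (rule Phi_one)
qed (rule Psd_Phi)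

end

section \<open>Extension from the sections\<close>

lemma ucp_map_cong:
  assumes F: "ucp_map S1 T1 F" and S: "complex_subspace S0" "S0 \<subseteq> S1" "1 \<in> S0" and T: "T1 \<subseteq> T"
    and eq: "\<And>x. x \<in> S0 \<Longrightarrow> f x = F x"
  shows "ucp_map S0 T f"
  unfolding ucp_map_def completely_positive_map_def
proof (intro conjI allI impI)
  show "f ` S0 \<subseteq> T" using F S T eq by (auto simp: ucp_map_def completely_positive_map_def image_subset_iff subset_iff)
  show "f 1 = 1" using F S eq by (simp add: ucp_map_def)
  have 0: "x + y \<in> S0" "scaleC c x \<in> S0" if "x \<in> S0" "y \<in> S0" for x y c
    using S(1) that by (auto simp: complex_subspace_def)
  show "complex_linear_on S0 f"
    using F S(2) 0 unfolding complex_linear_on_def ucp_map_def completely_positive_map_def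
    by (auto simp: eq subset_iff)
  fix n X assume X: "mat_positive n X \<and> elements_mat X \<subseteq> S0"
  then have "mat_positive n (map_mat F X)"
    using F S(2) by (auto simp: ucp_map_def completely_positive_map_def)
  moreover have "map_mat f X = map_mat F X"
  proof (rule eq_matI)
    fix i j assume "i < dim_row (map_mat F X)" "j < dim_col (map_mat F X)"
    then have ij: "i < dim_row X" "j < dim_col X" by auto
    then have "X $$ (i, j) \<in> elements_mat X" by (intro elements_matI[of X "dim_row X" "dim_col X" i j]) auto
    then show "map_mat f X $$ (i, j) = map_mat F X $$ (i, j)" using X ij eq by auto
  qed auto
  ultimately show "mat_positive n (map_mat f X)" by simp
qed

context uhf
begin

section \<open>Limits and perturbations of positive matrices\<close>

lemma Psd_limit:
  assumes "\<And>s t. s < n \<Longrightarrow> t < n \<Longrightarrow> (\<lambda>m. y m s t) \<longlonglongrightarrow> x s t" "\<And>m. Psd n (y m)"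
  shows "Psd n x"
  unfolding Psd_def
proof
  fix K
  show "psd (idx n K) (MF x)"
  proof (rule psd_limit)
    show "(\<lambda>m. MF (y m) a b) \<longlonglongrightarrow> MF x a b" if "a \<in> idx n K" "b \<in> idx n K" for a b
      using that by (intro MF_tendsto assms) (auto simp: idx_def)
    show "psd (idx n K) (MF (y m))" for m using assms(2) by (simp add: Psd_def)
  qed
qed

text \<open>Approximation may destroy positivity. A matrix of size \<open>n\<close> with entries of
  norm at most \<open>d\<close> has norm at most n d, so adding n d times the identity restores
  it.\<close>

lemma Psd_perturb:
  assumes x: "Psd n x" and z: "\<And>s t. s < n \<Longrightarrow> t < n \<Longrightarrow> star (z s t) = z t s"
    and d: "\<And>s t. s < n \<Longrightarrow> t < n \<Longrightarrow> norm (z s t - x s t) \<le> d" "0 < d"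
  shows "Psd n (\<lambda>s t. z s t + scaleR (real n * d) (one_fun s t))"
proof (cases "n = 0")
  case True
  then show ?thesis by (simp add: Psd_def psd_def idx_def ip_def)
next
  case False
  then have nd: "0 < real n * d" using d(2) by simp
  define w where "w s t = z s t - x s t" for s t
  have O: "Opb n (real n * d) w" using d by (intro Opb_entries) (auto simp: w_def)
  define y where "y s t = z s t + scaleR (real n * d) (one_fun s t)" for s t
  have y_star: "star (y s t) = y t s" if "s < n" "t < n" for s t
    using z[OF that] by (simp add: y_def star_add star_scaleR one_fun_def)
  have MFy: "MF y a b = MF x a b + MF w a b + (if a = b then of_real (real n * d) else 0)" for a b
    by (auto simp: MF_def y_def w_def ent_add ent_diff ent_scaleR one_fun_def ent_one prod_eq_iff)
  have "Psd n y"
    unfolding Psd_def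
  proof
    fix K
    let ?F = "idx n K"
    show "psd ?F (MF y)"
      unfolding psd_def
    proof (intro conjI ballI allI)
      fix a b assume "a \<in> ?F" "b \<in> ?F"
      then have "fst a < n" "fst b < n" by (auto simp: idx_def)
      then show "MF y b a = cnj (MF y a b)"
        using y_star[of "fst a" "fst b"] ent_star[of "y (fst a) (fst b)" "snd b" "snd a"] by (simp add: MF_def)
    next
      fix \<xi> :: "nat \<times> nat \<Rightarrow> complex"
      have "app ?F (MF y) \<xi> a = app ?F (MF x) \<xi> a + app ?F (MF w) \<xi> a + of_real (real n * d) * \<xi> a"
        if "a \<in> ?F" for a
      proof -
        have "(\<Sum>b\<in>?F. (if a = b then of_real (real n * d) else 0) * \<xi> b) =
            (\<Sum>b\<in>?F. if b = a then of_real (real n * d) * \<xi> a else 0)"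
          by (intro sum.cong) auto
        then show ?thesis using that by (simp add: app_def MFy distrib_right sum.distrib)
      qed
      then have "ip ?F \<xi> (app ?F (MF y) \<xi>) =
          ip ?F \<xi> (\<lambda>a. app ?F (MF x) \<xi> a + app ?F (MF w) \<xi> a + of_real (real n * d) * \<xi> a)"
        by (intro ip_cong) auto
      then have "Re (ip ?F \<xi> (app ?F (MF y) \<xi>)) =
          Re (ip ?F \<xi> (app ?F (MF x) \<xi>)) + Re (ip ?F \<xi> (app ?F (MF w) \<xi>)) + real n * d * sq ?F \<xi>"
        by (simp add: ip_add_right ip_scale_right ip_self flip: of_real_mult)
      moreover have "0 \<le> Re (ip ?F \<xi> (app ?F (MF x) \<xi>))" using x by (intro psd_form) (simp add: Psd_def)
      moreover have "2 * \<bar>Re (ip ?F \<xi> (app ?F (MF w) \<xi>))\<bar> \<le> real n * d * (sq ?F \<xi> + sq ?F \<xi>)"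
        using O nd by (intro opb_form_le) (auto simp: Opb_def)
      ultimately show "0 \<le> Re (ip ?F \<xi> (app ?F (MF y) \<xi>))"
        using abs_le_iff[of "Re (ip ?F \<xi> (app ?F (MF w) \<xi>))"] by (simp add: distrib_left)
    qed
  qed
  then show ?thesis by (simp only: y_def[abs_def])
qed

end

context uhf_system
begin

definition alg :: "'a set" where "alg = (\<Union>k. sec k)"

lemma alg_S: "alg \<subseteq> S"
  by (auto simp: alg_def sec_def)

lemma closure_alg: "closure alg = S"
proof
  show "closure alg \<subseteq> S" using alg_S S_closed by (rule closure_minimal)
  show "S \<subseteq> closure alg" using section_dense by (simp add: alg_def sec_def)
qed

lemma alg_seq: "x \<in> S \<Longrightarrow> \<exists>f. (\<forall>m. f m \<in> alg) \<and> f \<longlonglongrightarrow> x"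
  using closure_sequential[of x alg] by (simp add: closure_alg)

lemma alg_level:
  assumes "finite I" "\<And>a. a \<in> I \<Longrightarrow> f a \<in> alg"
  shows "\<exists>k. \<forall>a\<in>I. f a \<in> sec k"
  using assms
proof (induction I rule: finite_induct)
  case (insert b I)
  then obtain k where "\<forall>a\<in>I. f a \<in> sec k" by blast
  moreover obtain l where "f b \<in> sec l" using insert.prems[of b] by (auto simp: alg_def)
  ultimately have "\<forall>a\<in>insert b I. f a \<in> sec (max k l)"
    using sec_mono[of k "max k l"] sec_mono[of l "max k l"] by auto
  then show ?case by blast
qed auto

lemma alg_pair: "x \<in> alg \<Longrightarrow> y \<in> alg \<Longrightarrow> \<exists>k. x \<in> sec k \<and> y \<in> sec k"
proof -
  assume "x \<in> alg" "y \<in> alg"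
  then obtain k l where "x \<in> sec k" "y \<in> sec l" by (auto simp: alg_def)
  then have "x \<in> sec (max k l) \<and> y \<in> sec (max k l)"
    using sec_mono[of k "max k l"] sec_mono[of l "max k l"] by auto
  then show ?thesis by blast
qed

lemma DA_alg: "DA \<subseteq> alg"
proof
  fix d assume d: "d \<in> DA"
  then obtain k where "d \<in> range (dg k)" by (auto simp: DA_def)
  then have "d \<in> sec k" using dg_level[of k] d DA_S by (auto simp: sec_def)
  then show "d \<in> alg" by (auto simp: alg_def)
qed

end

context uhf_pair
begin

text \<open>Contractivity on each section extends \<open>f\<close> continuously. For positivity, a
  positive matrix over S is the limit of positive matrices, each over a single section: the
  approximants are made hermitian and shifted by a vanishing multiple of the identity.\<close>

lemma ucp_extend:
  assumes ucp: "\<And>k. ucp_map (A.sec k) T f"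
  shows "\<exists>F. ucp_map S T F \<and> continuous_on S F \<and> (\<forall>x\<in>A.alg. F x = f x)"
proof -
  have lin: "f (x + y) = f x + f y" "f (scaleC c x) = scaleC c (f x)" if "x \<in> A.sec k" "y \<in> A.sec k" for x y c k
    using ucp[of k] that by (auto simp: ucp_map_def completely_positive_map_def complex_linear_on_def)
  have fT: "f x \<in> T" if "x \<in> A.alg" for x
    using ucp that by (auto simp: A.alg_def ucp_map_def completely_positive_map_def image_subset_iff)
  have lip: "norm (f x - f y) \<le> norm (x - y)" if xy: "x \<in> A.alg" "y \<in> A.alg" for x y
  proof -
    obtain k where k: "x \<in> A.sec k" "y \<in> A.sec k" using A.alg_pair[OF xy] by blast
    have my: "scaleC (-1) y \<in> A.sec k" using k A.sec_subspace by (intro subspace_scale)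
    then have s: "x + scaleC (-1) y \<in> A.sec k" using k A.sec_subspace[of k] by (auto simp: complex_subspace_def)
    have "f (x + scaleC (-1) y) = f x + scaleC (-1) (f y)" using lin[OF k(1) my] lin(2)[OF k(2,2)] by simp
    then have "f (x - y) = f x - f y" by (simp add: scaleC_minus_one)
    moreover have "norm (f (x + scaleC (-1) y)) \<le> norm (x + scaleC (-1) y)"
      by (rule ucp_contractive[OF ucp A.sec_subspace A.one_sec s A.star_sec[OF s]])
    ultimately show ?thesis by (simp add: scaleC_minus_one)
  qed
  have "uniformly_continuous_on A.alg f"
    unfolding uniformly_continuous_on_def
    using lip by (auto simp: dist_norm intro: order.strict_trans1)
  then obtain F where "uniformly_continuous_on (closure A.alg) F" and Ff: "\<And>x. x \<in> A.alg \<Longrightarrow> f x = F x"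
    by (rule uniformly_continuous_on_extension_on_closure) blast
  then have cont: "continuous_on S F"
    using uniformly_continuous_imp_continuous by (simp add: A.closure_alg)
  have Flim: "(\<lambda>m. F (g m)) \<longlonglongrightarrow> F x" if "g \<longlonglongrightarrow> x" "x \<in> S" "\<And>m. g m \<in> S" for g x
    using continuous_on_tendsto_compose[OF cont that(1,2)] that(3) by auto
  have algS: "x \<in> A.alg \<Longrightarrow> x \<in> S" for x using A.alg_S by blast
  have FT: "F x \<in> T" if "x \<in> S" for x
  proof -
    from A.alg_seq[OF that] obtain g where g: "\<And>m. g m \<in> A.alg" "g \<longlonglongrightarrow> x" by blast
    have "F (g m) \<in> T" for m using fT[OF g(1)] Ff[OF g(1)] by simp
    moreover have "(\<lambda>m. F (g m)) \<longlonglongrightarrow> F x" using g that algS by (intro Flim) auto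
    ultimately show ?thesis using closed_sequentially[OF B.S_closed, of "\<lambda>m. F (g m)" "F x"] by blast
  qed
  have Fadd: "F (x + y) = F x + F y" if xy: "x \<in> S" "y \<in> S" for x y
  proof -
    obtain g where g: "\<And>m. g m \<in> A.alg" "g \<longlonglongrightarrow> x" using A.alg_seq[OF xy(1)] by blast
    obtain h where h: "\<And>m. h m \<in> A.alg" "h \<longlonglongrightarrow> y" using A.alg_seq[OF xy(2)] by blast
    have eq: "F (g m + h m) = F (g m) + F (h m)" for m
    proof -
      obtain k where k: "g m \<in> A.sec k" "h m \<in> A.sec k" using A.alg_pair[OF g(1) h(1)] by blast
      then have "g m + h m \<in> A.sec k" using A.sec_subspace[of k] by (auto simp: complex_subspace_def)
      then have "g m + h m \<in> A.alg" by (auto simp: A.alg_def)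
      then show ?thesis using lin(1)[OF k] Ff g(1) h(1) by metis
    qed
    have "(\<lambda>m. F (g m + h m)) \<longlonglongrightarrow> F (x + y)"
      using g h xy algS by (intro Flim tendsto_add A.S_add) auto
    moreover have "(\<lambda>m. F (g m) + F (h m)) \<longlonglongrightarrow> F x + F y"
      using g h xy algS by (intro tendsto_add Flim) auto
    ultimately show ?thesis unfolding eq by (rule LIMSEQ_unique)
  qed
  have Fscale: "F (scaleC c x) = scaleC c (F x)" if x: "x \<in> S" for c x
  proof -
    obtain g where g: "\<And>m. g m \<in> A.alg" "g \<longlonglongrightarrow> x" using A.alg_seq[OF x] by blast
    have eq: "F (scaleC c (g m)) = scaleC c (F (g m))" for m
    proof -
      obtain k where k: "g m \<in> A.sec k" using g(1)[of m] by (auto simp: A.alg_def)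
      then have "scaleC c (g m) \<in> A.sec k" using A.sec_subspace by (intro subspace_scale)
      then have "scaleC c (g m) \<in> A.alg" by (auto simp: A.alg_def)
      then show ?thesis using lin(2)[OF k k] Ff g(1) by metis
    qed
    have "(\<lambda>m. F (scaleC c (g m))) \<longlonglongrightarrow> F (scaleC c x)"
      using g x algS by (intro Flim bounded_linear.tendsto[OF bounded_linear_scaleC] A.S_scale) auto
    moreover have "(\<lambda>m. scaleC c (F (g m))) \<longlonglongrightarrow> scaleC c (F x)"
      using g x algS by (intro bounded_linear.tendsto[OF bounded_linear_scaleC] Flim) auto
    ultimately show ?thesis unfolding eq by (rule LIMSEQ_unique)
  qed
  have F1: "F 1 = 1"
  proof -
    have "1 \<in> A.alg" by (auto simp: A.alg_def)
    then show ?thesis using Ff[of 1] ucp[of 0] by (simp add: ucp_map_def)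
  qed
  have FPsd: "B.Psd n (\<lambda>s t. F (x s t))" if x: "A.Psd n x" and xS: "\<And>s t. s < n \<Longrightarrow> t < n \<Longrightarrow> x s t \<in> S" for n x
  proof -
    have "\<exists>g. (\<forall>m. g m \<in> A.alg) \<and> (s < n \<longrightarrow> t < n \<longrightarrow> g \<longlonglongrightarrow> x s t)" for s t
    proof (cases "s < n \<and> t < n")
      case True
      then show ?thesis using A.alg_seq[OF xS, of s t] by blast
    next
      case False
      have "0 \<in> A.alg" using A.sec_subspace[of 0] by (auto simp: A.alg_def complex_subspace_def)
      then show ?thesis using False by (intro exI[of _ "\<lambda>m. 0"]) auto
    qed
    then obtain g where g: "\<And>s t m. g s t m \<in> A.alg" "\<And>s t. s < n \<Longrightarrow> t < n \<Longrightarrow> g s t \<longlonglongrightarrow> x s t"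
      by metis
    have "\<exists>k. \<forall>a\<in>{..<n} \<times> {..<n}. g (fst a) (snd a) m \<in> A.sec k" for m
      by (rule A.alg_level) (auto intro: g)
    then obtain k where k: "\<And>m a. a \<in> {..<n} \<times> {..<n} \<Longrightarrow> g (fst a) (snd a) m \<in> A.sec (k m)" by metis
    then have k: "g s t m \<in> A.sec (k m)" if "s < n" "t < n" for s t m using k[of "(s, t)" m] that by simp
    \<comment> \<open>Averaging with the adjoint makes the approximants hermitian and keeps the
      limit, since \<open>x\<close> is hermitian.\<close>
    define z where "z m s t = scaleR (1/2) (g s t m + star (g t s m))" for m s t
    \<comment> \<open>The added inverse makes the error bound strictly positive, as
      \<open>Psd_perturb\<close> requires, and tends to 0.\<close>
    define d where "d m = (\<Sum>s<n. \<Sum>t<n. norm (z m s t - x s t)) + inverse (real (Suc m))" for m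
    have z_lim: "(\<lambda>m. z m s t) \<longlonglongrightarrow> x s t" if st: "s < n" "t < n" for s t
    proof -
      have "(\<lambda>m. z m s t) \<longlonglongrightarrow> scaleR (1/2) (x s t + star (x t s))"
        unfolding z_def using g(2) st by (intro tendsto_intros bounded_linear.tendsto[OF bounded_linear_star])
      moreover have "scaleR (1/2) (x s t + star (x t s)) = x s t"
        using A.Psd_star[OF x st(2,1)] by (simp add: scaleR_right_distrib flip: scaleR_left_distrib)
      ultimately show ?thesis by simp
    qed
    have "(\<lambda>m. norm (z m s t - x s t)) \<longlonglongrightarrow> 0" if "s < n" "t < n" for s t
      using z_lim[OF that] by (intro tendsto_norm_zero) (simp add: LIM_zero_iff)
    then have "d \<longlonglongrightarrow> (\<Sum>s<n. \<Sum>t<n. 0) + 0"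
      unfolding d_def by (intro tendsto_add tendsto_sum LIMSEQ_inverse_real_of_nat) auto
    then have d0: "d \<longlonglongrightarrow> 0" by simp
    have d_le: "norm (z m s t - x s t) \<le> d m" if "s < n" "t < n" for m s t
    proof -
      have "norm (z m s t - x s t) \<le> (\<Sum>s<n. \<Sum>t<n. norm (z m s t - x s t))"
        using that by (intro double_sum_member[of "\<lambda>s t. norm (z m s t - x s t)"]) auto
      also have "\<dots> \<le> d m" by (simp add: d_def)
      finally show ?thesis .
    qed
    have d_pos: "0 < d m" for m unfolding d_def by (intro add_nonneg_pos sum_nonneg) auto
    define y where "y m s t = z m s t + scaleR (real n * d m) (one_fun s t)" for m s t
    have "A.Psd n (y m)" for m
      unfolding y_def
      by (rule A.Psd_perturb[OF x _ d_le d_pos]) (auto simp: z_def star_scaleR star_add star_star add.commute)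
    moreover have y_sec: "y m s t \<in> A.sec (k m)" if st: "s < n" "t < n" for m s t
    proof -
      have 1: "one_fun s t \<in> A.sec (k m)"
        using A.sec_subspace[of "k m"] by (auto simp: one_fun_def complex_subspace_def)
      have "g s t m + star (g t s m) \<in> A.sec (k m)"
        using A.sec_subspace[of "k m"] k[OF st] A.star_sec[OF k[OF st(2,1)]] by (auto simp: complex_subspace_def)
      then have "scaleC (of_real (1/2)) (g s t m + star (g t s m)) + scaleC (of_real (real n * d m)) (one_fun s t) \<in> A.sec (k m)"
        using A.sec_subspace[of "k m"] 1 by (auto simp: complex_subspace_def simp del: of_real_divide of_real_mult)
      then show ?thesis unfolding y_def z_def scaleC_of_real .
    qed
    ultimately have "B.Psd n (\<lambda>s t. f (y m s t))" for m
      using ucp[of "k m"] by (intro cp_Psd[of "A.sec (k m)" T]) (auto simp: ucp_map_def)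
    moreover have fF: "f (y m s t) = F (y m s t)" if "s < n" "t < n" for m s t
      using y_sec[OF that, of m] by (intro Ff) (auto simp: A.alg_def)
    ultimately have PF: "B.Psd n (\<lambda>s t. F (y m s t))" for m
      using B.Psd_cong[of n "\<lambda>s t. f (y m s t)" "\<lambda>s t. F (y m s t)"] by blast
    have FF: "(\<lambda>m. F (y m s t)) \<longlonglongrightarrow> F (x s t)" if st: "s < n" "t < n" for s t
    proof (rule Flim)
      have "(\<lambda>m. y m s t) \<longlonglongrightarrow> x s t + scaleR (real n * 0) (one_fun s t)"
        unfolding y_def by (intro tendsto_intros z_lim st d0)
      then show "(\<lambda>m. y m s t) \<longlonglongrightarrow> x s t" by simp
      show "x s t \<in> S" by (rule xS[OF st])
      show "y m s t \<in> S" for m using y_sec[OF st, of m] by (simp add: A.sec_def)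
    qed
    show ?thesis
    proof (rule B.Psd_limit[where x = "\<lambda>s t. F (x s t)" and y = "\<lambda>m s t. F (y m s t)"])
      show "(\<lambda>m. F (y m s t)) \<longlonglongrightarrow> F (x s t)" if "s < n" "t < n" for s t using that by (rule FF)
      show "B.Psd n (\<lambda>s t. F (y m s t))" for m by (rule PF)
    qed
  qed
  have "ucp_map S T F"
    unfolding ucp_map_def
  proof (intro conjI cpI)
    show "F ` S \<subseteq> T" using FT by blast
    show "complex_linear_on S F" unfolding complex_linear_on_def
      by (intro conjI ballI allI Fadd Fscale)
    show "F 1 = 1" by (rule F1)
  qed (rule FPsd)
  then show ?thesis using cont Ff by auto
qed

lemma extension_inverse:
  assumes "continuous_on S F" "continuous_on T G" "F ` S \<subseteq> T" "\<And>x. x \<in> A.alg \<Longrightarrow> G (F x) = x"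
    and x: "x \<in> S"
  shows "G (F x) = x"
proof -
  obtain g where g: "\<And>m. g m \<in> A.alg" "g \<longlonglongrightarrow> x" using A.alg_seq[OF x] by blast
  have "continuous_on S (\<lambda>x. G (F x))" by (rule continuous_on_compose2[OF assms(2,1,3)])
  then have "(\<lambda>m. G (F (g m))) \<longlonglongrightarrow> G (F x)"
    using g x A.alg_S by (intro continuous_on_tendsto_compose[where f = "\<lambda>x. G (F x)"] always_eventually) auto
  then have "g \<longlonglongrightarrow> G (F x)" using g(1) assms(4) by simp
  then show ?thesis using g(2) LIMSEQ_unique by blast
qed

lemma extension_masa:
  assumes "continuous_on S F" "\<And>d. d \<in> A.DA \<Longrightarrow> F d \<in> B.DA"
  shows "F ` uhf_masa p \<alpha> \<subseteq> uhf_masa q \<beta>"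
proof clarify
  fix d assume d: "d \<in> uhf_masa p \<alpha>"
  then obtain g where g: "\<And>m. g m \<in> A.DA" "g \<longlonglongrightarrow> d"
    unfolding A.masa_eq closure_sequential by blast
  have "d \<in> S" using d A.masa_S by blast
  then have "(\<lambda>m. F (g m)) \<longlonglongrightarrow> F d"
    using g A.DA_S by (intro continuous_on_tendsto_compose[OF assms(1)] always_eventually) auto
  then show "F d \<in> uhf_masa q \<beta>"
    unfolding B.masa_eq closure_sequential using assms(2) g(1) by (intro exI[of _ "\<lambda>m. F (g m)"]) blast
qed

text \<open>The triangles make successive maps agree on smaller sections, so each family glues to
  one map on the union of the sections. The two glued maps are mutually inverse there, and their
  extensions remain so by continuity.\<close>

lemma intertwining_imp_iso:
  assumes m: "strict_mono m" and n: "strict_mono n"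
    and \<phi>': "\<forall>k. ucp_map (A.sec (m k)) (B.sec (n (Suc k))) (\<phi> (Suc k))"
    and \<psi>': "\<forall>k. ucp_map (B.sec (n k)) (A.sec (m k)) (\<psi> k)"
    and \<psi>\<phi>': "\<forall>k. \<forall>x\<in>A.sec (m k). \<psi> (Suc k) (\<phi> (Suc k) x) = x"
    and \<phi>\<psi>': "\<forall>k. \<forall>y\<in>B.sec (n k). \<phi> (Suc k) (\<psi> k y) = y"
    and \<phi>D': "\<forall>k. \<phi> (Suc k) ` range (A.dg (m k)) \<subseteq> range (B.dg (n (Suc k)))"
    and \<psi>D': "\<forall>k. \<psi> k ` range (B.dg (n k)) \<subseteq> range (A.dg (m k))"
  shows "\<exists>\<phi>. unital_complete_order_iso S T \<phi> \<and> \<phi> ` uhf_masa p \<alpha> = uhf_masa q \<beta>"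
proof -
  interpret sw: uhf_pair q \<beta> T p \<alpha> S by unfold_locales
  note \<phi> = \<phi>'[rule_format] and \<psi> = \<psi>'[rule_format] and \<psi>\<phi> = \<psi>\<phi>'[rule_format]
    and \<phi>\<psi> = \<phi>\<psi>'[rule_format] and \<phi>D = \<phi>D'[rule_format] and \<psi>D = \<psi>D'[rule_format]
  have m_le: "k \<le> m k" and n_le: "k \<le> n k" for k
    using m n by (auto intro: strict_mono_imp_increasing)
  have m_mono: "m k \<le> m l" and n_mono: "n k \<le> n l" if "k \<le> l" for k l
    using m n that by (auto simp: strict_mono_less_eq)
  have \<phi>_in: "\<phi> (Suc k) x \<in> B.sec (n (Suc k))" if "x \<in> A.sec (m k)" for k x
    using \<phi>[of k] that by (auto simp: ucp_map_def completely_positive_map_def)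
  have \<psi>_in: "\<psi> k y \<in> A.sec (m k)" if "y \<in> B.sec (n k)" for k y
    using \<psi>[of k] that by (auto simp: ucp_map_def completely_positive_map_def)
  \<comment> \<open>Evaluate \<open>\<phi> (Suc (Suc l)) (\<psi> (Suc l) (\<phi> (Suc l) x))\<close>
    in two ways: the outer two maps cancel to give \<open>\<phi> (Suc l) x\<close>, the inner two to
    give \<open>\<phi> (Suc (Suc l)) x\<close>.\<close>
  have \<phi>_mono: "\<phi> (Suc l) x = \<phi> (Suc k) x" if "k \<le> l" "x \<in> A.sec (m k)" for k l x
    using that(1)
  proof (induction l rule: dec_induct)
    case (step l)
    have "x \<in> A.sec (m l)" using that(2) A.sec_mono[OF m_mono[OF step.hyps(1)]] by blast
    then have "\<phi> (Suc (Suc l)) (\<psi> (Suc l) (\<phi> (Suc l) x)) = \<phi> (Suc l) x" "\<psi> (Suc l) (\<phi> (Suc l) x) = x"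
      by (rule \<phi>\<psi>[OF \<phi>_in], rule \<psi>\<phi>)
    then show ?case using step.IH by simp
  qed simp
  have \<psi>_mono: "\<psi> l y = \<psi> k y" if "k \<le> l" "y \<in> B.sec (n k)" for k l y
    using that(1)
  proof (induction l rule: dec_induct)
    case (step l)
    have "y \<in> B.sec (n l)" using that(2) B.sec_mono[OF n_mono[OF step.hyps(1)]] by blast
    then have "\<psi> (Suc l) (\<phi> (Suc l) (\<psi> l y)) = \<psi> l y" "\<phi> (Suc l) (\<psi> l y) = y"
      by (rule \<psi>\<phi>[OF \<psi>_in], rule \<phi>\<psi>)
    then show ?case using step.IH by simp
  qed simp
  define f where "f x = \<phi> (Suc (LEAST k. x \<in> A.sec (m k))) x" for x
  define g where "g y = \<psi> (LEAST k. y \<in> B.sec (n k)) y" for y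
  have f: "f x = \<phi> (Suc k) x" if "x \<in> A.sec (m k)" for x k
    unfolding f_def using LeastI[of "\<lambda>k. x \<in> A.sec (m k)", OF that] Least_le[of "\<lambda>k. x \<in> A.sec (m k)", OF that]
    by (intro \<phi>_mono[symmetric])
  have g: "g y = \<psi> k y" if "y \<in> B.sec (n k)" for y k
    unfolding g_def using LeastI[of "\<lambda>k. y \<in> B.sec (n k)", OF that] Least_le[of "\<lambda>k. y \<in> B.sec (n k)", OF that]
    by (intro \<psi>_mono[symmetric])
  \<comment> \<open>Since k \<le> m k, every section lies in one of the subsequence.\<close>
  have ucp_f: "ucp_map (A.sec k) T f" for k
  proof (rule ucp_map_cong[OF \<phi> A.sec_subspace _ A.one_sec])
    show "A.sec k \<subseteq> A.sec (m k)" by (rule A.sec_mono[OF m_le])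
    then show "x \<in> A.sec k \<Longrightarrow> f x = \<phi> (Suc k) x" for x by (intro f) blast
    show "B.sec (n (Suc k)) \<subseteq> T" by (auto simp: B.sec_def)
  qed
  have ucp_g: "ucp_map (B.sec k) S g" for k
  proof (rule ucp_map_cong[OF \<psi> B.sec_subspace _ B.one_sec])
    show "B.sec k \<subseteq> B.sec (n k)" by (rule B.sec_mono[OF n_le])
    then show "x \<in> B.sec k \<Longrightarrow> g x = \<psi> k x" for x by (intro g) blast
    show "A.sec (m k) \<subseteq> S" by (auto simp: A.sec_def)
  qed
  obtain F where F: "ucp_map S T F" "continuous_on S F" "\<And>x. x \<in> A.alg \<Longrightarrow> F x = f x"
    using ucp_extend[OF ucp_f] by blast
  obtain G where G: "ucp_map T S G" "continuous_on T G" "\<And>y. y \<in> B.alg \<Longrightarrow> G y = g y"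
    using sw.ucp_extend[OF ucp_g] by blast
  have alg_m: "\<exists>k. x \<in> A.sec (m k)" if "x \<in> A.alg" for x
    using that A.sec_mono[OF m_le] by (auto simp: A.alg_def)
  have alg_n: "\<exists>k. y \<in> B.sec (n k)" if "y \<in> B.alg" for y
    using that B.sec_mono[OF n_le] by (auto simp: B.alg_def)
  have GF_alg: "G (F x) = x" if x: "x \<in> A.alg" for x
  proof -
    obtain k where k: "x \<in> A.sec (m k)" using alg_m[OF x] by blast
    have "\<phi> (Suc k) x \<in> B.alg" using \<phi>_in[OF k] by (auto simp: B.alg_def)
    then show ?thesis using F(3)[OF x] G(3) f[OF k] g[OF \<phi>_in[OF k]] \<psi>\<phi>[OF k] by simp
  qed
  have FG_alg: "F (G y) = y" if y: "y \<in> B.alg" for y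
  proof -
    obtain k where k: "y \<in> B.sec (n k)" using alg_n[OF y] by blast
    have "\<psi> k y \<in> A.alg" using \<psi>_in[OF k] by (auto simp: A.alg_def)
    then show ?thesis using G(3)[OF y] F(3) g[OF k] f[OF \<psi>_in[OF k]] \<phi>\<psi>[OF k] by simp
  qed
  have FT: "F ` S \<subseteq> T" and GS: "G ` T \<subseteq> S"
    using F(1) G(1) by (auto simp: ucp_map_def completely_positive_map_def)
  have GF: "G (F x) = x" if "x \<in> S" for x by (rule extension_inverse[OF F(2) G(2) FT GF_alg that])
  have FG: "F (G y) = y" if "y \<in> T" for y by (rule sw.extension_inverse[OF G(2) F(2) GS FG_alg that])
  have F_DA: "F d \<in> B.DA" if d: "d \<in> A.DA" for d
  proof -
    obtain k where "d \<in> range (A.dg k)" using d by (auto simp: A.DA_def)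
    then have dk: "d \<in> range (A.dg (m k))" using A.diag_mono[OF m_le] by blast
    then have "d \<in> A.sec (m k)" using A.dg_level d A.DA_S by (auto simp: A.sec_def)
    then have "F d = \<phi> (Suc k) d" using F(3) A.DA_alg d f by auto
    moreover have "\<phi> (Suc k) d \<in> range (B.dg (n (Suc k)))" using \<phi>D[of k] dk by blast
    ultimately show ?thesis by (auto simp: B.DA_def)
  qed
  have G_DA: "G d \<in> A.DA" if d: "d \<in> B.DA" for d
  proof -
    obtain k where "d \<in> range (B.dg k)" using d by (auto simp: B.DA_def)
    then have dk: "d \<in> range (B.dg (n k))" using B.diag_mono[OF n_le] by blast
    then have "d \<in> B.sec (n k)" using B.dg_level d B.DA_S by (auto simp: B.sec_def)
    then have "G d = \<psi> k d" using G(3) B.DA_alg d g by auto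
    moreover have "\<psi> k d \<in> range (A.dg (m k))" using \<psi>D[of k] dk by blast
    ultimately show ?thesis by (auto simp: A.DA_def)
  qed
  have "F ` uhf_masa p \<alpha> = uhf_masa q \<beta>"
  proof
    show "F ` uhf_masa p \<alpha> \<subseteq> uhf_masa q \<beta>" by (rule extension_masa[OF F(2) F_DA])
    have "G ` uhf_masa q \<beta> \<subseteq> uhf_masa p \<alpha>" by (rule sw.extension_masa[OF G(2) G_DA])
    then show "uhf_masa q \<beta> \<subseteq> F ` uhf_masa p \<alpha>" using FG B.masa_S by (force simp: image_iff)
  qed
  moreover have bij: "bij_betw F S T" using GF FG FT GS by (intro bij_betw_byWitness[where f' = G]) auto
  moreover have "ucp_map T S (inv_into S F)"
  proof (rule ucp_map_cong[OF G(1)])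
    show "complex_subspace T" using B.S_zero B.S_add B.S_scale by (simp add: complex_subspace_def)
    show "inv_into S F y = G y" if "y \<in> T" for y
      using bij that GS FG by (intro inv_into_f_eq) (auto simp: bij_betw_def)
  qed auto
  ultimately show ?thesis using F(1) by (auto simp: unital_complete_order_iso_def ucp_map_def)
qed

lemma iso_imp_masa_iso:
  assumes iso: "unital_complete_order_iso S T \<phi>" and masa: "\<phi> ` uhf_masa p \<alpha> = uhf_masa q \<beta>"
  shows "masa_iso p \<alpha> S q \<beta> T \<phi> (inv_into S \<phi>)"
proof
  have bij: "bij_betw \<phi> S T" and u: "ucp_map S T \<phi>" and cp: "completely_positive_map T S (inv_into S \<phi>)"
    using iso by (auto simp: unital_complete_order_iso_def)
  have inj: "inj_on \<phi> S" and im: "\<phi> ` S = T" using bij by (auto simp: bij_betw_def)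
  show "ucp_map S T \<phi>" by fact
  have 1: "inv_into S \<phi> 1 = 1" using inv_into_f_f[OF inj A.S_one] u by (simp add: ucp_map_def)
  then show "ucp_map T S (inv_into S \<phi>)" using cp by (simp add: ucp_map_def)
  show "x \<in> S \<Longrightarrow> inv_into S \<phi> (\<phi> x) = x" for x using inj by simp
  show "y \<in> T \<Longrightarrow> \<phi> (inv_into S \<phi> y) = y" for y using im by (auto intro: f_inv_into_f)
  show "\<phi> ` uhf_masa p \<alpha> \<subseteq> uhf_masa q \<beta>" using masa by simp
  show "inv_into S \<phi> ` uhf_masa q \<beta> \<subseteq> uhf_masa p \<alpha>"
    unfolding masa[symmetric] using inj A.masa_S by (auto simp: subset_iff)
qed

end

context masa_iso
begin

lemma intertwining:
  "\<exists>m n \<Phi> \<Psi>. strict_mono m \<and> strict_mono n \<and>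
    ucp_map (A.sec 0) (B.sec (n 0)) (\<Phi> 0) \<and>
    (\<forall>k. ucp_map (A.sec (m k)) (B.sec (n (Suc k))) (\<Phi> (Suc k))) \<and>
    (\<forall>k. ucp_map (B.sec (n k)) (A.sec (m k)) (\<Psi> k)) \<and>
    (\<forall>x\<in>A.sec 0. \<Psi> 0 (\<Phi> 0 x) = x) \<and>
    (\<forall>k. \<forall>x\<in>A.sec (m k). \<Psi> (Suc k) (\<Phi> (Suc k) x) = x) \<and>
    (\<forall>k. \<forall>y\<in>B.sec (n k). \<Phi> (Suc k) (\<Psi> k y) = y) \<and>
    (\<forall>k. \<Phi> (Suc k) ` range (A.dg (m k)) \<subseteq> range (B.dg (n (Suc k)))) \<and>
    (\<forall>k. \<Psi> k ` range (B.dg (n k)) \<subseteq> range (A.dg (m k)))"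
proof -
  interpret sw: masa_iso q \<beta> T p \<alpha> S \<psi> \<phi> by (rule swap)
  obtain N where N: "\<And>m n. N m \<le> n \<Longrightarrow> good m n" using good_ex by metis
  obtain M where M: "\<And>n m. M n \<le> m \<Longrightarrow> sw.good n m" using sw.good_ex by metis
  \<comment> \<open>The new n is chosen first, beyond \<open>N m\<close>, and the new m then has to
    be large for that n. The successors in the maxima make both sequences strictly
    increasing.\<close>
  define step where "step = (\<lambda>(m, n). let n' = max (N m) (Suc n) in (max (M n') (Suc m), n'))"
  define s where "s = rec_nat (M (N 0), N 0) (\<lambda>_. step)"
  define m n where "m k = fst (s k)" and "n k = snd (s k)" for k
  have 0: "n 0 = N 0" "m 0 = M (N 0)" by (auto simp: m_def n_def s_def)
  have Suc: "n (Suc k) = max (N (m k)) (Suc (n k))" "m (Suc k) = max (M (n (Suc k))) (Suc (m k))" for k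
    by (auto simp: m_def n_def s_def step_def Let_def case_prod_unfold)
  have mono: "strict_mono m" "strict_mono n"
    unfolding strict_mono_Suc_iff by (auto simp: Suc)
  have g0: "good 0 (n 0)" and g: "good (m k) (n (Suc k))" for k
    by (auto intro: N simp: 0 Suc)
  have h: "sw.good (n k) (m k)" for k
    by (cases k) (auto intro: M simp: 0 Suc)
  define \<Phi> where "\<Phi> = case_nat (Phi 0) (\<lambda>k. Phi (m k))"
  define \<Psi> where "\<Psi> k = sw.Phi (n k)" for k
  have [simp]: "\<Phi> 0 = Phi 0" "\<Phi> (Suc k) = Phi (m k)" for k by (auto simp: \<Phi>_def)
  show ?thesis
  proof (rule exI[of _ m], rule exI[of _ n], rule exI[of _ \<Phi>], rule exI[of _ \<Psi>], intro conjI allI ballI mono)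
    fix k
    show "\<Phi> (Suc k) ` range (A.dg (m k)) \<subseteq> range (B.dg (n (Suc k)))"
      using Phi_diag[OF g] by auto
    show "\<Psi> k ` range (B.dg (n k)) \<subseteq> range (A.dg (m k))"
      using sw.Phi_diag[OF h] by (auto simp: \<Psi>_def)
  qed (auto simp: \<Psi>_def intro: Phi_ucp[OF g0] Phi_ucp[OF g] sw.Phi_ucp[OF h] Phi_inverse[OF g0]
      Phi_inverse[OF g] sw.Phi_inverse[OF h])
qed

end

text \<open>Counting starts at 0: section 0 is the first section, and \<open>n 0\<close>,
  \<open>m 0\<close> are the first terms of the subsequences. As connecting maps are inclusions,
  commuting triangles become identities on sections.\<close>

theorem theorem6p16:
  fixes p q :: "nat \<Rightarrow> nat"
    and \<alpha> :: "nat \<Rightarrow> complex mat \<Rightarrow> 'a::cstar_algebra"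
    and \<beta> :: "nat \<Rightarrow> complex mat \<Rightarrow> 'b::cstar_algebra"
    and S :: "'a set" and T :: "'b set"
  assumes "uhf_limit p \<alpha>"
    and "uhf_limit q \<beta>"
    and "concrete_operator_system (uhf_masa p \<alpha>) S"
    and "concrete_operator_system (uhf_masa q \<beta>) T"
  shows "(\<exists>\<phi>. unital_complete_order_iso S T \<phi> \<and> \<phi> ` uhf_masa p \<alpha> = uhf_masa q \<beta>)
    \<longleftrightarrow>
    (\<exists>(m :: nat \<Rightarrow> nat) (n :: nat \<Rightarrow> nat) (\<phi> :: nat \<Rightarrow> 'a \<Rightarrow> 'b) (\<psi> :: nat \<Rightarrow> 'b \<Rightarrow> 'a).
      strict_mono m \<and> strict_mono n \<and>
      ucp_map (uhf_section p \<alpha> S 0) (uhf_section q \<beta> T (n 0)) (\<phi> 0) \<and>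
      (\<forall>k. ucp_map (uhf_section p \<alpha> S (m k)) (uhf_section q \<beta> T (n (Suc k))) (\<phi> (Suc k))) \<and>
      (\<forall>k. ucp_map (uhf_section q \<beta> T (n k)) (uhf_section p \<alpha> S (m k)) (\<psi> k)) \<and>
      (\<forall>x \<in> uhf_section p \<alpha> S 0. \<psi> 0 (\<phi> 0 x) = x) \<and>
      (\<forall>k. \<forall>x \<in> uhf_section p \<alpha> S (m k). \<psi> (Suc k) (\<phi> (Suc k) x) = x) \<and>
      (\<forall>k. \<forall>y \<in> uhf_section q \<beta> T (n k). \<phi> (Suc k) (\<psi> k y) = y) \<and>
      (\<forall>k. \<phi> (Suc k) ` uhf_diag p \<alpha> (m k) \<subseteq> uhf_diag q \<beta> (n (Suc k))) \<and>
      (\<forall>k. \<psi> k ` uhf_diag q \<beta> (n k) \<subseteq> uhf_diag p \<alpha> (m k)))"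
proof -
  interpret uhf_pair p \<alpha> S q \<beta> T
    by unfold_locales (fact assms)+
  show ?thesis
    unfolding A.section_eq B.section_eq A.diag_eq B.diag_eq
    by (rule iffI)
      ((elim exE conjE, rule masa_iso.intertwining[OF iso_imp_masa_iso]; assumption),
       (elim exE conjE, rule intertwining_imp_iso; assumption))
qed

end
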